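(* Let $\alpha\in\mathbb{R}\setminus\mathbb{Q}$, let $m\ge 1$, and let $v\in C^{\omega}(\mathbb{T},\mathbb{R})$ be the real-valued trigonometric polynomial $$v(x)=\sum_{k=-m}^{m}\widehat{v}_k\,\mathrm{e}^{2\pi\mathrm{i}kx},\qquad \widehat v_m\neq 0.$$ For every $y>\gamma_m(0)$, put $g=2\pi m y+\log|\widehat{v}_m|$ and let $\Sigma(g,y)$ be the spectrum of the operator $\mathcal{H}(g,x+\mathrm{i}y)$ on $\ell^2(\mathbb{Z})$, $$[\mathcal{H}(g,x+\mathrm{i}y)u]_{n}=-\mathrm{e}^{g}u_{n+1}-\mathrm{e}^{-g}u_{n-1}+v(x+n\alpha+\mathrm{i}y)u_{n}.$$ Then $\Sigma(g,y)$ has positive two-dimensional Lebesgue measure in $\mathbb{C}$.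
   Context: $\mathbb{T}=\mathbb{R}/\mathbb{Z}$. The trigonometric polynomial $v$ is extended to complex arguments by its formula. The spectrum of $\mathcal{H}(g,x+\mathrm{i}y)$ does not depend on $x\in\mathbb{T}$ (irrational rotations are minimal). The numbers $\gamma_j(E)$: the dual operator is $$[\widehat{L}(x)u]_n=-\sum_{k=-m}^{m}\widehat{v}_k u_{n+k}+2\cos 2\pi(x+n\alpha)\,u_n .$$ For $E\in\mathbb{C}$, the equation $\widehat{L}(x)u=Eu$, i.e. $$u_{n+m}=\widehat v_m^{-1}\Big[(2\cos2\pi(x+n\alpha)-E)u_n-\sum_{k=-m}^{m-1}\widehat v_k u_{n+k}\Big],$$ defines a $2m$-dimensional linear cocycle over $x\mapsto x+\alpha$ on $\mathbb{T}$ (transfer matrices sending $(u_{n+m-1},\dots,u_{n-m})^{T}$ to $(u_{n+m},\dots,u_{n-m+1})^{T}$). This cocycle is symplectic, so its $2m$ Lyapunov exponents (with respect to Lebesgue measure on $\mathbb{T}$, counted with multiplicity) come in pairs $\pm\gamma_1(E),\dots,\pm\gamma_m(E)$, ordered so that $0\leqslant\gamma_1(E)\leqslant\cdots\leqslant\gamma_m(E)$. *)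

theory Defs
  imports "HOL-Analysis.Analysis" "Jordan_Normal_Form.Schur_Decomposition"
begin

hide_const (open) Finite_Cartesian_Product.vec Finite_Cartesian_Product.mat
no_notation Finite_Cartesian_Product.vec_nth (infixl \<open>$\<close> 90)

definition ell2 :: "(int \<Rightarrow> complex) set"
  where "ell2 = {u. (\<lambda>n. (cmod (u n))\<^sup>2) summable_on UNIV}"

definition ell2_norm :: "(int \<Rightarrow> complex) \<Rightarrow> real"
  where "ell2_norm u = sqrt (\<Sum>\<^sub>\<infinity>n. (cmod (u n))\<^sup>2)"

definition bounded_op :: "((int \<Rightarrow> complex) \<Rightarrow> (int \<Rightarrow> complex)) \<Rightarrow> bool"
  where "bounded_op T \<longleftrightarrow>
    (\<forall>u\<in>ell2. T u \<in> ell2) \<and>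
    (\<forall>u\<in>ell2. \<forall>w\<in>ell2. T (\<lambda>n. u n + w n) = (\<lambda>n. T u n + T w n)) \<and>
    (\<forall>c. \<forall>u\<in>ell2. T (\<lambda>n. c * u n) = (\<lambda>n. c * T u n)) \<and>
    (\<exists>C. \<forall>u\<in>ell2. ell2_norm (T u) \<le> C * ell2_norm u)"

text \<open>
  Only meaningful for \<^term>\<open>bounded_op T\<close>; \<open>R\<close> is the resolvent, a two-sided inverse of
  \<open>T - z\<close> on \<^const>\<open>ell2\<close>.
\<close>
definition op_spectrum :: "((int \<Rightarrow> complex) \<Rightarrow> (int \<Rightarrow> complex)) \<Rightarrow> complex set"
  where "op_spectrum T = {z. \<not> (\<exists>R. bounded_op R \<and>
    (\<forall>u\<in>ell2. R (\<lambda>n. T u n - z * u n) = u \<and> (\<lambda>n. T (R u) n - z * R u n) = u))}"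

definition trig_poly :: "nat \<Rightarrow> (int \<Rightarrow> complex) \<Rightarrow> complex \<Rightarrow> complex"
  where "trig_poly m vh z =
    (\<Sum>k\<in>{- int m..int m}. vh k * exp (2 * of_real pi * \<i> * of_int k * z))"

definition hop :: "real \<Rightarrow> (complex \<Rightarrow> complex) \<Rightarrow> real \<Rightarrow> complex \<Rightarrow>
    (int \<Rightarrow> complex) \<Rightarrow> (int \<Rightarrow> complex)"
  where "hop \<alpha> v g z u = (\<lambda>n.
    - of_real (exp g) * u (n + 1) - of_real (exp (- g)) * u (n - 1)
    + v (z + of_int n * of_real \<alpha>) * u n)"

definition dual_op :: "real \<Rightarrow> nat \<Rightarrow> (int \<Rightarrow> complex) \<Rightarrow> real \<Rightarrow>
    (int \<Rightarrow> complex) \<Rightarrow> (int \<Rightarrow> complex)"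
  where "dual_op \<alpha> m vh x u = (\<lambda>n.
    - (\<Sum>k\<in>{- int m..int m}. vh k * u (n + k))
    + of_real (2 * cos (2 * pi * (x + of_int n * \<alpha>))) * u n)"

text \<open>
  The list of singular values of a square matrix, i.e. of the square roots of the eigenvalues of
  \<open>A\<^sup>* A\<close> with algebraic multiplicity, in nonincreasing order (so index \<open>0\<close> is the largest).
\<close>
definition singular_values :: "complex mat \<Rightarrow> real list"
  where "singular_values A = rev (sorted_list_of_multiset
    (image_mset (\<lambda>z. sqrt (Re z)) (proots (char_poly (mat_adjoint A * A)))))"

text \<open>\<open>A\<^sub>n(x) = A(x + (n - 1)\<alpha>) \<cdots> A(x + \<alpha>) A(x)\<close>\<close>
primrec cocycle_iterate :: "real \<Rightarrow> (real \<Rightarrow> complex mat) \<Rightarrow> nat \<Rightarrow> real \<Rightarrow> complex mat"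
  where
    "cocycle_iterate \<alpha> A 0 x = 1\<^sub>m (dim_row (A x))"
  | "cocycle_iterate \<alpha> A (Suc n) x = A (x + of_nat n * \<alpha>) * cocycle_iterate \<alpha> A n x"

text \<open>
  For a continuous, invertible, \<open>1\<close>-periodic \<open>d \<times> d\<close> matrix function \<open>A\<close> and \<open>1 \<le> k \<le> d\<close>, the
  \<open>k\<close>-th Lyapunov exponent of the cocycle \<open>(\<alpha>, A)\<close> with respect to Lebesgue measure on the circle,
  in the nonincreasing order \<open>L\<^sub>1 \<ge> \<dots> \<ge> L\<^sub>d\<close> with multiplicity:
  \<open>L\<^sub>k = lim 1/n \<integral> log \<sigma>\<^sub>k(A\<^sub>n(x)) dx\<close>.
\<close>
definition lyapunov_exponent :: "real \<Rightarrow> (real \<Rightarrow> complex mat) \<Rightarrow> nat \<Rightarrow> real"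
  where "lyapunov_exponent \<alpha> A k =
    lim (\<lambda>n. (LBINT x:{0..1}. ln (singular_values (cocycle_iterate \<alpha> A n x) ! (k - 1))) / real n)"

text \<open>
  \<open>(u\<^sub>n\<^sub>+\<^sub>m\<^sub>-\<^sub>1, \<dots>, u\<^sub>n\<^sub>-\<^sub>m)\<^sup>T\<close>: entry \<open>j\<close> is \<open>u\<^sub>n\<^sub>+\<^sub>m\<^sub>-\<^sub>1\<^sub>-\<^sub>j\<close>.
\<close>
definition state_vec :: "nat \<Rightarrow> (int \<Rightarrow> complex) \<Rightarrow> int \<Rightarrow> complex vec"
  where "state_vec m u n = vec (2 * m) (\<lambda>j. u (n + int m - 1 - int j))"

text \<open>
  Column \<open>j\<close> of row \<open>0\<close> is the coefficient of \<open>u\<^sub>n\<^sub>+\<^sub>k\<close> with \<open>k = m - 1 - j\<close> in the equation for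
  \<open>u\<^sub>n\<^sub>+\<^sub>m\<close>; the other rows shift.
\<close>
definition dual_transfer :: "nat \<Rightarrow> (int \<Rightarrow> complex) \<Rightarrow> complex \<Rightarrow> real \<Rightarrow> complex mat"
  where "dual_transfer m vh E x = mat (2 * m) (2 * m) (\<lambda>(i, j).
    if i = 0 then
      (let k = int m - 1 - int j in
        ((if k = 0 then of_real (2 * cos (2 * pi * x)) - E else 0) - vh k) / vh (int m))
    else if i = Suc j then 1 else 0)"

lemma dual_op_eigen_iff_dual_transfer:
  assumes m: "m \<ge> 1" and vm: "vh (int m) \<noteq> 0"
  shows "(\<forall>n. dual_op \<alpha> m vh x u n = E * u n) \<longleftrightarrow>
    (\<forall>n. state_vec m u (n + 1) = dual_transfer m vh E (x + of_int n * \<alpha>) *\<^sub>v state_vec m u n)"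
proof -
  have "dual_op \<alpha> m vh x u n = E * u n \<longleftrightarrow>
    state_vec m u (n + 1) = dual_transfer m vh E (x + of_int n * \<alpha>) *\<^sub>v state_vec m u n" for n
  proof -
    define c where "c = complex_of_real (2 * cos (2 * pi * (x + of_int n * \<alpha>)))"
    define T where "T = dual_transfer m vh E (x + of_int n * \<alpha>)"
    define S where "S = (\<Sum>k\<in>{- int m..<int m}. vh k * u (n + k))"
    have entry: "(T *\<^sub>v state_vec m u n) $ i = (\<Sum>j<2*m. T $$ (i,j) * u (n + int m - 1 - int j))"
      if "i < 2 * m" for i
      using that by (auto simp: T_def dual_transfer_def state_vec_def scalar_prod_def lessThan_atLeast0
        intro!: sum.cong)
    have shift: "(T *\<^sub>v state_vec m u n) $ i = state_vec m u (n + 1) $ i" if "i < 2 * m" "i \<noteq> 0" for i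
    proof -
      from \<open>i \<noteq> 0\<close> obtain j where j: "i = Suc j" by (cases i) auto
      have "(\<Sum>l<2*m. T $$ (i,l) * u (n + int m - 1 - int l))
          = (\<Sum>l<2*m. if l = j then u (n + int m - 1 - int l) else 0)"
        using that j by (intro sum.cong) (auto simp: T_def dual_transfer_def)
      also have "\<dots> = u (n + int m - 1 - int j)"
        using that j by simp
      finally show ?thesis using that j entry[of i] by (simp add: state_vec_def diff_diff_eq)
    qed
    have "(T *\<^sub>v state_vec m u n) $ 0 = (\<Sum>j<2*m. T $$ (0,j) * u (n + int m - 1 - int j))"
      using m by (intro entry) auto
    also have "\<dots> = (\<Sum>k\<in>{- int m..<int m}. ((if k = 0 then c - E else 0) - vh k) / vh (int m) * u (n + k))"
      by (rule sum.reindex_bij_witness[of _ "\<lambda>k. nat (int m - 1 - k)" "\<lambda>j. int m - 1 - int j"])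
        (auto simp: T_def dual_transfer_def c_def Let_def algebra_simps)
    also have "\<dots> = (\<Sum>k\<in>{- int m..<int m}.
        ((if k = 0 then (c - E) * u n else 0) - vh k * u (n + k)) / vh (int m))"
      by (intro sum.cong) (auto simp: left_diff_distrib diff_divide_distrib)
    also have "\<dots> = ((c - E) * u n - S) / vh (int m)"
      using m by (simp add: sum_divide_distrib[symmetric] sum_subtractf S_def)
    finally have row0: "(T *\<^sub>v state_vec m u n) $ 0 = ((c - E) * u n - S) / vh (int m)" .
    have "{- int m..int m} = insert (int m) {- int m..<int m}" by auto
    then have "dual_op \<alpha> m vh x u n = - (vh (int m) * u (n + int m) + S) + c * u n"
      by (simp add: dual_op_def S_def c_def)
    then have "dual_op \<alpha> m vh x u n - E * u n = ((c - E) * u n - S) - u (n + int m) * vh (int m)"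
      by (simp add: algebra_simps)
    then have "dual_op \<alpha> m vh x u n = E * u n \<longleftrightarrow> u (n + int m) * vh (int m) = (c - E) * u n - S"
      by (metis right_minus_eq)
    also have "\<dots> \<longleftrightarrow> u (n + int m) = ((c - E) * u n - S) / vh (int m)"
      using vm by (simp add: eq_divide_eq)
    also have "\<dots> \<longleftrightarrow> state_vec m u (n + 1) $ 0 = (T *\<^sub>v state_vec m u n) $ 0"
      using m row0 by (simp add: state_vec_def)
    also have "\<dots> \<longleftrightarrow> state_vec m u (n + 1) = T *\<^sub>v state_vec m u n"
    proof
      assume "state_vec m u (n + 1) $ 0 = (T *\<^sub>v state_vec m u n) $ 0"
      then have "state_vec m u (n + 1) $ i = (T *\<^sub>v state_vec m u n) $ i" if "i < 2 * m" for i
        using that shift[of i] by (cases "i = 0") auto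
      then show "state_vec m u (n + 1) = T *\<^sub>v state_vec m u n"
        by (intro eq_vecI) (auto simp: T_def dual_transfer_def state_vec_def)
    qed simp
    finally show ?thesis by (simp add: T_def)
  qed
  then show ?thesis by simp
qed

text \<open>
  The \<open>2m\<close> exponents \<open>L\<^sub>1 \<ge> \<dots> \<ge> L\<^sub>2\<^sub>m\<close> of the dual cocycle are \<open>\<plusminus>\<gamma>\<^sub>1, \<dots>, \<plusminus>\<gamma>\<^sub>m\<close> with
  \<open>0 \<le> \<gamma>\<^sub>1 \<le> \<dots> \<le> \<gamma>\<^sub>m\<close>, hence \<open>\<gamma>\<^sub>j = L\<^sub>m\<^sub>+\<^sub>1\<^sub>-\<^sub>j\<close> for \<open>1 \<le> j \<le> m\<close>.
\<close>
definition dual_gamma :: "real \<Rightarrow> nat \<Rightarrow> (int \<Rightarrow> complex) \<Rightarrow> nat \<Rightarrow> complex \<Rightarrow> real"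
  where "dual_gamma \<alpha> m vh j E = lyapunov_exponent \<alpha> (dual_transfer m vh E) (m + 1 - j)"

end

theory Submission
  imports Defs
begin

text \<open>
The spectrum contains a whole disc around \<open>0\<close>. Put \<open>\<zeta>\<^sub>n = exp (2\<pi>\<i>(x + \<i>y + n\<alpha>))\<close>, so that all
\<open>\<zeta>\<^sub>n\<close> lie on the circle of radius \<open>r = exp (-2\<pi>y)\<close>, and suppose that some \<open>E\<close> near \<open>0\<close> does not lie in the
spectrum. The symmetric recurrence \<open>- u\<^sub>n\<^sub>+\<^sub>1 - u\<^sub>n\<^sub>-\<^sub>1 + (v - E) u\<^sub>n = \<delta>\<^sub>n\<^sub>k\<close> then has two Green's functions.

The first comes from the resolvent. Its kernel \<open>\<Gamma>\<close> decays like \<open>exp (-\<delta>\<bar>n - k\<bar>)\<close> by the Combes--Thomas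
argument, and \<open>exp (g(n - k)) \<Gamma>\<close> solves the symmetric recurrence.

The second comes from duality. Expanding the inverse of the operator with \<open>g = 0\<close> in powers of \<open>\<zeta>\<close> gives
\<open>G(n,k) = G\<^sub>n\<^sub>-\<^sub>k(\<zeta>\<^sub>n)\<close> with power series \<open>G\<^sub>j\<close>, whose coefficients, summed over \<open>j\<close> against characters
and conjugated, solve the dual equation at energy \<open>- cnj E\<close>. The number \<open>\<gamma>\<^sub>m(0)\<close> is the top Lyapunov exponent of the dual
cocycle. Since \<open>0 \<le> \<gamma>\<^sub>m(0) < y < 2\<pi>y\<close>, products of \<open>n\<close> dual transfer matrices at energies near \<open>0\<close> are at
most of order \<open>exp (\<kappa>n)\<close> with \<open>\<kappa> < 2\<pi>y\<close>, uniformly in the phase (subadditivity and equidistribution).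
Hence the power series converge beyond \<open>\<bar>\<zeta>\<bar> = r\<close>, and \<open>G(n,k)\<close> decays exponentially.

Two such Green's functions can be related in only two ways: either they coincide, or \<open>\<Gamma>\<close> is causal, that is
\<open>\<Gamma>(n,k) = 0\<close> for \<open>n \<le> k\<close> (\<open>green_function_dichotomy\<close>). Both are refuted by one principle: along an orbit
of an irrational rotation, the supremum of a function dominates each of its Fourier coefficients
(\<open>orbit_bound_imp_coeff_bound\<close>). Note that \<open>exp g = \<bar>v\<^sub>m\<bar> / r\<^sup>m\<close>.

\<^item> The lowest coefficient of \<open>G\<^sub>-\<^sub>l\<close> has modulus \<open>\<bar>v\<^sub>m\<bar>\<close> to the power \<open>-(l + 1)\<close> and degree \<open>m(l + 1)\<close>, so
  the supremum of \<open>\<bar>G(k - l, k)\<bar>\<close> over \<open>k\<close> is at least \<open>exp (-g(l + 1))\<close>; if the two functions coincided,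
  it would be at most \<open>C exp (-(g + \<delta>)l)\<close>.
\<^item> A causal \<open>\<Gamma>\<close> is built from continuants. Up to powers of \<open>\<zeta>\<close> these are polynomials in \<open>\<zeta>\<close> with constant
  term \<open>v\<^sub>-\<^sub>m\<close> to the power \<open>l\<close>, so their supremum is at least \<open>exp (gl)\<close>; but the decay of \<open>\<Gamma>\<close> bounds
  them by a multiple of \<open>exp ((g - \<delta>)l)\<close>.

So the disc lies in the spectrum. The spectrum is closed, hence measurable, and has positive measure.
\<close>

section \<open>Equidistribution of irrational rotations\<close>

definition character :: "int \<Rightarrow> real \<Rightarrow> complex"
  where "character k x = cis (2 * pi * of_int k * x)"

lemma norm_character [simp]: "norm (character k x) = 1"
  by (simp add: character_def)

lemma character_0 [simp]: "character 0 x = 1"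
  by (simp add: character_def)

lemma character_add_right: "character k (x + y) = character k x * character k y"
  by (simp add: character_def cis_mult algebra_simps)

lemma character_add_left: "character (k + l) x = character k x * character l x"
  by (simp add: character_def cis_mult algebra_simps)

lemma character_nonzero [simp]: "character k x \<noteq> 0"
  by (simp add: character_def)

lemma cnj_character: "cnj (character k x) = character (- k) x"
  by (simp add: character_def cis_cnj)

lemma character_uminus_right: "character k (- x) = character (- k) x"
  by (simp add: character_def)

lemma character_of_nat_mult: "character k (of_nat n * x) = character k x ^ n"
  unfolding character_def Complex.DeMoivre by (rule arg_cong[of _ _ cis]) simp

lemma character_of_nat: "character (int n) x = character 1 x ^ n"
  unfolding character_def Complex.DeMoivre by (rule arg_cong[of _ _ cis]) simp

lemma cis_2pi_eq_iff: "cis (2 * pi * s) = cis (2 * pi * t) \<longleftrightarrow> (\<exists>n::int. s = t + of_int n)"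
proof -
  have "cis (2 * pi * s) = cis (2 * pi * t) \<longleftrightarrow>
      (\<exists>n::int. \<i> * complex_of_real (2 * pi * s) = \<i> * complex_of_real (2 * pi * t) + of_int (2 * n) * pi * \<i>)"
    by (simp add: cis_conv_exp exp_eq)
  also have "\<dots> \<longleftrightarrow> (\<exists>n::int. s = t + of_int n)"
  proof (intro ex_cong1)
    fix n :: int
    have "\<i> * complex_of_real (2 * pi * s) = \<i> * complex_of_real (2 * pi * t) + of_int (2 * n) * pi * \<i>
       \<longleftrightarrow> complex_of_real (2 * pi * s) = complex_of_real (2 * pi * (t + of_int n))"
      by (auto simp: complex_eq_iff algebra_simps)
    also have "\<dots> \<longleftrightarrow> s = t + of_int n"
      by (subst of_real_eq_iff) simp
    finally show "\<i> * complex_of_real (2 * pi * s) = \<i> * complex_of_real (2 * pi * t) + of_int (2 * n) * pi * \<i>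
       \<longleftrightarrow> s = t + of_int n" .
  qed
  finally show ?thesis .
qed

lemma character_irrational_neq_1:
  assumes "\<alpha> \<notin> \<rat>" "k \<noteq> 0"
  shows "character k \<alpha> \<noteq> 1"
proof
  assume "character k \<alpha> = 1"
  then have "cis (2 * pi * (of_int k * \<alpha>)) = cis (2 * pi * 0)"
    by (simp add: character_def mult_ac)
  then obtain n :: int where "of_int k * \<alpha> = 0 + of_int n"
    unfolding cis_2pi_eq_iff by blast
  then have "\<alpha> = of_int n / of_int k" using assms(2) by (simp add: field_simps)
  then show False using assms(1) by simp
qed

text \<open>
  Along the orbit the character is a geometric sequence with ratio different from \<open>1\<close>, so the sums do not
  grow with \<open>N\<close>.
\<close>
lemma norm_sum_character_orbit_le:
  assumes "\<alpha> \<notin> \<rat>" "k \<noteq> 0"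
  shows "norm (\<Sum>n<N. character k (x + of_nat n * \<alpha>)) \<le> 2 / norm (character k \<alpha> - 1)"
proof -
  let ?q = "character k \<alpha>"
  have q: "?q \<noteq> 1" using assms by (rule character_irrational_neq_1)
  have "(\<Sum>n<N. character k (x + of_nat n * \<alpha>)) = character k x * ((?q ^ N - 1) / (?q - 1))"
    by (simp add: character_add_right character_of_nat_mult geometric_sum[OF q] flip: sum_distrib_left)
  also have "norm \<dots> = norm (?q ^ N - 1) / norm (?q - 1)"
    by (simp add: norm_mult norm_divide)
  also have "\<dots> \<le> 2 / norm (?q - 1)"
  proof (intro divide_right_mono)
    have "norm (?q ^ N - 1) \<le> norm (?q ^ N) + norm (1::complex)" by (rule norm_triangle_ineq4)
    then show "norm (?q ^ N - 1) \<le> 2" by (simp add: norm_power)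
  qed simp
  finally show ?thesis .
qed

definition orbit_average :: "real \<Rightarrow> (real \<Rightarrow> 'a::real_normed_vector) \<Rightarrow> nat \<Rightarrow> real \<Rightarrow> 'a"
  where "orbit_average \<alpha> f N x = (\<Sum>n<N. f (x + of_nat n * \<alpha>)) /\<^sub>R real N"

lemma orbit_average_add:
  "orbit_average \<alpha> (\<lambda>x. f x + g x) N x = orbit_average \<alpha> f N x + orbit_average \<alpha> g N x"
  by (simp add: orbit_average_def sum.distrib scaleR_add_right)

lemma orbit_average_diff:
  "orbit_average \<alpha> (\<lambda>x. f x - g x) N x = orbit_average \<alpha> f N x - orbit_average \<alpha> g N x"
  by (simp add: orbit_average_def sum_subtractf scaleR_diff_right)

lemma norm_orbit_average_le:
  assumes "\<And>n. norm (f (x + of_nat n * \<alpha>)) \<le> B"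
  shows "norm (orbit_average \<alpha> f N x) \<le> B"
proof (cases "N = 0")
  case True
  then show ?thesis using order_trans[OF norm_ge_zero assms] by (simp add: orbit_average_def)
next
  case False
  have "norm (\<Sum>n<N. f (x + of_nat n * \<alpha>)) \<le> real N * B"
    using sum_norm_bound[of "{..<N}" "\<lambda>n. f (x + of_nat n * \<alpha>)" B] assms by simp
  then show ?thesis using False by (simp add: orbit_average_def divide_inverse_commute[symmetric] pos_divide_le_eq mult.commute)
qed

text \<open>
  Uniformity in the starting point is what turns the mean of a logarithm into a bound valid for every phase.
\<close>
definition uniform_orbit_mean :: "real \<Rightarrow> (real \<Rightarrow> 'a::real_normed_vector) \<Rightarrow> 'a \<Rightarrow> bool"
  where "uniform_orbit_mean \<alpha> f M \<longleftrightarrow> uniform_limit UNIV (orbit_average \<alpha> f) (\<lambda>_. M) sequentially"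

lemma uniform_orbit_mean_tendsto:
  "uniform_orbit_mean \<alpha> f M \<Longrightarrow> (\<lambda>N. orbit_average \<alpha> f N x) \<longlonglongrightarrow> M"
  unfolding uniform_orbit_mean_def by (rule tendsto_uniform_limitI) auto

lemma uniform_orbit_mean_add:
  assumes "uniform_orbit_mean \<alpha> f M" "uniform_orbit_mean \<alpha> g L"
  shows "uniform_orbit_mean \<alpha> (\<lambda>x. f x + g x) (M + L)"
  using uniform_limit_add[OF assms[unfolded uniform_orbit_mean_def]]
  unfolding uniform_orbit_mean_def orbit_average_add[symmetric] .

lemma uniform_orbit_mean_character:
  assumes "\<alpha> \<notin> \<rat>"
  shows "uniform_orbit_mean \<alpha> (\<lambda>x. c * character k x) (if k = 0 then c else 0)"
  unfolding uniform_orbit_mean_def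
proof (rule uniform_limitI)
  fix e :: real assume e: "e > 0"
  show "\<forall>\<^sub>F N in sequentially. \<forall>x\<in>UNIV. dist (orbit_average \<alpha> (\<lambda>x. c * character k x) N x) (if k = 0 then c else 0) < e"
  proof (cases "k = 0")
    case True
    then show ?thesis using e
      by (intro eventually_mono[OF eventually_gt_at_top[of 0]])
        (simp add: orbit_average_def scaleR_conv_of_real flip: mult.assoc)
  next
    case False
    let ?B = "norm c * (2 / norm (character k \<alpha> - 1))"
    have "(\<lambda>N. ?B * inverse (real N)) \<longlonglongrightarrow> 0" by (rule tendsto_mult_right_zero[OF lim_inverse_n])
    then have "\<forall>\<^sub>F N in sequentially. ?B * inverse (real N) < e" using e by (rule order_tendstoD)
    then show ?thesis
    proof eventually_elim
      case (elim N)
      have "norm (orbit_average \<alpha> (\<lambda>x. c * character k x) N x) < e" for x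
      proof -
        have "norm (orbit_average \<alpha> (\<lambda>x. c * character k x) N x)
            = norm c * norm (\<Sum>n<N. character k (x + of_nat n * \<alpha>)) * inverse (real N)"
          by (simp add: orbit_average_def norm_mult flip: sum_distrib_left)
        also have "\<dots> \<le> ?B * inverse (real N)"
          by (intro mult_right_mono mult_left_mono norm_sum_character_orbit_le assms False) simp_all
        finally show ?thesis using elim by simp
      qed
      then show ?case using False by simp
    qed
  qed
qed

lemma has_integral_character:
  "((\<lambda>x. c * character k x) has_integral (if k = 0 then c else 0)) {0..1}"
proof (cases "k = 0")
  case True
  then show ?thesis using has_integral_const_real[of c 0 1] by simp
next
  case False
  define F where "F = (\<lambda>x::real. c / (2 * pi * of_int k * \<i>) * cis (2 * pi * of_int k * x))"
  have "(F has_vector_derivative c * character k x) (at x within {0..1})" for x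
    using False unfolding F_def character_def cis_conv_exp
    by (auto intro!: derivative_eq_intros has_vector_derivative_real_field simp: field_simps)
  then have "((\<lambda>x. c * character k x) has_integral (F 1 - F 0)) {0..1}"
    by (intro fundamental_theorem_of_calculus) auto
  moreover have "F 1 - F 0 = 0" unfolding F_def by simp
  ultimately show ?thesis using False by simp
qed

text \<open>
  The span of the characters. Frequencies may repeat in such a sum, which makes products easy to form, and
  induction over the sum computes orbit means and integrals side by side.
\<close>
inductive trigonometric :: "(real \<Rightarrow> complex) \<Rightarrow> bool" where
  character: "trigonometric (\<lambda>x. c * character k x)"
| add: "trigonometric f \<Longrightarrow> trigonometric g \<Longrightarrow> trigonometric (\<lambda>x. f x + g x)"

lemma trigonometric_const: "trigonometric (\<lambda>x. c)"
  using trigonometric.character[of c 0] by simp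

lemma trigonometric_mult:
  assumes "trigonometric f" "trigonometric g"
  shows "trigonometric (\<lambda>x. f x * g x)"
  using assms(1)
proof induction
  case (character c k)
  show ?case using assms(2)
  proof induction
    case (character d l)
    have "(\<lambda>x. c * character k x * (d * character l x)) = (\<lambda>x. (c * d) * character (k + l) x)"
      by (simp add: character_add_left mult_ac)
    then show ?case using trigonometric.character[of "c * d" "k + l"] by metis
  next
    case (add f g)
    show ?case unfolding distrib_left by (rule trigonometric.add[OF add.IH])
  qed
next
  case (add f h)
  show ?case unfolding distrib_right by (rule trigonometric.add[OF add.IH])
qed

lemma trigonometric_real_polynomial_function:
  assumes "real_polynomial_function (p :: complex \<Rightarrow> real)"
  shows "trigonometric (\<lambda>x. of_real (p (character 1 x)))"
  using assms
proof induction
  case (linear h)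
  interpret h: bounded_linear h by fact
  have hz: "h z = Re z * h 1 + Im z * h \<i>" for z
  proof -
    have "h z = h (Re z *\<^sub>R 1 + Im z *\<^sub>R \<i>)" by (rule arg_cong[of _ _ h]) (simp add: complex_eq_iff)
    then show ?thesis by (simp only: h.add h.scaleR) simp
  qed
  have "of_real (h z) = (complex_of_real (h 1) - \<i> * h \<i>) / 2 * z
      + (complex_of_real (h 1) + \<i> * h \<i>) / 2 * cnj z" for z
    unfolding hz[of z] by (rule complex_eqI) (simp_all add: diff_divide_distrib add_divide_distrib mult.commute)
  then have "of_real (h (character 1 x)) = (complex_of_real (h 1) - \<i> * h \<i>) / 2 * character 1 x
      + (complex_of_real (h 1) + \<i> * h \<i>) / 2 * character (- 1) x" for x
    unfolding cnj_character[symmetric] .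
  then show ?case by (simp only:) (rule trigonometric.add[OF trigonometric.character trigonometric.character])
next
  case (const c)
  show ?case by (rule trigonometric_const)
next
  case (add f g)
  from trigonometric.add[OF add.IH] show ?case by simp
next
  case (mult f g)
  from trigonometric_mult[OF mult.IH] show ?case by simp
qed

lemma trigonometric_mean:
  assumes "\<alpha> \<notin> \<rat>" "trigonometric f"
  shows "\<exists>M. uniform_orbit_mean \<alpha> f M \<and> (f has_integral M) {0..1}"
  using assms(2)
proof induction
  case (character c k)
  show ?case using uniform_orbit_mean_character[OF assms(1)] has_integral_character by blast
next
  case (add f g)
  then obtain M L where "uniform_orbit_mean \<alpha> f M" "(f has_integral M) {0..1}"
      "uniform_orbit_mean \<alpha> g L" "(g has_integral L) {0..1}"
    by blast
  then show ?case by (intro exI[of _ "M + L"] conjI uniform_orbit_mean_add has_integral_add)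
qed

lemma periodic_of_int:
  assumes "\<And>x. f (x + 1) = (f x :: 'a)"
  shows "f (x + of_int k) = f (x :: real)"
proof (induction k rule: int_induct[where k = 0])
  case (step1 i)
  then show ?case using assms[of "x + of_int i"] by (simp add: add.assoc)
next
  case (step2 i)
  then show ?case using assms[of "x + of_int (i - 1)"] by (simp add: add.assoc)
qed simp

text \<open>
  A \<open>1\<close>-periodic continuous function descends to a continuous function on the unit circle. Stone--Weierstrass
  approximates it there by polynomials in the real and imaginary part, and these are trigonometric.
\<close>
lemma trigonometric_approximation:
  fixes f :: "real \<Rightarrow> real"
  assumes cont: "continuous_on UNIV f" and per: "\<And>x. f (x + 1) = f x" and "e > 0"
  obtains p where "trigonometric (\<lambda>x. of_real (p x))" "\<And>x. \<bar>f x - p x\<bar> < e"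
proof -
  let ?w = "\<lambda>t::real. cis (2 * pi * t)"
  define F where "F = (\<lambda>z. f (SOME t. t \<in> {0..1} \<and> z = ?w t))"
  have F: "F (?w t) = f t" for t
  proof -
    let ?s = "SOME s. s \<in> {0..1} \<and> ?w t = ?w s"
    have "frac t \<in> {0..1} \<and> ?w t = ?w (frac t)"
      unfolding cis_2pi_eq_iff
      by (intro conjI exI[of _ "\<lfloor>t\<rfloor>"]) (auto simp: less_imp_le[OF frac_lt_1], simp add: frac_def)
    then have "?s \<in> {0..1} \<and> ?w t = ?w ?s" by (rule someI)
    then obtain n :: int where "t = ?s + of_int n" using cis_2pi_eq_iff by blast
    then have "f t = f ?s" using periodic_of_int[of f, OF per] by metis
    then show ?thesis by (simp add: F_def)
  qed
  let ?S = "sphere (0::complex) 1"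
  have img: "?w ` {0..1} = ?S"
  proof
    show "?S \<subseteq> ?w ` {0..1}"
    proof
      fix z :: complex assume "z \<in> ?S"
      then have "norm z = 1" by simp
      then obtain t where t: "0 \<le> t" "t < 2 * pi" "z = Complex (cos t) (sin t)"
        using complex_unimodular_polar by blast
      have "z = ?w (t / (2 * pi))" using t(3) by (simp add: complex_eq_iff)
      moreover have "t / (2 * pi) \<in> {0..1}" using t by simp
      ultimately show "z \<in> ?w ` {0..1}" by blast
    qed
  qed auto
  have "continuous_on ?S F"
  proof (subst continuous_on_closed_vimage)
    show "\<forall>B. closed B \<longrightarrow> closed (F -` B \<inter> ?S)"
    proof (intro allI impI)
      fix B :: "real set" assume B: "closed B"
      \<comment> \<open>Preimages of closed sets are images of compact sets, hence closed.\<close>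
      have "F -` B \<inter> ?S = ?w ` (f -` B \<inter> {0..1})"
        using F unfolding img[symmetric] by auto
      moreover have "closed (f -` B)"
        using cont B by (simp add: continuous_closed_vimage continuous_on_eq_continuous_at)
      then have "compact (f -` B \<inter> {0..1})" by (simp add: closed_Int_compact)
      then have "compact (?w ` (f -` B \<inter> {0..1}))"
        by (intro compact_continuous_image continuous_intros)
      ultimately show "closed (F -` B \<inter> ?S)" by (simp add: compact_imp_closed)
    qed
  qed simp
  then obtain q where q: "real_polynomial_function q" "\<And>z. z \<in> ?S \<Longrightarrow> \<bar>F z - q z\<bar> < e"
    using Stone_Weierstrass_real_polynomial_function[of ?S F e] \<open>e > 0\<close> by auto
  show ?thesis
  proof (rule that)
    show "trigonometric (\<lambda>x. of_real (q (character 1 x)))"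
      by (rule trigonometric_real_polynomial_function[OF q(1)])
    show "\<bar>f x - q (character 1 x)\<bar> < e" for x
      using q(2)[of "character 1 x"] F[of x] by (simp add: character_def)
  qed
qed

text \<open>
  Orbit mean and integral agree for trigonometric functions, and both change by at most \<open>e\<close> when the function
  changes by at most \<open>e\<close>.
\<close>
theorem weyl_equidistribution:
  fixes f :: "real \<Rightarrow> real"
  assumes irr: "\<alpha> \<notin> \<rat>" and cont: "continuous_on UNIV f" and per: "\<And>x. f (x + 1) = f x"
  shows "uniform_orbit_mean \<alpha> f (integral {0..1} f)"
  unfolding uniform_orbit_mean_def
proof (rule uniform_limitI)
  fix e :: real assume "e > 0"
  then have e3: "e / 3 > 0" by simp
  obtain p where p: "trigonometric (\<lambda>x. of_real (p x))" and fp: "\<And>x. \<bar>f x - p x\<bar> < e / 3"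
    using trigonometric_approximation[OF cont per e3] by blast
  obtain M where M: "uniform_orbit_mean \<alpha> (\<lambda>x. complex_of_real (p x)) M"
    and Mi: "((\<lambda>x. complex_of_real (p x)) has_integral M) {0..1}"
    using trigonometric_mean[OF irr p] by blast
  have "((\<lambda>x. p x) has_integral Re M) {0..1}"
    using has_integral_linear[OF Mi bounded_linear_Re] by (simp add: o_def)
  moreover have "(f has_integral integral {0..1} f) {0..1}"
    by (intro integrable_integral integrable_continuous_real continuous_on_subset[OF cont]) auto
  ultimately have "((\<lambda>x. f x - p x) has_integral (integral {0..1} f - Re M)) {0..1}"
    by (intro has_integral_diff)
  then have "norm (integral {0..1} f - Re M) \<le> e / 3 * measure lborel {0..1::real}"
    using fp e3 by (intro has_integral_bound_real[where f = "\<lambda>x. f x - p x" and S = "{}"]) (auto intro: less_imp_le)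
  then have I: "\<bar>integral {0..1} f - Re M\<bar> \<le> e / 3" by simp
  show "\<forall>\<^sub>F N in sequentially. \<forall>x\<in>UNIV. dist (orbit_average \<alpha> f N x) (integral {0..1} f) < e"
    using uniform_limitD[OF M[unfolded uniform_orbit_mean_def] e3]
  proof eventually_elim
    case (elim N)
    show ?case
    proof
      fix x
      have "complex_of_real (orbit_average \<alpha> p N x) = orbit_average \<alpha> (\<lambda>x. of_real (p x)) N x"
        by (simp add: orbit_average_def scaleR_conv_of_real)
      then have "\<bar>orbit_average \<alpha> p N x - Re M\<bar> = \<bar>Re (orbit_average \<alpha> (\<lambda>x. of_real (p x)) N x - M)\<bar>"
        by (metis Re_complex_of_real minus_complex.simps(1))
      also have "\<dots> < e / 3"
        by (rule le_less_trans[OF abs_Re_le_cmod]) (use elim in \<open>simp add: dist_norm\<close>)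
      finally have 1: "\<bar>orbit_average \<alpha> p N x - Re M\<bar> < e / 3" .
      have "norm (orbit_average \<alpha> (\<lambda>x. f x - p x) N x) \<le> e / 3"
        by (rule norm_orbit_average_le) (use fp less_imp_le in auto)
      with 1 I show "dist (orbit_average \<alpha> f N x) (integral {0..1} f) < e"
        unfolding orbit_average_diff real_norm_def dist_real_def by linarith
    qed
  qed
qed

text \<open>
  Orbit means are uniform in the starting point and therefore blind to a shift; they determine the integral.
\<close>
lemma integral_periodic_shift:
  fixes \<alpha> :: real and f :: "real \<Rightarrow> real"
  assumes irr: "\<alpha> \<notin> \<rat>"
    and cont: "continuous_on UNIV f" and per: "\<And>x. f (x + 1) = f x"
  shows "integral {0..1} (\<lambda>x. f (x + a)) = integral {0..1} f"
proof (rule LIMSEQ_unique)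
  have "continuous_on UNIV (\<lambda>x. f (x + a))"
    by (rule continuous_on_compose2[OF cont]) (auto intro!: continuous_intros)
  moreover have "f (x + 1 + a) = f (x + a)" for x
    using per[of "x + a"] by (simp add: add_ac)
  ultimately show "(\<lambda>N. orbit_average \<alpha> (\<lambda>x. f (x + a)) N 0) \<longlonglongrightarrow> integral {0..1} (\<lambda>x. f (x + a))"
    by (intro uniform_orbit_mean_tendsto weyl_equidistribution[OF irr])
  have "orbit_average \<alpha> (\<lambda>x. f (x + a)) N 0 = orbit_average \<alpha> f N a" for N
    by (simp add: orbit_average_def add.commute)
  then show "(\<lambda>N. orbit_average \<alpha> (\<lambda>x. f (x + a)) N 0) \<longlonglongrightarrow> integral {0..1} f"
    using uniform_orbit_mean_tendsto[OF weyl_equidistribution[OF irr cont per], of a] by simp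
qed

text \<open>
  The coefficient \<open>a q\<close> is the orbit mean of the function times the character of frequency \<open>- q\<close>, hence at
  most the supremum over the orbit. A single orbit suffices, so that statements about one operator, whose
  potential sees one orbit only, can be confronted with Fourier coefficients.
\<close>
lemma orbit_bound_imp_coeff_bound:
  fixes a :: "int \<Rightarrow> complex"
  assumes irr: "\<alpha> \<notin> \<rat>" and A: "finite A" "q \<in> A"
    and bound: "\<And>n::nat. norm (\<Sum>k\<in>A. a k * character k (x + of_nat n * \<alpha>)) \<le> M"
  shows "norm (a q) \<le> M"
proof -
  define f where "f = (\<lambda>t. (\<Sum>k\<in>A. a k * character (k - q) t))"
  have mean: "uniform_orbit_mean \<alpha> (\<lambda>t. \<Sum>k\<in>B. a k * character (k - q) t) (if q \<in> B then a q else 0)"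
    if "finite B" for B
    using that
  proof induction
    case empty
    then show ?case using uniform_orbit_mean_character[OF irr, of 0 0] by simp
  next
    case (insert k B)
    have "uniform_orbit_mean \<alpha> (\<lambda>t. a k * character (k - q) t + (\<Sum>k\<in>B. a k * character (k - q) t))
      ((if k - q = 0 then a k else 0) + (if q \<in> B then a q else 0))"
      by (intro uniform_orbit_mean_add uniform_orbit_mean_character irr insert.IH)
    moreover have "(if k - q = 0 then a k else 0) + (if q \<in> B then a q else 0) = (if q \<in> insert k B then a q else 0)"
      using insert.hyps by auto
    ultimately show ?case using insert.hyps by simp
  qed
  have f_bound: "norm (f (x + of_nat n * \<alpha>)) \<le> M" for n
  proof -
    have "f t = character (- q) t * (\<Sum>k\<in>A. a k * character k t)" for t
      using character_add_left[of "- q" _ t] by (simp add: f_def sum_distrib_left mult.left_commute)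
    then show ?thesis using bound[of n] by (simp add: norm_mult)
  qed
  have "(\<lambda>N. norm (orbit_average \<alpha> f N x)) \<longlonglongrightarrow> norm (a q)"
    using tendsto_norm[OF uniform_orbit_mean_tendsto[OF mean[OF A(1)]]] A(2) unfolding f_def by simp
  then show ?thesis
    by (rule LIMSEQ_le_const2) (use norm_orbit_average_le[where f = f, OF f_bound] in blast)
qed

section \<open>Square-summable sequences and resolvents\<close>

text \<open>
  Membership in \<^const>\<open>ell2\<close> and its norm are governed by finite sums, so the Minkowski inequality for
  \<^const>\<open>L2_set\<close> carries over.
\<close>
lemma ell2I:
  assumes "\<And>F. finite F \<Longrightarrow> L2_set (\<lambda>n. cmod (u n)) F \<le> B"
  shows "u \<in> ell2" "ell2_norm u \<le> B"
proof -
  have B: "B \<ge> 0" using assms[of "{}"] by simp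
  have sum: "(\<Sum>n\<in>F. (cmod (u n))\<^sup>2) \<le> B\<^sup>2" if "finite F" for F
    using assms[OF that] unfolding L2_set_def by (rule sqrt_le_D)
  have summable: "(\<lambda>n. (cmod (u n))\<^sup>2) summable_on UNIV"
    by (rule nonneg_bounded_partial_sums_imp_summable_on[where C = "B\<^sup>2"])
      (auto intro!: eventually_finite_subsets_at_top_weakI sum)
  then show "u \<in> ell2" by (simp add: ell2_def)
  have "(\<Sum>\<^sub>\<infinity>n. (cmod (u n))\<^sup>2) \<le> B\<^sup>2"
    by (rule infsum_le_finite_sums[OF summable]) (use sum in auto)
  then show "ell2_norm u \<le> B"
    unfolding ell2_norm_def using B by (simp add: real_le_lsqrt)
qed

lemma L2_set_le_ell2_norm:
  assumes "u \<in> ell2" "finite F"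
  shows "L2_set (\<lambda>n. cmod (u n)) F \<le> ell2_norm u"
  unfolding L2_set_def ell2_norm_def
  using assms by (intro real_sqrt_le_mono finite_sum_le_infsum) (auto simp: ell2_def)

lemma ell2_norm_nonneg: "ell2_norm u \<ge> 0"
  unfolding ell2_norm_def by (intro real_sqrt_ge_zero infsum_nonneg) auto

lemma cmod_le_ell2_norm: "u \<in> ell2 \<Longrightarrow> cmod (u n) \<le> ell2_norm u"
  using L2_set_le_ell2_norm[of u "{n}"] by simp

lemma ell2_dominated:
  assumes "u \<in> ell2" "\<And>n. cmod (w n) \<le> B * cmod (u n)" "B \<ge> 0"
  shows "w \<in> ell2" "ell2_norm w \<le> B * ell2_norm u"
proof -
  have *: "L2_set (\<lambda>n. cmod (w n)) F \<le> B * ell2_norm u" if "finite F" for F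
  proof -
    have "L2_set (\<lambda>n. cmod (w n)) F \<le> L2_set (\<lambda>n. B * cmod (u n)) F"
      by (intro L2_set_mono assms) auto
    also have "\<dots> = B * L2_set (\<lambda>n. cmod (u n)) F"
      by (rule L2_set_right_distrib[OF assms(3), symmetric])
    also have "\<dots> \<le> B * ell2_norm u"
      by (intro mult_left_mono L2_set_le_ell2_norm that assms)
    finally show ?thesis .
  qed
  show "w \<in> ell2" "ell2_norm w \<le> B * ell2_norm u" by (rule ell2I(1), erule *) (rule ell2I(2), erule *)
qed

lemma ell2_add:
  assumes "u \<in> ell2" "w \<in> ell2"
  shows "(\<lambda>n. u n + w n) \<in> ell2" "ell2_norm (\<lambda>n. u n + w n) \<le> ell2_norm u + ell2_norm w"
proof -
  have *: "L2_set (\<lambda>n. cmod (u n + w n)) F \<le> ell2_norm u + ell2_norm w" if "finite F" for F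
  proof -
    have "L2_set (\<lambda>n. cmod (u n + w n)) F \<le> L2_set (\<lambda>n. cmod (u n) + cmod (w n)) F"
      by (intro L2_set_mono norm_triangle_ineq) auto
    also have "\<dots> \<le> L2_set (\<lambda>n. cmod (u n)) F + L2_set (\<lambda>n. cmod (w n)) F"
      by (rule L2_set_triangle_ineq)
    also have "\<dots> \<le> ell2_norm u + ell2_norm w"
      by (intro add_mono L2_set_le_ell2_norm that assms)
    finally show ?thesis .
  qed
  show "(\<lambda>n. u n + w n) \<in> ell2" "ell2_norm (\<lambda>n. u n + w n) \<le> ell2_norm u + ell2_norm w"
    by (rule ell2I(1), erule *) (rule ell2I(2), erule *)
qed

lemma ell2_scale:
  assumes "u \<in> ell2"
  shows "(\<lambda>n. c * u n) \<in> ell2" "ell2_norm (\<lambda>n. c * u n) \<le> cmod c * ell2_norm u"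
  by (rule ell2_dominated(1)[OF assms, of _ "cmod c"]; simp add: norm_mult)
    (rule ell2_dominated(2)[OF assms]; simp add: norm_mult)

lemma ell2_shift:
  assumes "u \<in> ell2"
  shows "(\<lambda>n. u (n + k)) \<in> ell2" "ell2_norm (\<lambda>n. u (n + k)) \<le> ell2_norm u"
proof -
  have *: "L2_set (\<lambda>n. cmod (u (n + k))) F \<le> ell2_norm u" if "finite F" for F
  proof -
    have "L2_set (\<lambda>n. cmod (u (n + k))) F = L2_set (\<lambda>n. cmod (u n)) ((\<lambda>n. n + k) ` F)"
      unfolding L2_set_def by (subst sum.reindex) (auto simp: inj_on_def)
    also have "\<dots> \<le> ell2_norm u" by (intro L2_set_le_ell2_norm assms finite_imageI that)
    finally show ?thesis .
  qed
  show "(\<lambda>n. u (n + k)) \<in> ell2" "ell2_norm (\<lambda>n. u (n + k)) \<le> ell2_norm u" by (rule ell2I(1), erule *) (rule ell2I(2), erule *)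
qed

lemma ell2_basis:
  "(\<lambda>n. if n = k then 1 else 0) \<in> ell2" "ell2_norm (\<lambda>n. if n = k then 1 else 0) \<le> 1"
proof -
  have *: "L2_set (\<lambda>n. cmod (if n = k then 1 else 0)) F \<le> 1" if "finite F" for F
    using that by (auto simp: L2_set_def if_distrib[of cmod] if_distrib[of "\<lambda>x. x\<^sup>2"] cong: if_cong)
  show "(\<lambda>n. if n = k then 1 else 0) \<in> ell2" "ell2_norm (\<lambda>n. if n = k then 1 else 0) \<le> 1"
    by (rule ell2I(1), erule *) (rule ell2I(2), erule *)
qed

lemma summable_on_power_nat_abs:
  assumes "0 \<le> q" "q < (1::real)"
  shows "(\<lambda>n. q ^ nat \<bar>n - k\<bar>) summable_on (UNIV :: int set)"
proof -
  have g: "(\<lambda>m. q ^ m) summable_on (UNIV :: nat set)"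
    using summable_norm[of "\<lambda>m. q ^ m"] assms by (intro norm_summable_imp_summable_on) (simp add: norm_power summable_geometric)
  have 1: "(\<lambda>n. q ^ nat \<bar>n - k\<bar>) summable_on {k..}"
  proof -
    have "bij_betw (\<lambda>m. k + int m) UNIV {k..}"
      by (rule bij_betwI[of _ _ _ "\<lambda>n. nat (n - k)"]) auto
    then show ?thesis using g by (subst summable_on_reindex_bij_betw[symmetric]) auto
  qed
  have 2: "(\<lambda>n. q ^ nat \<bar>n - k\<bar>) summable_on {..k}"
  proof -
    have "bij_betw (\<lambda>m. k - int m) UNIV {..k}"
      by (rule bij_betwI[of _ _ _ "\<lambda>n. nat (k - n)"]) auto
    then show ?thesis using g by (subst summable_on_reindex_bij_betw[symmetric]) auto
  qed
  have "{k..} \<union> {..k} = UNIV" by auto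
  then show ?thesis using summable_on_union[OF 1 2] by simp
qed

lemma summable_on_of_cofinite_bound:
  fixes f h :: "int \<Rightarrow> real"
  assumes "h summable_on UNIV" "\<And>n. n \<notin> X \<Longrightarrow> 0 \<le> f n \<and> f n \<le> h n" "finite X"
  shows "f summable_on UNIV"
proof -
  have "f summable_on - X"
    by (rule summable_on_comparison_test[OF summable_on_subset_banach[OF assms(1)]]) (use assms(2) in auto)
  then have "f summable_on (X \<union> - X)"
    by (intro summable_on_union) (use assms(3) in auto)
  then show ?thesis by simp
qed

definition jacobi :: "complex \<Rightarrow> complex \<Rightarrow> (int \<Rightarrow> complex) \<Rightarrow> (int \<Rightarrow> complex) \<Rightarrow> int \<Rightarrow> complex"
  where "jacobi a b V u n = a * u (n + 1) + b * u (n - 1) + V n * u n"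

lemma jacobi_ell2:
  assumes "u \<in> ell2" "\<And>n. cmod (V n) \<le> B"
  shows "jacobi a b V u \<in> ell2"
proof -
  have "B \<ge> 0" using assms(2)[of 0] norm_ge_zero order_trans by blast
  then have "(\<lambda>n. V n * u n) \<in> ell2"
    using assms(2) by (intro ell2_dominated[OF assms(1), of _ B]) (auto simp: norm_mult mult_right_mono)
  moreover have "(\<lambda>n. u (n - 1)) \<in> ell2" using ell2_shift(1)[OF assms(1), of "- 1"] by simp
  ultimately show ?thesis unfolding jacobi_def[abs_def]
    by (intro ell2_add ell2_scale ell2_shift assms)
qed

lemma not_in_op_spectrumD:
  assumes "z \<notin> op_spectrum T"
  obtains R C where "bounded_op R" "C > 0"
    "\<forall>u\<in>ell2. R u \<in> ell2 \<and> ell2_norm (R u) \<le> C * ell2_norm u \<and>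
      R (\<lambda>n. T u n - z * u n) = u \<and> (\<lambda>n. T (R u) n - z * R u n) = u"
proof -
  obtain R where R: "bounded_op R" "\<And>u. u \<in> ell2 \<Longrightarrow> R (\<lambda>n. T u n - z * u n) = u"
    "\<And>u. u \<in> ell2 \<Longrightarrow> (\<lambda>n. T (R u) n - z * R u n) = u"
    using assms unfolding op_spectrum_def by blast
  obtain C where C: "\<And>u. u \<in> ell2 \<Longrightarrow> ell2_norm (R u) \<le> C * ell2_norm u"
    using R(1) unfolding bounded_op_def by blast
  have R_in: "\<And>u. u \<in> ell2 \<Longrightarrow> R u \<in> ell2" using R(1) unfolding bounded_op_def by blast
  have C': "ell2_norm (R u) \<le> max C 1 * ell2_norm u" if "u \<in> ell2" for u
    by (rule order_trans[OF C[OF that]]) (intro mult_right_mono ell2_norm_nonneg, simp)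
  show ?thesis
  proof (rule that)
    show "bounded_op R" by fact
    show "max C 1 > 0" by simp
    show "\<forall>u\<in>ell2. R u \<in> ell2 \<and> ell2_norm (R u) \<le> max C 1 * ell2_norm u \<and>
      R (\<lambda>n. T u n - z * u n) = u \<and> (\<lambda>n. T (R u) n - z * R u n) = u"
      using R_in C' R(2,3) by blast
  qed
qed

lemma truncated_exp_weight_neighbour:
  fixes \<delta> N :: real and k n p :: int
  assumes "\<delta> > 0" "\<bar>n - p\<bar> = 1"
  defines "\<rho> \<equiv> (\<lambda>n::int. exp (\<delta> * min \<bar>real_of_int (n - k)\<bar> N))"
  shows "\<bar>\<rho> p - \<rho> n\<bar> \<le> (exp \<delta> - 1) * \<rho> p"
proof -
  define s where "s = min \<bar>real_of_int (n - k)\<bar> N - min \<bar>real_of_int (p - k)\<bar> N"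
  have "\<bar>real_of_int (n - p)\<bar> = 1" using assms(2) by (metis of_int_1 of_int_abs)
  then have s: "\<bar>s\<bar> \<le> 1" unfolding s_def min_def by (auto split: if_splits)
  have eq: "\<rho> n = \<rho> p * exp (\<delta> * s)"
    unfolding \<rho>_def s_def by (simp add: exp_add[symmetric] algebra_simps)
  have up: "exp (\<delta> * s) \<le> exp \<delta>" using s assms(1) by (simp add: mult_left_le abs_le_iff)
  have "exp (- \<delta>) \<le> exp (\<delta> * s)"
    using mult_left_mono[of "-1" s \<delta>] s assms(1) by simp
  moreover have "1 - exp (- \<delta>) \<le> exp \<delta> - 1"
  proof -
    have "exp \<delta> + exp (- \<delta>) \<ge> 2" using arith_geo_mean_sqrt[of "exp \<delta>" "exp (- \<delta>)"] by (simp add: exp_minus)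
    then show ?thesis by simp
  qed
  ultimately have "\<bar>1 - exp (\<delta> * s)\<bar> \<le> exp \<delta> - 1" using up by linarith
  then have "\<rho> p * \<bar>1 - exp (\<delta> * s)\<bar> \<le> \<rho> p * (exp \<delta> - 1)"
    by (intro mult_left_mono) (auto simp: \<rho>_def)
  moreover have "\<bar>\<rho> p - \<rho> n\<bar> = \<rho> p * \<bar>1 - exp (\<delta> * s)\<bar>"
  proof -
    have "\<rho> p - \<rho> n = \<rho> p * (1 - exp (\<delta> * s))" unfolding eq by (simp add: algebra_simps)
    moreover have "\<rho> p \<ge> 0" by (simp add: \<rho>_def)
    ultimately show ?thesis by (simp add: abs_mult)
  qed
  ultimately show ?thesis by (simp add: mult.commute)
qed

text \<open>
  The column \<open>\<Gamma> k\<close> of the resolvent is multiplied by the weight \<open>exp (\<delta> \<bar>n - k\<bar>)\<close>, truncated at distance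
  \<open>N\<close> so that it stays in \<^const>\<open>ell2\<close>. Moving the weight past the operator costs a term of relative size
  \<open>exp \<delta> - 1\<close>, which for small \<open>\<delta>\<close> is absorbed by the lower bound for the operator minus \<open>z\<close>. The
  resulting bound does not depend on \<open>N\<close>.
\<close>
lemma combes_thomas:
  assumes z: "z \<notin> op_spectrum (jacobi a b V)"
  obtains \<Gamma> C \<delta> where "\<delta> > 0" "C \<ge> 0"
    "\<And>k n. jacobi a b V (\<Gamma> k) n - z * \<Gamma> k n = (if n = k then 1 else 0)"
    "\<And>k n. cmod (\<Gamma> k n) \<le> C * exp (- \<delta> * \<bar>real_of_int (n - k)\<bar>)"
    "\<And>w n. w \<in> ell2 \<Longrightarrow> (\<And>n. jacobi a b V w n - z * w n = 0) \<Longrightarrow> w n = 0"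
proof -
  obtain R C where "bounded_op R" and C: "C > 0"
    and R: "\<forall>u\<in>ell2. R u \<in> ell2 \<and> ell2_norm (R u) \<le> C * ell2_norm u \<and>
      R (\<lambda>n. jacobi a b V u n - z * u n) = u \<and> (\<lambda>n. jacobi a b V (R u) n - z * R u n) = u"
    by (rule not_in_op_spectrumD[OF z])
  have RC: "R u \<in> ell2 \<and> ell2_norm (R u) \<le> C * ell2_norm u"
    and R1: "R (\<lambda>n. jacobi a b V u n - z * u n) = u" if "u \<in> ell2" for u
    using R that by blast+
  have R2: "jacobi a b V (R u) n - z * R u n = u n" if "u \<in> ell2" for u n
  proof -
    have "(\<lambda>n. jacobi a b V (R u) n - z * R u n) = u" using R that by blast
    then show ?thesis by (rule fun_cong)
  qed
  have lower: "ell2_norm w \<le> C * ell2_norm f"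
    if "w \<in> ell2" "f \<in> ell2" "\<And>n. jacobi a b V w n - z * w n = f n" for w f
    using RC[OF that(2)] R1[OF that(1)] that(3) by simp
  define A where "A = cmod a + cmod b"
  \<comment> \<open>Chosen so that the commutator term takes up at most half of the lower bound.\<close>
  define \<delta> where "\<delta> = ln (1 + 1 / (2 * C * (A + 1)))"
  have A: "A \<ge> 0" by (simp add: A_def)
  have pos: "1 / (2 * C * (A + 1)) > 0" using C A by simp
  then have \<delta>: "\<delta> > 0" unfolding \<delta>_def by (intro ln_gt_zero) simp
  have exp\<delta>: "exp \<delta> - 1 = 1 / (2 * C * (A + 1))" 
  proof -
    have "1 + 1 / (2 * C * (A + 1)) > 0" using pos by linarith
    then show ?thesis unfolding \<delta>_def by (simp only: exp_ln)
  qed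
  have small: "C * ((exp \<delta> - 1) * A) \<le> 1 / 2"
  proof -
    have "C * ((exp \<delta> - 1) * A) = A / (2 * (A + 1))" unfolding exp\<delta> using C by simp
    also have "\<dots> \<le> 1 / 2" using A by (simp add: divide_le_eq)
    finally show ?thesis .
  qed
  define \<Gamma> where "\<Gamma> = (\<lambda>k. R (\<lambda>n. if n = k then 1 else 0))"
  have \<Gamma>_in: "\<Gamma> k \<in> ell2" for k unfolding \<Gamma>_def using RC ell2_basis by blast
  have \<Gamma>_eq: "jacobi a b V (\<Gamma> k) n - z * \<Gamma> k n = (if n = k then 1 else 0)" for k n
    unfolding \<Gamma>_def by (rule R2[OF ell2_basis(1)])
  have decay: "cmod (\<Gamma> k j) \<le> 2 * C * exp (- \<delta> * \<bar>real_of_int (j - k)\<bar>)" for k j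
  proof -
    \<comment> \<open>Truncating at the distance of the site in question loses nothing there.\<close>
    define N where "N = \<bar>real_of_int (j - k)\<bar>"
    define \<rho> where "\<rho> = (\<lambda>n::int. exp (\<delta> * min \<bar>real_of_int (n - k)\<bar> N))"
    define w where "w = (\<lambda>n. of_real (\<rho> n) * \<Gamma> k n)"
    have \<rho>: "0 \<le> \<rho> n" "\<rho> n \<le> exp (\<delta> * N)" for n using \<delta> by (auto simp: \<rho>_def)
    have w: "w \<in> ell2"
      by (rule ell2_dominated(1)[OF \<Gamma>_in[of k], where B = "exp (\<delta> * N)"])
        (use \<rho> in \<open>auto simp: w_def norm_mult intro!: mult_right_mono\<close>)
    define f1 where "f1 = (\<lambda>n. of_real (\<rho> (n + 1) - \<rho> n) * \<Gamma> k (n + 1))"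
    define f2 where "f2 = (\<lambda>n. of_real (\<rho> (n - 1) - \<rho> n) * \<Gamma> k (n - 1))"
    have f: "cmod (of_real (\<rho> p - \<rho> n) * \<Gamma> k p) \<le> (exp \<delta> - 1) * cmod (w p)" if "\<bar>n - p\<bar> = 1" for n p
    proof -
      have "\<bar>\<rho> p - \<rho> n\<bar> \<le> (exp \<delta> - 1) * \<rho> p"
        unfolding \<rho>_def by (rule truncated_exp_weight_neighbour[OF \<delta> that])
      then have "\<bar>\<rho> p - \<rho> n\<bar> * cmod (\<Gamma> k p) \<le> (exp \<delta> - 1) * \<rho> p * cmod (\<Gamma> k p)"
        by (intro mult_right_mono) auto
      then show ?thesis using \<rho>(1)[of p] by (simp add: w_def norm_mult del: of_real_diff)
    qed
    have commutator: "(\<lambda>n. of_real (\<rho> (n + i) - \<rho> n) * \<Gamma> k (n + i)) \<in> ell2"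
      "ell2_norm (\<lambda>n. of_real (\<rho> (n + i) - \<rho> n) * \<Gamma> k (n + i)) \<le> (exp \<delta> - 1) * ell2_norm w"
      if i: "\<bar>i\<bar> = 1" for i
    proof -
      let ?f = "\<lambda>n. of_real (\<rho> (n + i) - \<rho> n) * \<Gamma> k (n + i)"
      have e1: "exp \<delta> - 1 \<ge> 0" using \<delta> by simp
      have *: "cmod (?f n) \<le> (exp \<delta> - 1) * cmod (w (n + i))" for n by (rule f) (use i in simp)
      show "?f \<in> ell2" by (rule ell2_dominated(1)[OF ell2_shift(1)[OF w] * e1])
      have "ell2_norm ?f \<le> (exp \<delta> - 1) * ell2_norm (\<lambda>n. w (n + i))"
        by (rule ell2_dominated(2)[OF ell2_shift(1)[OF w] * e1])
      also have "\<dots> \<le> (exp \<delta> - 1) * ell2_norm w" by (intro mult_left_mono ell2_shift w e1)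
      finally show "ell2_norm ?f \<le> (exp \<delta> - 1) * ell2_norm w" .
    qed
    have f1: "f1 \<in> ell2" "ell2_norm f1 \<le> (exp \<delta> - 1) * ell2_norm w"
      unfolding f1_def by (rule commutator; simp)+
    have f2: "f2 \<in> ell2" "ell2_norm f2 \<le> (exp \<delta> - 1) * ell2_norm w"
      using commutator[of "- 1"] unfolding f2_def by simp_all
    define f where "f = (\<lambda>n. (if n = k then 1 else 0) + (a * f1 n + b * f2 n))"
    have f12: "(\<lambda>n. a * f1 n + b * f2 n) \<in> ell2"
      "ell2_norm (\<lambda>n. a * f1 n + b * f2 n) \<le> A * ((exp \<delta> - 1) * ell2_norm w)"
    proof -
      note s = ell2_scale[OF f1(1), of a] ell2_scale[OF f2(1), of b]
      show "(\<lambda>n. a * f1 n + b * f2 n) \<in> ell2" by (rule ell2_add(1)[OF s(1) s(3)])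
      have "ell2_norm (\<lambda>n. a * f1 n + b * f2 n) \<le> cmod a * ell2_norm f1 + cmod b * ell2_norm f2"
        using ell2_add(2)[OF s(1) s(3)] s(2) s(4) by linarith
      also have "\<dots> \<le> cmod a * ((exp \<delta> - 1) * ell2_norm w) + cmod b * ((exp \<delta> - 1) * ell2_norm w)"
        by (intro add_mono mult_left_mono f1 f2 norm_ge_zero)
      finally show "ell2_norm (\<lambda>n. a * f1 n + b * f2 n) \<le> A * ((exp \<delta> - 1) * ell2_norm w)"
        by (simp add: A_def distrib_right)
    qed
    have fb: "f \<in> ell2" "ell2_norm f \<le> 1 + A * ((exp \<delta> - 1) * ell2_norm w)"
      using ell2_add[OF ell2_basis(1)[of k] f12(1)] ell2_basis(2)[of k] f12(2)
      unfolding f_def by linarith+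
    have "jacobi a b V w n - z * w n = f n" for n
    proof -
      have "jacobi a b V w n - z * w n
          = of_real (\<rho> n) * (jacobi a b V (\<Gamma> k) n - z * \<Gamma> k n) + (a * f1 n + b * f2 n)"
        by (simp add: jacobi_def w_def f1_def f2_def algebra_simps)
      also have "of_real (\<rho> n) * (jacobi a b V (\<Gamma> k) n - z * \<Gamma> k n) = (if n = k then 1 else 0)"
        unfolding \<Gamma>_eq by (auto simp: \<rho>_def N_def min_def)
      finally show ?thesis by (simp add: f_def)
    qed
    then have "ell2_norm w \<le> C * ell2_norm f" by (intro lower w fb)
    also have "\<dots> \<le> C * (1 + A * ((exp \<delta> - 1) * ell2_norm w))"
      using fb(2) C by (intro mult_left_mono) auto
    also have "\<dots> = C + C * ((exp \<delta> - 1) * A) * ell2_norm w" by (simp add: distrib_left mult_ac)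
    also have "\<dots> \<le> C + 1 / 2 * ell2_norm w"
      by (intro add_left_mono mult_right_mono small ell2_norm_nonneg)
    finally have "ell2_norm w \<le> 2 * C" by simp
    then have "cmod (w j) \<le> 2 * C" using cmod_le_ell2_norm[OF w] order_trans by blast
    moreover have "cmod (w j) = exp (\<delta> * N) * cmod (\<Gamma> k j)"
      by (simp add: w_def \<rho>_def N_def norm_mult)
    ultimately show ?thesis unfolding N_def[symmetric] by (simp add: exp_minus field_simps)
  qed
  show ?thesis
  proof (rule that[OF \<delta> _ \<Gamma>_eq decay])
    show "2 * C \<ge> 0" using C by simp
    fix w n assume w: "w \<in> ell2" and "\<And>n. jacobi a b V w n - z * w n = 0"
    then have "ell2_norm w \<le> C * ell2_norm (\<lambda>n. 0)"
      by (intro lower w) (use ell2_scale(1)[OF w, of 0] in auto)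
    then have "ell2_norm w \<le> 0" by (simp add: ell2_norm_def)
    then have "cmod (w n) \<le> 0" using cmod_le_ell2_norm[OF w, of n] by linarith
    then show "w n = 0" by simp
  qed
qed

text \<open>
  Near a point of the resolvent set the resolvent is given by its Neumann series. Powers of the resolvent grow
  at most geometrically in norm, so the series converges at every site and its sum stays in \<^const>\<open>ell2\<close>;
  a three-term operator may be applied to it term by term. The lemma makes the spectrum Lebesgue measurable.
\<close>
lemma closed_op_spectrum_jacobi:
  assumes V: "\<And>n. cmod (V n) \<le> B"
  shows "closed (op_spectrum (jacobi a b V))"
proof -
  let ?T = "jacobi a b V"
  have "open (- op_spectrum ?T)"
    unfolding open_dist
  proof (intro ballI)
    fix z assume "z \<in> - op_spectrum ?T"
    then have z: "z \<notin> op_spectrum ?T" by simp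
    obtain R C where R0: "bounded_op R" and C: "C > 0"
      and R: "\<forall>u\<in>ell2. R u \<in> ell2 \<and> ell2_norm (R u) \<le> C * ell2_norm u \<and>
        R (\<lambda>n. ?T u n - z * u n) = u \<and> (\<lambda>n. ?T (R u) n - z * R u n) = u"
      by (rule not_in_op_spectrumD[OF z])
    have R_add: "R (\<lambda>n. u n + w n) = (\<lambda>n. R u n + R w n)" if "u \<in> ell2" "w \<in> ell2" for u w
      using R0 that unfolding bounded_op_def by blast
    have R_scale: "R (\<lambda>n. c * u n) = (\<lambda>n. c * R u n)" if "u \<in> ell2" for c u
      using R0 that unfolding bounded_op_def by blast
    have pow: "(R ^^ k) u \<in> ell2 \<and> ell2_norm ((R ^^ k) u) \<le> C ^ k * ell2_norm u" if "u \<in> ell2" for k u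
    proof (induction k)
      case (Suc k)
      have "ell2_norm (R ((R ^^ k) u)) \<le> C * ell2_norm ((R ^^ k) u)" using R Suc by blast
      also have "\<dots> \<le> C * (C ^ k * ell2_norm u)" using Suc C by (intro mult_left_mono) auto
      finally show ?case using R Suc by (simp add: mult_ac)
    qed (use that in simp)
    have pow_add: "(R ^^ k) (\<lambda>n. u n + w n) = (\<lambda>n. (R ^^ k) u n + (R ^^ k) w n)"
      if "u \<in> ell2" "w \<in> ell2" for k u w
      by (induction k) (use that pow R_add in auto)
    have pow_scale: "(R ^^ k) (\<lambda>n. c * u n) = (\<lambda>n. c * (R ^^ k) u n)" if "u \<in> ell2" for k c u
      by (induction k) (use that pow R_scale in auto)
    show "\<exists>e>0. \<forall>w. dist w z < e \<longrightarrow> w \<in> - op_spectrum ?T"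
    proof (intro exI[of _ "1 / C"] conjI allI impI)
      show "1 / C > 0" using C by simp
      fix w assume w: "dist w z < 1 / C"
      define c where "c = w - z"
      define q where "q = cmod c * C"
      have q: "0 \<le> q" "q < 1" using w C by (auto simp: q_def c_def dist_norm field_simps)
      have bound: "cmod (c ^ k * (R ^^ k) u n) \<le> q ^ k * ell2_norm u" if "u \<in> ell2" for k u n
      proof -
        have "cmod ((R ^^ k) u n) \<le> C ^ k * ell2_norm u"
          using pow[OF that, of k] cmod_le_ell2_norm order_trans by blast
        then have "cmod c ^ k * cmod ((R ^^ k) u n) \<le> cmod c ^ k * (C ^ k * ell2_norm u)"
          by (intro mult_left_mono) auto
        then show ?thesis by (simp add: norm_mult norm_power q_def power_mult_distrib mult_ac)
      qed
      have summable: "summable (\<lambda>k. c ^ k * (R ^^ k) u n)" if "u \<in> ell2" for u n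
        by (rule summable_comparison_test'[of "\<lambda>k. q ^ k * ell2_norm u"])
          (use bound[OF that] q in \<open>auto intro: summable_mult2 summable_geometric\<close>)
      \<comment> \<open>The Neumann series, summed site by site.\<close>
      define S where "S = (\<lambda>f n. \<Sum>k. c ^ k * (R ^^ k) (R f) n)"
      have S: "(\<lambda>k. c ^ k * (R ^^ k) (R f) n) sums S f n" if "f \<in> ell2" for f n
        unfolding S_def by (intro summable_sums summable) (use R that in blast)
      have S_ell2: "S f \<in> ell2 \<and> ell2_norm (S f) \<le> C / (1 - q) * ell2_norm f" if f: "f \<in> ell2" for f
      proof -
        have Rf: "R f \<in> ell2" "ell2_norm (R f) \<le> C * ell2_norm f" using R f by blast+
        have partial: "L2_set (\<lambda>n. cmod (\<Sum>k<K. c ^ k * (R ^^ k) (R f) n)) F \<le> (\<Sum>k<K. q ^ k) * ell2_norm (R f)"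
          if F: "finite F" for F K
        proof (induction K)
          case (Suc K)
          have "L2_set (\<lambda>n. cmod (\<Sum>k<Suc K. c ^ k * (R ^^ k) (R f) n)) F
            \<le> L2_set (\<lambda>n. cmod (\<Sum>k<K. c ^ k * (R ^^ k) (R f) n) + cmod (c ^ K * (R ^^ K) (R f) n)) F"
            by (intro L2_set_mono) (auto intro: norm_triangle_ineq)
          also have "\<dots> \<le> L2_set (\<lambda>n. cmod (\<Sum>k<K. c ^ k * (R ^^ k) (R f) n)) F
              + L2_set (\<lambda>n. cmod (c ^ K * (R ^^ K) (R f) n)) F"
            by (rule L2_set_triangle_ineq)
          also have "L2_set (\<lambda>n. cmod (c ^ K * (R ^^ K) (R f) n)) F \<le> q ^ K * ell2_norm (R f)"
          proof -
            have p: "(R ^^ K) (R f) \<in> ell2" "ell2_norm ((R ^^ K) (R f)) \<le> C ^ K * ell2_norm (R f)"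
              using pow[OF Rf(1)] by auto
            have "L2_set (\<lambda>n. cmod (c ^ K * (R ^^ K) (R f) n)) F \<le> ell2_norm (\<lambda>n. c ^ K * (R ^^ K) (R f) n)"
              by (rule L2_set_le_ell2_norm[OF ell2_scale(1)[OF p(1)] F])
            also have "\<dots> \<le> cmod (c ^ K) * ell2_norm ((R ^^ K) (R f))" by (rule ell2_scale(2)[OF p(1)])
            also have "\<dots> \<le> cmod (c ^ K) * (C ^ K * ell2_norm (R f))" by (intro mult_left_mono p) auto
            finally show ?thesis by (simp add: q_def power_mult_distrib norm_power mult_ac)
          qed
          finally show ?case using Suc by (simp add: distrib_right)
        qed (simp add: L2_set_def)
        have geo: "(\<Sum>k<K. q ^ k) \<le> 1 / (1 - q)" for K
        proof -
          have "(\<Sum>k<K. q ^ k) \<le> (\<Sum>k. q ^ k)"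
            using q by (intro sum_le_suminf summable_geometric) auto
          then show ?thesis using suminf_geometric[of q] q by simp
        qed
        have limit: "L2_set (\<lambda>n. cmod (S f n)) F \<le> C / (1 - q) * ell2_norm f" if F: "finite F" for F
        proof (rule LIMSEQ_le_const2)
          show "(\<lambda>K. L2_set (\<lambda>n. cmod (\<Sum>k<K. c ^ k * (R ^^ k) (R f) n)) F) \<longlonglongrightarrow> L2_set (\<lambda>n. cmod (S f n)) F"
            unfolding L2_set_def
            by (intro tendsto_intros) (use S[OF f] in \<open>auto simp: sums_def\<close>)
          have "L2_set (\<lambda>n. cmod (\<Sum>k<K. c ^ k * (R ^^ k) (R f) n)) F \<le> C / (1 - q) * ell2_norm f" for K
          proof -
            have "(\<Sum>k<K. q ^ k) * ell2_norm (R f) \<le> 1 / (1 - q) * (C * ell2_norm f)"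
              using Rf q by (intro mult_mono geo ell2_norm_nonneg) auto
            then show ?thesis using partial[OF F, of K] by simp
          qed
          then show "\<exists>N. \<forall>K\<ge>N. L2_set (\<lambda>n. cmod (\<Sum>k<K. c ^ k * (R ^^ k) (R f) n)) F \<le> C / (1 - q) * ell2_norm f"
            by blast
        qed
        show ?thesis using ell2I[of "S f" "C / (1 - q) * ell2_norm f"] limit by blast
      qed
      have S_add: "S (\<lambda>n. u n + w n) = (\<lambda>n. S u n + S w n)" if u: "u \<in> ell2" and w: "w \<in> ell2" for u w
      proof
        fix n
        have Ru: "R u \<in> ell2" "R w \<in> ell2" using R u w by blast+
        have "(\<lambda>k. c ^ k * (R ^^ k) (R u) n + c ^ k * (R ^^ k) (R w) n) sums (S u n + S w n)"
          by (intro sums_add S u w)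
        then have "(\<lambda>k. c ^ k * (R ^^ k) (R (\<lambda>n. u n + w n)) n) sums (S u n + S w n)"
          unfolding R_add[OF u w] pow_add[OF Ru] by (simp add: distrib_left)
        then show "S (\<lambda>n. u n + w n) n = S u n + S w n"
          using S[OF ell2_add(1)[OF u w]] sums_unique2 by blast
      qed
      have S_scale: "S (\<lambda>n. d * u n) = (\<lambda>n. d * S u n)" if u: "u \<in> ell2" for d u
      proof
        fix n
        have Ru: "R u \<in> ell2" using R u by blast
        have "(\<lambda>k. d * (c ^ k * (R ^^ k) (R u) n)) sums (d * S u n)"
          by (intro sums_mult S u)
        then have "(\<lambda>k. c ^ k * (R ^^ k) (R (\<lambda>n. d * u n)) n) sums (d * S u n)"
          unfolding R_scale[OF u] pow_scale[OF Ru] by (simp add: mult.left_commute)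
        then show "S (\<lambda>n. d * u n) n = d * S u n"
          using S[OF ell2_scale(1)[OF u]] sums_unique2 by blast
      qed
      have "bounded_op S"
        unfolding bounded_op_def using S_ell2 S_add S_scale by blast
      moreover have "S (\<lambda>n. ?T u n - w * u n) = u" if u: "u \<in> ell2" for u
      proof
        fix n
        have Ru: "R u \<in> ell2" using R u by blast
        have Tu: "(\<lambda>n. ?T u n - z * u n) \<in> ell2"
          using ell2_add(1)[OF jacobi_ell2[OF u V, of a b] ell2_scale(1)[OF u, of "- z"]] by simp
        have cu: "(\<lambda>n. - c * u n) \<in> ell2" by (rule ell2_scale(1)[OF u])
        let ?f = "\<lambda>n. ?T u n - w * u n"
        have f: "?f = (\<lambda>n. (?T u n - z * u n) + - c * u n)" by (auto simp: c_def algebra_simps)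
        have f_in: "?f \<in> ell2" unfolding f by (rule ell2_add(1)[OF Tu cu])
        have Rf: "R ?f = (\<lambda>n. u n + - c * R u n)"
          unfolding f R_add[OF Tu cu] R_scale[OF u] using R u by simp
        have shift: "(R ^^ k) (R ?f) n = (R ^^ k) u n - c * (R ^^ Suc k) u n" for k
          unfolding Rf pow_add[OF u ell2_scale(1)[OF Ru]] pow_scale[OF Ru] by (simp add: funpow_swap1)
        have "c ^ k * (R ^^ k) (R ?f) n = c ^ k * (R ^^ k) u n - c ^ Suc k * (R ^^ Suc k) u n" for k
          unfolding shift by (simp add: algebra_simps)
        then have "(\<lambda>k. c ^ k * (R ^^ k) u n - c ^ Suc k * (R ^^ Suc k) u n) sums S ?f n"
          using S[OF f_in, of n] by simp
        moreover have "(\<lambda>k. c ^ k * (R ^^ k) u n - c ^ Suc k * (R ^^ Suc k) u n) sums (c ^ 0 * (R ^^ 0) u n - 0)"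
          by (rule telescope_sums'[OF summable_LIMSEQ_zero[OF summable[OF u]]])
        ultimately show "S ?f n = u n" using sums_unique2 by force
      qed
      moreover have "(\<lambda>n. ?T (S f) n - w * S f n) = f" if f: "f \<in> ell2" for f
      proof
        fix n
        define t where "t = (\<lambda>k. (R ^^ k) (R f))"
        have RR: "?T (t k) n - z * t k n = (R ^^ k) f n" for k
        proof -
          have "(R ^^ k) f \<in> ell2" using pow[OF f] by blast
          then have "(\<lambda>n. ?T (R ((R ^^ k) f)) n - z * R ((R ^^ k) f) n) = (R ^^ k) f" using R by blast
          then show ?thesis unfolding t_def funpow_swap1 by (rule fun_cong)
        qed
        have St: "(\<lambda>k. c ^ k * t k p) sums S f p" for p using S[OF f] by (simp add: t_def)
        have "(\<lambda>k. a * (c ^ k * t k (n + 1)) + b * (c ^ k * t k (n - 1)) + V n * (c ^ k * t k n) - z * (c ^ k * t k n))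
            sums (?T (S f) n - z * S f n)"
          unfolding jacobi_def by (intro sums_add sums_diff sums_mult St)
        moreover have "a * (c ^ k * t k (n + 1)) + b * (c ^ k * t k (n - 1)) + V n * (c ^ k * t k n) - z * (c ^ k * t k n)
            = c ^ k * (R ^^ k) f n" for k
          unfolding RR[symmetric] jacobi_def by (simp add: algebra_simps)
        ultimately have 1: "(\<lambda>k. c ^ k * (R ^^ k) f n) sums (?T (S f) n - z * S f n)" by simp
        have "(\<lambda>k. c * (c ^ k * t k n)) sums (c * S f n)" by (intro sums_mult St)
        then have "(\<lambda>k. c ^ Suc k * (R ^^ Suc k) f n) sums (c * S f n)"
          by (simp add: t_def funpow_swap1 mult_ac)
        then have "(\<lambda>k. c ^ k * (R ^^ k) f n) sums (c * S f n + c ^ 0 * (R ^^ 0) f n)"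
          by (subst (asm) sums_Suc_iff) simp
        with 1 have "?T (S f) n - z * S f n = c * S f n + f n" using sums_unique2 by force
        then show "?T (S f) n - w * S f n = f n" by (simp add: c_def algebra_simps)
      qed
      ultimately show "w \<in> - op_spectrum ?T" unfolding op_spectrum_def by blast
    qed
  qed
  then show ?thesis by (simp add: closed_def)
qed

section \<open>Two Green's functions of one recurrence\<close>

lemma tendsto_0_of_left_decay:
  fixes f :: "int \<Rightarrow> complex"
  assumes "\<delta> > 0" and f: "\<And>n. n \<le> k \<Longrightarrow> cmod (f n) \<le> C * exp (- \<delta> * \<bar>real_of_int (n - k)\<bar>)"
  shows "(\<lambda>i. f (c - int i)) \<longlonglongrightarrow> 0"
proof (rule Lim_null_comparison)
  have "(\<lambda>i. exp (- \<delta>) ^ i) \<longlonglongrightarrow> 0"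
    using assms(1) by (intro LIMSEQ_power_zero) simp
  then show "(\<lambda>i. (C * exp (- \<delta> * (k - c))) * exp (- \<delta>) ^ i) \<longlonglongrightarrow> 0"
    by (rule tendsto_mult_right_zero)
  show "\<forall>\<^sub>F i in sequentially. cmod (f (c - int i)) \<le> (C * exp (- \<delta> * (k - c))) * exp (- \<delta>) ^ i"
    using eventually_ge_at_top[of "nat (c - k)"]
  proof eventually_elim
    case (elim i)
    then have le: "c - int i \<le> k" by linarith
    then have "\<bar>real_of_int (c - int i - k)\<bar> = real_of_int (k - c) + real i" by simp
    then have "exp (- \<delta> * \<bar>real_of_int (c - int i - k)\<bar>) = exp (- \<delta> * (k - c)) * exp (- \<delta>) ^ i"
      by (simp add: exp_add[symmetric] exp_of_nat_mult[symmetric] algebra_simps)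
    then show ?case using f[OF le] by simp
  qed
qed

lemma ell2_of_one_sided_decay:
  fixes w :: "int \<Rightarrow> complex"
  assumes "\<delta> > 0" "\<epsilon> > 0"
    and l: "\<And>n. n \<le> j \<Longrightarrow> cmod (w n) \<le> A * exp (- \<delta> * \<bar>real_of_int (n - j)\<bar>)"
    and r: "\<And>n. n \<ge> k \<Longrightarrow> cmod (w n) \<le> B * exp (- \<epsilon> * \<bar>real_of_int (n - k)\<bar>)"
  shows "w \<in> ell2"
proof -
  have sq: "(X * exp (- s * \<bar>real_of_int (n - p)\<bar>))\<^sup>2 = X\<^sup>2 * exp (- 2 * s) ^ nat \<bar>n - p\<bar>" for X s n p
  proof -
    have "real (nat \<bar>n - p\<bar>) = \<bar>real_of_int (n - p)\<bar>" by simp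
    then show ?thesis
      by (simp add: power_mult_distrib exp_of_nat_mult[symmetric] exp_double[symmetric] algebra_simps)
  qed
  define h where "h = (\<lambda>n. A\<^sup>2 * exp (- 2 * \<delta>) ^ nat \<bar>n - j\<bar> + B\<^sup>2 * exp (- 2 * \<epsilon>) ^ nat \<bar>n - k\<bar>)"
  have "h summable_on UNIV"
    unfolding h_def using assms(1,2)
    by (intro summable_on_add summable_on_cmult_right summable_on_power_nat_abs) auto
  moreover have "0 \<le> (cmod (w n))\<^sup>2 \<and> (cmod (w n))\<^sup>2 \<le> h n" if "n \<notin> {j<..<k}" for n
  proof -
    have pos: "0 \<le> A\<^sup>2 * exp (- 2 * \<delta>) ^ nat \<bar>n - j\<bar>" "0 \<le> B\<^sup>2 * exp (- 2 * \<epsilon>) ^ nat \<bar>n - k\<bar>" by simp_all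
    have "n \<le> j \<or> n \<ge> k" using that by auto
    then show ?thesis
    proof
      assume "n \<le> j"
      then have "(cmod (w n))\<^sup>2 \<le> (A * exp (- \<delta> * \<bar>real_of_int (n - j)\<bar>))\<^sup>2" by (intro power_mono l) auto
      then show ?thesis using pos unfolding sq h_def by (intro conjI zero_le_power2) linarith
    next
      assume "n \<ge> k"
      then have "(cmod (w n))\<^sup>2 \<le> (B * exp (- \<epsilon> * \<bar>real_of_int (n - k)\<bar>))\<^sup>2" by (intro power_mono r) auto
      then show ?thesis using pos unfolding sq h_def by (intro conjI zero_le_power2) linarith
    qed
  qed
  ultimately have "(\<lambda>n. (cmod (w n))\<^sup>2) summable_on UNIV"
    by (rule summable_on_of_cofinite_bound[where X = "{j<..<k}"]) auto
  then show ?thesis by (simp add: ell2_def)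
qed

lemma jacobi_symmetric_eq_0_iff:
  "jacobi (- 1) (- 1) V u n = 0 \<longleftrightarrow> u (n + 1) = V n * u n - u (n - 1)"
  by (auto simp: jacobi_def algebra_simps add_eq_0_iff2)

lemma jacobi_solution_determined_backward:
  fixes j n :: int and d :: complex
  assumes u: "\<And>n. n < j \<Longrightarrow> jacobi (- 1) (- 1) V u n = 0"
    and h: "\<And>n. n < j \<Longrightarrow> jacobi (- 1) (- 1) V h n = 0"
    and "u j = d * h j" "u (j - 1) = d * h (j - 1)" "n \<le> j"
  shows "u n = d * h n"
proof -
  have "u (j - int i) = d * h (j - int i) \<and> u (j - int i - 1) = d * h (j - int i - 1)" for i
  proof (induction i)
    case (Suc i)
    let ?n = "j - int i - 1"
    have e: "u (?n - 1) = V ?n * u ?n - u (?n + 1)" "h (?n - 1) = V ?n * h ?n - h (?n + 1)"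
      using u[of ?n] h[of ?n] unfolding jacobi_symmetric_eq_0_iff by simp_all
    have "u (?n - 1) = d * h (?n - 1)" unfolding e using Suc by (simp add: algebra_simps)
    then show ?case using Suc by (simp add: algebra_simps)
  qed (use assms in simp)
  from this[of "nat (j - n)"] show ?thesis using \<open>n \<le> j\<close> by simp
qed

text \<open>
  The Wronskian of two solutions on the left of \<open>j\<close> is constant there. It tends to \<open>0\<close> at \<open>-\<infinity>\<close>, so it
  vanishes and the solutions are proportional.
\<close>
lemma proportional_of_wronskian:
  assumes D: "\<And>n. n < j \<Longrightarrow> jacobi (- 1) (- 1) V D n = 0"
    and h: "\<And>n. n < j \<Longrightarrow> jacobi (- 1) (- 1) V h n = 0"
    and D0: "(\<lambda>i. D (j - int i)) \<longlonglongrightarrow> 0" and h0: "(\<lambda>i. h (j - int i)) \<longlonglongrightarrow> 0"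
    and nz: "n0 \<le> j" "h n0 \<noteq> 0"
  obtains c where "\<And>n. n \<le> j \<Longrightarrow> D n = c * h n"
proof -
  define W where "W = (\<lambda>n. D (n + 1) * h n - D n * h (n + 1))"
  have step: "W n = W (n - 1)" if "n < j" for n
  proof -
    have e: "D (n + 1) = V n * D n - D (n - 1)" "h (n + 1) = V n * h n - h (n - 1)"
      using D[OF that] h[OF that] unfolding jacobi_symmetric_eq_0_iff by simp_all
    show ?thesis unfolding W_def e by (simp add: algebra_simps)
  qed
  have W_const: "W (j - 1 - int i) = W (j - 1)" for i
  proof (induction i)
    case (Suc i)
    have "W (j - 1 - int i) = W (j - 1 - int i - 1)" by (rule step) simp
    then show ?case using Suc by (simp add: algebra_simps)
  qed simp
  have "(\<lambda>i. D (j - int i) * h (j - int (Suc i)) - D (j - int (Suc i)) * h (j - int i)) \<longlonglongrightarrow> 0 * 0 - 0 * 0"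
    by (intro tendsto_intros D0 h0 LIMSEQ_Suc[OF D0] LIMSEQ_Suc[OF h0])
  moreover have "D (j - int i) * h (j - int (Suc i)) - D (j - int (Suc i)) * h (j - int i) = W (j - 1)" for i
    using W_const[of i] unfolding W_def by (simp add: algebra_simps)
  ultimately have "(\<lambda>i::nat. W (j - 1)) \<longlonglongrightarrow> 0" by simp
  then have "W (j - 1) = 0" by (simp add: LIMSEQ_const_iff)
  then have par: "D j * h (j - 1) = D (j - 1) * h j" by (simp add: W_def)
  note backward = jacobi_solution_determined_backward[OF _ h]
  have "h j \<noteq> 0 \<or> h (j - 1) \<noteq> 0"
    using backward[where u = h and d = 0 and n = n0] h nz by auto
  then have "\<exists>c. D j = c * h j \<and> D (j - 1) = c * h (j - 1)"
  proof
    assume "h j \<noteq> 0"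
    then show ?thesis using par by (intro exI[of _ "D j / h j"]) (simp add: field_simps)
  next
    assume "h (j - 1) \<noteq> 0"
    then show ?thesis using par by (intro exI[of _ "D (j - 1) / h (j - 1)"]) (simp add: field_simps)
  qed
  then obtain c where "D j = c * h j" "D (j - 1) = c * h (j - 1)" by blast
  then show ?thesis using backward[where u = D and d = c] D by (intro that[of c]) blast
qed

text \<open>
  Undoing the weight turns \<open>\<Gamma>\<close> into a Green's function \<open>\<Gamma>0\<close> of the same recurrence as \<open>G\<close>, so \<open>\<Gamma>0 k - G k\<close>
  is a solution, and it decays at \<open>-\<infinity>\<close> because \<open>g \<ge> 0\<close>. Suppose it is not zero for some \<open>k\<close> and that some
  \<open>\<Gamma>0 j\<close> does not vanish identically on \<open>n \<le> j\<close>. Both decay at \<open>-\<infinity>\<close>, so they are proportional on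
  \<open>n \<le> j\<close>. Therefore the solution inherits from \<open>\<Gamma>\<close> a decay at \<open>-\<infinity>\<close> that survives the weight
  \<open>exp (- g n)\<close>; at \<open>+\<infinity>\<close> the weighted solution is controlled by \<open>\<Gamma> k\<close> and \<open>G k\<close>, which decay there. It is
  therefore a nonzero square-summable element of the kernel, against injectivity.
\<close>
theorem green_function_dichotomy:
  fixes g :: real and V :: "int \<Rightarrow> complex" and \<Gamma> G :: "int \<Rightarrow> int \<Rightarrow> complex"
  assumes g: "g \<ge> 0" and \<delta>: "\<delta> > 0" and \<epsilon>: "\<epsilon> > 0" and "C \<ge> 0" "D \<ge> 0"
    and \<Gamma>_eq: "\<And>k n. jacobi (- exp g) (- exp (- g)) V (\<Gamma> k) n = (if n = k then 1 else 0)"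
    and \<Gamma>_decay: "\<And>k n. cmod (\<Gamma> k n) \<le> C * exp (- \<delta> * \<bar>real_of_int (n - k)\<bar>)"
    and inj: "\<And>w n. w \<in> ell2 \<Longrightarrow> (\<And>n. jacobi (- exp g) (- exp (- g)) V w n = 0) \<Longrightarrow> w n = 0"
    and G_eq: "\<And>k n. jacobi (- 1) (- 1) V (G k) n = (if n = k then 1 else 0)"
    and G_decay: "\<And>k n. cmod (G k n) \<le> D * exp (- \<epsilon> * \<bar>real_of_int (n - k)\<bar>)"
  shows "(\<forall>k n. G k n = of_real (exp (g * of_int (n - k))) * \<Gamma> k n) \<or> (\<forall>k n. n \<le> k \<longrightarrow> \<Gamma> k n = 0)"
proof (rule ccontr)
  define \<Gamma>0 where "\<Gamma>0 = (\<lambda>k n. exp (g * of_int (n - k)) * \<Gamma> k n)"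
  define U where "U = (\<lambda>k n. \<Gamma>0 k n - G k n)"
  assume "\<not> ?thesis"
  then have "\<not> (\<forall>k n. G k n = \<Gamma>0 k n)" and "\<not> (\<forall>k n. n \<le> k \<longrightarrow> \<Gamma> k n = 0)"
    unfolding \<Gamma>0_def by blast+
  then obtain k n1 j n0 where "G k n1 \<noteq> \<Gamma>0 k n1" and n0: "n0 \<le> j" "\<Gamma> j n0 \<noteq> 0" by blast
  then have Un1: "U k n1 \<noteq> 0" by (simp add: U_def)
  have \<Gamma>0_eq: "jacobi (- 1) (- 1) V (\<Gamma>0 k) n = (if n = k then 1 else 0)" for k n
  proof -
    have "jacobi (- 1) (- 1) V (\<Gamma>0 k) n = exp (g * of_int (n - k)) * jacobi (- exp g) (- exp (- g)) V (\<Gamma> k) n"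
    proof -
      have e: "exp (g * of_int (n + 1 - k)) = exp g * exp (g * of_int (n - k))"
        "exp (g * of_int (n - 1 - k)) = exp (- g) * exp (g * of_int (n - k))"
        by (simp_all add: exp_add[symmetric] algebra_simps)
      show ?thesis unfolding jacobi_def \<Gamma>0_def e of_real_mult by (simp add: algebra_simps)
    qed
    then show ?thesis using \<Gamma>_eq by simp
  qed
  have U_eq: "jacobi (- 1) (- 1) V (U k) n = 0" for k n
  proof -
    have "jacobi (- 1) (- 1) V (U k) n = jacobi (- 1) (- 1) V (\<Gamma>0 k) n - jacobi (- 1) (- 1) V (G k) n"
      by (simp add: jacobi_def U_def algebra_simps)
    then show ?thesis by (simp add: \<Gamma>0_eq G_eq)
  qed
  have \<Gamma>0_left: "cmod (\<Gamma>0 k n) \<le> C * exp (- \<delta> * \<bar>real_of_int (n - k)\<bar>)" if "n \<le> k" for k n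
  proof -
    have "g * of_int (n - k) \<le> 0" using g that by (simp add: mult_nonneg_nonpos)
    then have "exp (g * of_int (n - k)) \<le> 1" by simp
    then have "cmod (\<Gamma>0 k n) \<le> 1 * cmod (\<Gamma> k n)"
      unfolding \<Gamma>0_def norm_mult by (intro mult_right_mono) auto
    then show ?thesis using \<Gamma>_decay[of k n] by linarith
  qed
  have \<Gamma>0_lim: "(\<lambda>i. \<Gamma>0 k (j - int i)) \<longlonglongrightarrow> 0" for k
    by (rule tendsto_0_of_left_decay[OF \<delta> \<Gamma>0_left])
  have "(\<lambda>i. U k (j - int i)) \<longlonglongrightarrow> 0 - 0"
    unfolding U_def by (intro tendsto_diff \<Gamma>0_lim tendsto_0_of_left_decay[OF \<epsilon> G_decay])
  then have U_lim: "(\<lambda>i. U k (j - int i)) \<longlonglongrightarrow> 0" by simp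
  have "\<Gamma>0 j n0 \<noteq> 0" using n0 by (simp add: \<Gamma>0_def)
  moreover have "jacobi (- 1) (- 1) V (\<Gamma>0 j) n = 0" if "n < j" for n using that by (simp add: \<Gamma>0_eq)
  ultimately obtain c where c: "\<And>n. n \<le> j \<Longrightarrow> U k n = c * \<Gamma>0 j n"
    using proportional_of_wronskian[OF U_eq _ U_lim \<Gamma>0_lim n0(1)] by blast
  \<comment> \<open>The weight turns solutions of the symmetric recurrence into kernel elements of the weighted operator.\<close>
  define w where "w = (\<lambda>n. exp (- g * of_int n) * U k n)"
  have w_eq: "jacobi (- exp g) (- exp (- g)) V w n = 0" for n
  proof -
    have "jacobi (- exp g) (- exp (- g)) V w n = exp (- g * of_int n) * jacobi (- 1) (- 1) V (U k) n"
    proof -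
      have e: "exp g * exp (- g * of_int (n + 1)) = exp (- g * of_int n)"
        "exp (- g) * exp (- g * of_int (n - 1)) = exp (- g * of_int n)"
        by (simp_all add: exp_add[symmetric] algebra_simps)
      have "jacobi (- exp g) (- exp (- g)) V w n
          = - of_real (exp g * exp (- g * of_int (n + 1))) * U k (n + 1)
            - of_real (exp (- g) * exp (- g * of_int (n - 1))) * U k (n - 1)
            + V n * (of_real (exp (- g * of_int n)) * U k n)"
        unfolding jacobi_def w_def of_real_mult by simp
      then show ?thesis unfolding e jacobi_def by (simp add: algebra_simps)
    qed
    then show ?thesis by (simp add: U_eq)
  qed
  define \<eta> where "\<eta> = min \<delta> \<epsilon>"
  have \<eta>: "\<eta> > 0" "\<eta> \<le> \<delta>" "\<eta> \<le> \<epsilon>" using \<delta> \<epsilon> by (auto simp: \<eta>_def)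
  have left: "cmod (w n) \<le> (cmod c * exp (- g * j) * C) * exp (- \<delta> * \<bar>real_of_int (n - j)\<bar>)" if "n \<le> j" for n
  proof -
    have "w n = c * exp (- g * j) * \<Gamma> j n"
    proof -
      have e: "exp (- g * of_int n) * exp (g * of_int (n - j)) = exp (- g * j)"
        by (simp add: exp_add[symmetric] algebra_simps)
      show ?thesis unfolding w_def c[OF that] \<Gamma>0_def
        using arg_cong[OF e, of complex_of_real] unfolding of_real_mult by (simp add: algebra_simps)
    qed
    then have "cmod (w n) = cmod c * exp (- g * j) * cmod (\<Gamma> j n)" by (simp add: norm_mult)
    also have "\<dots> \<le> cmod c * exp (- g * j) * (C * exp (- \<delta> * \<bar>real_of_int (n - j)\<bar>))"
      by (intro mult_left_mono \<Gamma>_decay) auto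
    finally show ?thesis by (simp add: mult_ac)
  qed
  have right: "cmod (w n) \<le> (exp (- g * k) * (C + D)) * exp (- \<eta> * \<bar>real_of_int (n - k)\<bar>)" if "n \<ge> k" for n
  proof -
    have "w n = exp (- g * k) * \<Gamma> k n - exp (- g * n) * G k n"
    proof -
      have e: "exp (- g * of_int n) * exp (g * of_int (n - k)) = exp (- g * k)"
        by (simp add: exp_add[symmetric] algebra_simps)
      show ?thesis unfolding w_def U_def \<Gamma>0_def
        using arg_cong[OF e, of complex_of_real] unfolding of_real_mult by (simp add: algebra_simps)
    qed
    then have "cmod (w n) \<le> exp (- g * k) * cmod (\<Gamma> k n) + exp (- g * n) * cmod (G k n)"
      using norm_triangle_ineq4[of "exp (- g * k) * \<Gamma> k n" "exp (- g * n) * G k n"] by (simp add: norm_mult)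
    also have "\<dots> \<le> exp (- g * k) * (C * exp (- \<eta> * \<bar>real_of_int (n - k)\<bar>))
        + exp (- g * k) * (D * exp (- \<eta> * \<bar>real_of_int (n - k)\<bar>))"
    proof (intro add_mono mult_mono)
      show "cmod (\<Gamma> k n) \<le> C * exp (- \<eta> * \<bar>real_of_int (n - k)\<bar>)"
        by (rule order_trans[OF \<Gamma>_decay]) (use \<eta> \<open>C \<ge> 0\<close> in \<open>auto intro!: mult_left_mono mult_right_mono\<close>)
      show "cmod (G k n) \<le> D * exp (- \<eta> * \<bar>real_of_int (n - k)\<bar>)"
        by (rule order_trans[OF G_decay]) (use \<eta> \<open>D \<ge> 0\<close> in \<open>auto intro!: mult_left_mono mult_right_mono\<close>)
      show "exp (- g * n) \<le> exp (- g * k)" using g that by (simp add: mult_left_mono)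
    qed (use \<open>C \<ge> 0\<close> \<open>D \<ge> 0\<close> in auto)
    finally show ?thesis by (simp add: algebra_simps)
  qed
  have "w \<in> ell2" by (rule ell2_of_one_sided_decay[OF \<delta> \<eta>(1) left right])
  then have "w n1 = 0" by (rule inj[OF _ w_eq])
  then show False using Un1 by (simp add: w_def)
qed

section \<open>Cauchy estimates along an orbit and continuants\<close>

text \<open>
  A Cauchy estimate in which the circle is replaced by one orbit on it.
\<close>
lemma power_series_orbit_bound:
  fixes c :: "nat \<Rightarrow> complex"
  assumes irr: "\<alpha> \<notin> \<rat>" and r: "r > 0" and summable: "summable (\<lambda>p. cmod (c p) * r ^ p)"
    and bound: "\<And>n::nat. cmod (\<Sum>p. c p * (of_real r * character 1 (x + n * \<alpha>)) ^ p) \<le> M"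
  shows "cmod (c q) * r ^ q \<le> M"
proof (rule field_le_epsilon)
  fix e :: real assume e: "e > 0"
  define t where "t = (\<lambda>n p. c p * (of_real r * character 1 (x + real n * \<alpha>)) ^ p)"
  have norm_t: "cmod (t n p) = cmod (c p) * r ^ p" for n p
    using r by (simp add: t_def norm_mult norm_power power_mult_distrib)
  obtain P0 where P0: "\<And>P. P \<ge> P0 \<Longrightarrow> norm (\<Sum>p. cmod (c (p + P)) * r ^ (p + P)) < e"
    using suminf_exist_split[OF e summable] by blast
  define P where "P = max P0 (Suc q)"
  have tail: "(\<Sum>p. cmod (c (p + P)) * r ^ (p + P)) < e" using P0[of P] by (auto simp: P_def)
  define a where "a = (\<lambda>k::int. c (nat k) * of_real r ^ nat k)"
  have "cmod (a (int q)) \<le> M + e"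
  proof (rule orbit_bound_imp_coeff_bound[OF irr, where A = "int ` {..<P}" and x = x])
    show "int q \<in> int ` {..<P}" by (auto simp: P_def)
    fix n :: nat
    have s: "summable (\<lambda>p. t n p)" "summable (\<lambda>p. cmod (t n p))"
      using summable by (auto simp: norm_t intro: summable_norm_cancel)
    have "(\<Sum>k\<in>int ` {..<P}. a k * character k (x + real n * \<alpha>)) = (\<Sum>p<P. t n p)"
      by (subst sum.reindex) (auto simp: a_def t_def character_of_nat power_mult_distrib mult_ac inj_on_def)
    also have "\<dots> = (\<Sum>p. t n p) - (\<Sum>p. t n (p + P))"
      using suminf_split_initial_segment[OF s(1), of P] by simp
    also have "cmod \<dots> \<le> cmod (\<Sum>p. t n p) + cmod (\<Sum>p. t n (p + P))" by (rule norm_triangle_ineq4)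
    also have "cmod (\<Sum>p. t n p) \<le> M" using bound[of n] by (simp add: t_def)
    also have "cmod (\<Sum>p. t n (p + P)) \<le> (\<Sum>p. cmod (t n (p + P)))"
      by (rule summable_norm) (use s in \<open>simp add: summable_iff_shift[of "\<lambda>p. cmod (t n p)"]\<close>)
    also have "\<dots> < e" using tail by (simp add: norm_t)
    finally show "cmod (\<Sum>k\<in>int ` {..<P}. a k * character k (x + real n * \<alpha>)) \<le> M + e" by simp
  qed simp
  then show "cmod (c q) * r ^ q \<le> M + e" using r by (simp add: a_def norm_mult norm_power)
qed

lemma poly_orbit_bound:
  fixes U :: "complex poly"
  assumes irr: "\<alpha> \<notin> \<rat>" and r: "r > 0"
    and bound: "\<And>n::nat. cmod (poly U (of_real r * character 1 (x + n * \<alpha>))) \<le> M"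
  shows "cmod (coeff U 0) \<le> M"
proof -
  have "cmod (coeff U 0) * r ^ 0 \<le> M"
  proof (rule power_series_orbit_bound[OF irr r])
    show "summable (\<lambda>p. cmod (coeff U p) * r ^ p)"
      by (rule summable_finite[of "{..degree U}"]) (auto simp: coeff_eq_0)
    fix n :: nat
    let ?z = "of_real r * character 1 (x + n * \<alpha>)"
    have "(\<Sum>p. coeff U p * ?z ^ p) = (\<Sum>p\<le>degree U. coeff U p * ?z ^ p)"
      by (rule suminf_finite) (auto simp: coeff_eq_0)
    then show "cmod (\<Sum>p. coeff U p * ?z ^ p) \<le> M" using bound[of n] by (simp add: poly_altdef)
  qed
  then show ?thesis by simp
qed

text \<open>
  The continuant of a three-term recurrence, that is the corner entry of a product of its transfer matrices,
  for the potential \<open>q(\<zeta>) / \<zeta>\<^sup>m\<close> evaluated at \<open>\<zeta> = \<omega>z, \<omega>\<^sup>2z, \<dots>\<close>, with all denominators cleared.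
\<close>
fun continuant_poly :: "complex poly \<Rightarrow> complex \<Rightarrow> nat \<Rightarrow> nat \<Rightarrow> complex poly" where
  "continuant_poly q \<omega> m 0 = 0"
| "continuant_poly q \<omega> m (Suc 0) = 1"
| "continuant_poly q \<omega> m (Suc (Suc l)) =
    pcompose q [:0, \<omega> ^ Suc l:] * continuant_poly q \<omega> m (Suc l)
    - pcompose (monom 1 m) [:0, \<omega> ^ Suc l:] * pcompose (monom 1 m) [:0, \<omega> ^ l:] * continuant_poly q \<omega> m l"

text \<open>
  At \<open>z = 0\<close> the subtracted term drops out, since clearing denominators gave it a positive power of \<open>z\<close>.
\<close>
lemma coeff_0_continuant_poly:
  assumes "m > 0"
  shows "coeff (continuant_poly q \<omega> m (Suc l)) 0 = coeff q 0 ^ l"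
proof (induction l)
  case (Suc l)
  have "coeff (pcompose p [:0, \<omega> ^ i:]) 0 = coeff p 0" for p i
    by (simp add: poly_0_coeff_0[symmetric] poly_pcompose)
  then show ?case using Suc assms by (simp add: coeff_mult_0)
qed simp

lemma poly_continuant_poly:
  fixes V W :: "nat \<Rightarrow> complex" and z \<omega> :: complex
  assumes rec: "\<And>l. W (Suc (Suc l)) = V (Suc l) * W (Suc l) - W l" and W: "W 0 = 0" "W (Suc 0) = 1"
    and V: "\<And>l. V l * (\<omega> ^ l * z) ^ m = poly q (\<omega> ^ l * z)"
  shows "poly (continuant_poly q \<omega> m l) z = W l * (\<Prod>s\<in>{1..<l}. (\<omega> ^ s * z) ^ m)"
proof (induction l rule: induct_nat_012)
  case (ge2 l)
  have p: "(\<Prod>s\<in>{1..<Suc (Suc l)}. (\<omega> ^ s * z) ^ m) = (\<omega> ^ Suc l * z) ^ m * (\<Prod>s\<in>{1..<Suc l}. (\<omega> ^ s * z) ^ m)"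
    by (simp add: prod.atLeastLessThan_Suc mult_ac)
  have q: "W l * (\<Prod>s\<in>{1..<Suc l}. (\<omega> ^ s * z) ^ m) = (\<omega> ^ l * z) ^ m * (W l * (\<Prod>s\<in>{1..<l}. (\<omega> ^ s * z) ^ m))"
    by (cases "l = 0") (simp_all add: W(1) prod.atLeastLessThan_Suc mult_ac)
  have "W (Suc (Suc l)) * (\<Prod>s\<in>{1..<Suc (Suc l)}. (\<omega> ^ s * z) ^ m)
      = (V (Suc l) * (\<omega> ^ Suc l * z) ^ m) * (W (Suc l) * (\<Prod>s\<in>{1..<Suc l}. (\<omega> ^ s * z) ^ m))
        - (\<omega> ^ Suc l * z) ^ m * ((\<omega> ^ l * z) ^ m * (W l * (\<Prod>s\<in>{1..<l}. (\<omega> ^ s * z) ^ m)))"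
    unfolding rec p q[symmetric] by (simp only: algebra_simps)
  also have "\<dots> = poly (continuant_poly q \<omega> m (Suc (Suc l))) z"
    unfolding V ge2.IH[symmetric] by (simp add: poly_pcompose poly_monom mult_ac)
  finally show ?case by simp
qed (simp_all add: W)

section \<open>The power series of the dual Green's function\<close>

text \<open>
  \<open>dual_coeff \<alpha> m vh E p j\<close> is the coefficient of \<open>\<zeta>\<close> to the power \<open>p\<close> in the Green's function between sites
  \<open>n\<close> and \<open>n - j\<close>, seen as a function of \<open>\<zeta> = \<zeta>\<^sub>n\<close>. Moving \<open>n\<close> by one multiplies \<open>\<zeta>\<close> by a character, which
  produces the phases. The equation is solved for the most singular term, of frequency \<open>- m\<close>, so that
  the coefficients at \<open>p\<close> are determined by those of smaller degree.
\<close>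
function dual_coeff :: "real \<Rightarrow> nat \<Rightarrow> (int \<Rightarrow> complex) \<Rightarrow> complex \<Rightarrow> nat \<Rightarrow> int \<Rightarrow> complex" where
  "dual_coeff \<alpha> m vh E p j = (if m = 0 \<or> p < m then 0 else
     ((if p = m \<and> j = 0 then 1 else 0)
      + character (int (p - m)) \<alpha> * dual_coeff \<alpha> m vh E (p - m) (j + 1)
      + character (- int (p - m)) \<alpha> * dual_coeff \<alpha> m vh E (p - m) (j - 1)
      + E * dual_coeff \<alpha> m vh E (p - m) j
      - (\<Sum>i\<in>{p - 2 * m..<p}. vh (int p - int m - int i) * dual_coeff \<alpha> m vh E i j)) / vh (- int m))"
  by pat_completeness auto
termination by (relation "Wellfounded.measure (\<lambda>(\<alpha>, m, vh, E, p, j). p)") auto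

declare dual_coeff.simps [simp del]

locale dual_expansion =
  fixes \<alpha> :: real and m :: nat and vh :: "int \<Rightarrow> complex" and E :: complex
  assumes m: "m > 0" and vh: "vh (- int m) \<noteq> 0"
begin

abbreviation c where "c \<equiv> dual_coeff \<alpha> m vh E"

lemma coeff_eq_0_of_less: "p < m \<Longrightarrow> c p j = 0"
  by (subst dual_coeff.simps) simp

lemma coeff_rec:
  "vh (- int m) * c (q + m) j = (if q = 0 \<and> j = 0 then 1 else 0)
     + character (int q) \<alpha> * c q (j + 1) + character (- int q) \<alpha> * c q (j - 1) + E * c q j
     - (\<Sum>i\<in>{q - m..<q + m}. vh (int q - int i) * c i j)"
proof -
  have "q + m - 2 * m = q - m" by simp
  then show ?thesis using m vh by (subst dual_coeff.simps) simp
qed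

text \<open>
  To change \<open>j\<close> by one the recursion must raise the degree by \<open>m\<close>, and the source sits at \<open>p = m\<close>, \<open>j = 0\<close>.
\<close>
lemma coeff_support: "int p < int m * (\<bar>j\<bar> + 1) \<Longrightarrow> c p j = 0"
proof (induction p arbitrary: j rule: less_induct)
  case (less p)
  show ?case
  proof (cases "p < m")
    case True
    then show ?thesis by (rule coeff_eq_0_of_less)
  next
    case False
    define q where "q = p - m"
    have p: "p = q + m" using False by (simp add: q_def)
    have q: "int q < int m * \<bar>j\<bar>" using less.prems unfolding p by (simp add: distrib_left)
    have le: "int m * \<bar>j\<bar> \<le> int m * (\<bar>j + 1\<bar> + 1)" "int m * \<bar>j\<bar> \<le> int m * (\<bar>j - 1\<bar> + 1)"
      "int m * \<bar>j\<bar> \<le> int m * (\<bar>j\<bar> + 1)"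
      by (intro mult_left_mono; linarith)+
    have qp: "q < p" using m p by simp
    have zero: "c q (j + 1) = 0" "c q (j - 1) = 0" "c q j = 0"
      by (rule less.IH[OF qp]; use q le in linarith)+
    have "(\<Sum>i\<in>{q - m..<q + m}. vh (int q - int i) * c i j) = 0"
    proof (rule sum.neutral, intro ballI)
      fix i assume "i \<in> {q - m..<q + m}"
      then have "i < p" using p by simp
      then have "c i j = 0" by (rule less.IH) (use less.prems \<open>i < p\<close> in linarith)
      then show "vh (int q - int i) * c i j = 0" by simp
    qed
    moreover have "\<not> (q = 0 \<and> j = 0)" using q by auto
    ultimately have "vh (- int m) * c p j = 0"
      using coeff_rec[of q j] zero unfolding p by auto
    then show ?thesis using vh by simp
  qed
qed

text \<open>
  On the boundary of the support only one path of the recursion contributes, namely \<open>j = 0, -1, \<dots>, -l\<close>.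
  It collects \<open>l + 1\<close> divisions by \<open>vh (- m)\<close>, up to phases.
\<close>
lemma coeff_leading: "cmod (c (m * Suc l) (- int l)) = inverse (cmod (vh (- int m))) ^ Suc l"
proof (induction l)
  case 0
  have "(\<Sum>i\<in>{0 - m..<0 + m}. vh (int 0 - int i) * c i 0) = 0"
    by (intro sum.neutral) (simp add: coeff_eq_0_of_less)
  then have "vh (- int m) * c (0 + m) 0 = 1"
    using coeff_rec[of 0 0] m by (simp add: coeff_eq_0_of_less)
  from arg_cong[OF this, of cmod] have "cmod (vh (- int m)) * cmod (c m 0) = 1" by (simp add: norm_mult)
  then show ?case using vh by (simp add: field_simps)
next
  case (Suc l)
  define q where "q = m * Suc l"
  define j where "j = - int (Suc l)"
  have mq: "m * Suc (Suc l) = q + m" by (simp add: q_def)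
  have zero: "c p j = 0" if "p < q + m" for p
  proof (rule coeff_support)
    have "int p < int (m * Suc (Suc l))" using that unfolding mq by (simp only: of_nat_less_iff)
    then show "int p < int m * (\<bar>j\<bar> + 1)" by (simp add: algebra_simps j_def)
  qed
  have "c q (j - 1) = 0"
    by (rule coeff_support) (use m in \<open>simp add: algebra_simps q_def j_def\<close>)
  moreover have "(\<Sum>i\<in>{q - m..<q + m}. vh (int q - int i) * c i j) = 0"
    by (intro sum.neutral ballI) (simp add: zero)
  moreover have "c q j = 0" by (rule zero) (use m in simp)
  moreover have "j + 1 = - int l" "j \<noteq> 0" by (simp_all add: j_def)
  ultimately have "vh (- int m) * c (q + m) j = character (int q) \<alpha> * c q (- int l)"
    using coeff_rec[of q j] by simp
  from arg_cong[OF this, of cmod]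
  have "cmod (vh (- int m)) * cmod (c (q + m) j) = cmod (c q (- int l))" by (simp add: norm_mult)
  then have "cmod (c (q + m) j) = inverse (cmod (vh (- int m))) * cmod (c q (- int l))"
    using vh by (simp add: field_simps)
  then show ?case unfolding mq j_def[symmetric] using Suc by (simp add: q_def)
qed

end

locale dual_expansion_bounded = dual_expansion +
  fixes K \<rho> r :: real
  assumes K: "K \<ge> 0" and \<rho>: "\<rho> > 0" and r: "r > 0" and conv: "\<rho> * r < 1"
    and coeff_bound: "\<And>p j. cmod (c p j) \<le> K * \<rho> ^ p"
begin

definition dual_series :: "int \<Rightarrow> complex \<Rightarrow> complex"
  where "dual_series j \<zeta> = (\<Sum>p. c p j * \<zeta> ^ p)"

lemma coeff_term_bound:
  assumes "cmod \<zeta> = r"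
  shows "cmod (c p j * \<zeta> ^ p) \<le> (if p < nat \<bar>j\<bar> then 0 else K * (\<rho> * r) ^ p)"
proof (cases "p < nat \<bar>j\<bar>")
  case True
  have "1 * \<bar>j\<bar> \<le> int m * \<bar>j\<bar>" using m by (intro mult_right_mono) auto
  then have "\<bar>j\<bar> \<le> int m * (\<bar>j\<bar> + 1)" by (simp add: distrib_left)
  then have "int p < int m * (\<bar>j\<bar> + 1)" using True by linarith
  then show ?thesis using True by (simp add: coeff_support)
next
  case False
  have "cmod (c p j) * r ^ p \<le> K * \<rho> ^ p * r ^ p"
    using r by (intro mult_right_mono coeff_bound) auto
  then show ?thesis using False assms by (simp add: norm_mult norm_power power_mult_distrib mult_ac)
qed

lemma summable_majorant: "summable (\<lambda>p. K * (\<rho> * r) ^ p)"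
  using \<rho> r conv by (intro summable_mult summable_geometric) auto

lemma summable_norm_coeff: "summable (\<lambda>p. cmod (c p j) * r ^ p)"
proof (rule summable_comparison_test'[OF summable_majorant])
  fix p
  show "norm (cmod (c p j) * r ^ p) \<le> K * (\<rho> * r) ^ p"
    using mult_right_mono[OF coeff_bound[of p j], of "r ^ p"] r
    by (simp add: power_mult_distrib mult_ac)
qed

lemma sums_dual_series:
  assumes "cmod \<zeta> = r"
  shows "(\<lambda>p. c p j * \<zeta> ^ p) sums dual_series j \<zeta>"
proof -
  have "summable (\<lambda>p. cmod (c p j * \<zeta> ^ p))"
    using summable_norm_coeff[of j] assms by (simp add: norm_mult norm_power)
  then show ?thesis unfolding dual_series_def by (rule summable_sums[OF summable_norm_cancel])
qed

lemma dual_series_decay: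
  assumes "cmod \<zeta> = r"
  shows "cmod (dual_series j \<zeta>) \<le> K / (1 - \<rho> * r) * (\<rho> * r) ^ nat \<bar>j\<bar>"
proof -
  let ?N = "nat \<bar>j\<bar>"
  have "(\<lambda>p. (\<rho> * r) ^ p) sums (1 / (1 - \<rho> * r))"
    using \<rho> r conv by (intro geometric_sums) auto
  then have "(\<lambda>p. K * (\<rho> * r) ^ ?N * (\<rho> * r) ^ p) sums (K * (\<rho> * r) ^ ?N * (1 / (1 - \<rho> * r)))"
    by (rule sums_mult)
  then have "(\<lambda>p. (\<lambda>p. if p < ?N then 0 else K * (\<rho> * r) ^ p) (p + ?N)) sums (K / (1 - \<rho> * r) * (\<rho> * r) ^ ?N)"
    by (simp add: power_add mult_ac)
  then have s: "(\<lambda>p. if p < ?N then 0 else K * (\<rho> * r) ^ p) sums (K / (1 - \<rho> * r) * (\<rho> * r) ^ ?N)"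
    by (subst (asm) sums_zero_iff_shift) auto
  have "cmod (dual_series j \<zeta>) \<le> (\<Sum>p. if p < ?N then 0 else K * (\<rho> * r) ^ p)"
    unfolding dual_series_def by (rule norm_suminf_le[OF coeff_term_bound[OF assms] sums_summable[OF s]])
  then show ?thesis unfolding sums_unique[OF s, symmetric] .
qed

text \<open>
  After multiplication by \<open>\<zeta>\<^sup>m\<close> both sides are power series in \<open>\<zeta>\<close>, and comparing coefficients gives back
  the recursion.
\<close>
lemma dual_series_green:
  assumes \<zeta>: "cmod \<zeta> = r"
  shows "((\<Sum>s\<le>2 * m. vh (int s - int m) * \<zeta> ^ s) / \<zeta> ^ m - E) * dual_series j \<zeta>
      - dual_series (j + 1) (character 1 \<alpha> * \<zeta>) - dual_series (j - 1) (character (- 1) \<alpha> * \<zeta>)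
    = (if j = 0 then 1 else 0)"
proof -
  have \<zeta>0: "\<zeta> \<noteq> 0" using \<zeta> r by auto
  have rot: "cmod (character k \<alpha> * \<zeta>) = r" for k using \<zeta> by (simp add: norm_mult)
  have shifted: "(\<lambda>P. if P < s then 0 else f (P - s) * \<zeta> ^ P) sums (\<zeta> ^ s * F)"
    if "(\<lambda>p. f p * \<zeta> ^ p) sums F" for s f F
  proof -
    have "(\<lambda>p. \<zeta> ^ s * (f p * \<zeta> ^ p)) sums (\<zeta> ^ s * F)" by (intro sums_mult that)
    then have "(\<lambda>p. (\<lambda>P. if P < s then 0 else f (P - s) * \<zeta> ^ P) (p + s)) sums (\<zeta> ^ s * F)"
      by (simp add: power_add mult_ac)
    then show ?thesis by (subst (asm) sums_zero_iff_shift) auto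
  qed
  define f where "f = (\<lambda>p. character (int p) \<alpha> * c p (j + 1) + character (- int p) \<alpha> * c p (j - 1) + E * c p j)"
  have "(\<lambda>p. f p * \<zeta> ^ p) sums (dual_series (j + 1) (character 1 \<alpha> * \<zeta>)
      + dual_series (j - 1) (character (- 1) \<alpha> * \<zeta>) + E * dual_series j \<zeta>)" (is "_ sums ?F")
  proof -
    have ch: "character (- int p) \<alpha> = character (- 1) \<alpha> ^ p" for p
      using character_of_nat[of p "- \<alpha>"] by (simp add: character_uminus_right)
    have "(\<lambda>p. c p (j + 1) * (character 1 \<alpha> * \<zeta>) ^ p + c p (j - 1) * (character (- 1) \<alpha> * \<zeta>) ^ p
        + E * (c p j * \<zeta> ^ p)) sums ?F"
      by (intro sums_add sums_mult sums_dual_series rot \<zeta>)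
    moreover have "c p (j + 1) * (character 1 \<alpha> * \<zeta>) ^ p + c p (j - 1) * (character (- 1) \<alpha> * \<zeta>) ^ p
        + E * (c p j * \<zeta> ^ p) = f p * \<zeta> ^ p" for p
      unfolding f_def ch character_of_nat by (simp add: power_mult_distrib algebra_simps)
    ultimately show ?thesis by simp
  qed
  then have rhs: "(\<lambda>P. if P < m then 0 else f (P - m) * \<zeta> ^ P) sums (\<zeta> ^ m * ?F)"
    by (rule shifted)
  have lhs: "(\<lambda>P. \<Sum>s\<le>2 * m. vh (int s - int m) * (if P < s then 0 else c (P - s) j * \<zeta> ^ P))
      sums (\<Sum>s\<le>2 * m. vh (int s - int m) * (\<zeta> ^ s * dual_series j \<zeta>))"
    by (intro sums_sum sums_mult shifted sums_dual_series \<zeta>)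
  have coeff: "(\<Sum>s\<le>2 * m. vh (int s - int m) * (if P < s then 0 else c (P - s) j * \<zeta> ^ P))
      - (if P < m then 0 else f (P - m) * \<zeta> ^ P) = (if P = m then (if j = 0 then \<zeta> ^ m else 0) else 0)" for P
  proof (cases "P < m")
    case True
    then have "(\<Sum>s\<le>2 * m. vh (int s - int m) * (if P < s then 0 else c (P - s) j * \<zeta> ^ P)) = 0"
      by (intro sum.neutral) (auto simp: coeff_eq_0_of_less)
    then show ?thesis using True by simp
  next
    case False
    define q where "q = P - m"
    have P: "P = q + m" using False by (simp add: q_def)
    have "(\<Sum>s\<le>2 * m. vh (int s - int m) * (if P < s then 0 else c (P - s) j))
        = vh (- int m) * c P j + (\<Sum>s\<in>{1..2 * m}. vh (int s - int m) * (if P < s then 0 else c (P - s) j))"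
      by (simp add: atMost_atLeast0 sum.atLeast_Suc_atMost)
    also have "(\<Sum>s\<in>{1..2 * m}. vh (int s - int m) * (if P < s then 0 else c (P - s) j))
        = (\<Sum>s\<in>{1..min P (2 * m)}. vh (int s - int m) * c (P - s) j)"
      by (intro sum.mono_neutral_cong_right) auto
    also have "\<dots> = (\<Sum>i\<in>{q - m..<q + m}. vh (int q - int i) * c i j)"
      by (rule sum.reindex_bij_witness[of _ "\<lambda>i. P - i" "\<lambda>s. P - s"]) (auto simp: P of_nat_diff)
    finally have "(\<Sum>s\<le>2 * m. vh (int s - int m) * (if P < s then 0 else c (P - s) j)) - f q
        = (if q = 0 \<and> j = 0 then 1 else 0)"
      using coeff_rec[of q j] unfolding f_def P by simp
    then have "((\<Sum>s\<le>2 * m. vh (int s - int m) * (if P < s then 0 else c (P - s) j)) - f q) * \<zeta> ^ P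
        = (if q = 0 \<and> j = 0 then 1 else 0) * \<zeta> ^ P" by simp
    moreover have "(\<Sum>s\<le>2 * m. vh (int s - int m) * (if P < s then 0 else c (P - s) j)) * \<zeta> ^ P
        = (\<Sum>s\<le>2 * m. vh (int s - int m) * (if P < s then 0 else c (P - s) j * \<zeta> ^ P))"
      unfolding sum_distrib_right by (intro sum.cong) auto
    ultimately have "(\<Sum>s\<le>2 * m. vh (int s - int m) * (if P < s then 0 else c (P - s) j * \<zeta> ^ P)) - f q * \<zeta> ^ P
        = (if q = 0 \<and> j = 0 then 1 else 0) * \<zeta> ^ P"
      by (simp only: left_diff_distrib)
    then show ?thesis using False by (simp add: q_def)
  qed
  \<comment> \<open>Only the source term, at the power \<open>m\<close>, survives.\<close>
  have "(\<lambda>P. if P = m then (if j = 0 then \<zeta> ^ m else 0) else 0) sums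
      ((\<Sum>s\<le>2 * m. vh (int s - int m) * (\<zeta> ^ s * dual_series j \<zeta>)) - \<zeta> ^ m * ?F)"
    using sums_diff[OF lhs rhs] unfolding coeff .
  moreover have "(\<lambda>P. if P = m then (if j = 0 then \<zeta> ^ m else 0) else 0) sums (if j = 0 then \<zeta> ^ m else 0)"
    using sums_single[of m "\<lambda>P. if j = 0 then \<zeta> ^ m else 0"] by simp
  ultimately have "(\<Sum>s\<le>2 * m. vh (int s - int m) * (\<zeta> ^ s * dual_series j \<zeta>)) - \<zeta> ^ m * ?F
      = (if j = 0 then \<zeta> ^ m else 0)"
    by (rule sums_unique2)
  moreover have "(\<Sum>s\<le>2 * m. vh (int s - int m) * (\<zeta> ^ s * dual_series j \<zeta>))
      = (\<Sum>s\<le>2 * m. vh (int s - int m) * \<zeta> ^ s) * dual_series j \<zeta>"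
    by (simp only: sum_distrib_right mult.assoc)
  ultimately have "((\<Sum>s\<le>2 * m. vh (int s - int m) * \<zeta> ^ s) * dual_series j \<zeta> - \<zeta> ^ m * ?F) / \<zeta> ^ m
      = (if j = 0 then 1 else 0)"
    using \<zeta>0 by simp
  moreover have "(X * dual_series j \<zeta> - \<zeta> ^ m * Y) / \<zeta> ^ m = X / \<zeta> ^ m * dual_series j \<zeta> - Y" for X Y
    using \<zeta>0 by (simp add: diff_divide_distrib)
  ultimately have "(\<Sum>s\<le>2 * m. vh (int s - int m) * \<zeta> ^ s) / \<zeta> ^ m * dual_series j \<zeta> - ?F
      = (if j = 0 then 1 else 0)"
    by (simp only:)
  then show ?thesis by (simp only: left_diff_distrib diff_diff_eq add_ac)
qed

text \<open>
  By \<open>coeff_support\<close> and \<open>coeff_leading\<close>, the power \<open>m (l + 1)\<close> is the lowest one in the series with index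
  \<open>- l\<close>, and the modulus of its coefficient is explicit.
\<close>
lemma dual_series_lower_bound:
  assumes irr: "\<alpha> \<notin> \<rat>"
    and bound: "\<And>n::nat. cmod (dual_series (- int l) (of_real r * character 1 (x + n * \<alpha>))) \<le> M"
  shows "(r ^ m / cmod (vh (- int m))) ^ Suc l \<le> M"
proof -
  have "cmod (c (m * Suc l) (- int l)) * r ^ (m * Suc l) \<le> M"
    by (rule power_series_orbit_bound[OF irr r summable_norm_coeff])
      (use bound in \<open>simp add: dual_series_def\<close>)
  moreover have "(r ^ m / cmod (vh (- int m))) ^ Suc l = inverse (cmod (vh (- int m))) ^ Suc l * r ^ (m * Suc l)"
    unfolding divide_inverse power_mult_distrib power_mult by (rule mult.commute)
  ultimately show ?thesis unfolding coeff_leading by linarith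
qed

end

section \<open>Energies in the spectrum\<close>

lemma not_le_exp_decay:
  fixes a C \<delta> :: real
  assumes "a > 0" "\<delta> > 0" and "\<And>l::nat. a \<le> C * exp (- \<delta> * l)"
  shows False
proof -
  have "(\<lambda>l. exp (- \<delta>) ^ l) \<longlonglongrightarrow> 0" using assms(2) by (intro LIMSEQ_power_zero) simp
  then have "(\<lambda>l. C * exp (- \<delta>) ^ l) \<longlonglongrightarrow> 0" by (rule tendsto_mult_right_zero)
  moreover have "C * exp (- \<delta>) ^ l = C * exp (- \<delta> * l)" for l
    by (simp add: exp_of_nat_mult[symmetric] mult.commute)
  ultimately have "(\<lambda>l::nat. C * exp (- \<delta> * l)) \<longlonglongrightarrow> 0" by simp
  then have "a \<le> 0" by (rule LIMSEQ_le_const) (use assms(3) in auto)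
  then show False using assms(1) by simp
qed

context dual_expansion_bounded
begin

definition orbit :: "real \<Rightarrow> int \<Rightarrow> complex"
  where "orbit x n = of_real r * character 1 (x + of_int n * \<alpha>)"

lemma cmod_orbit [simp]: "cmod (orbit x n) = r"
  using r by (simp add: orbit_def norm_mult)

lemma orbit_nonzero [simp]: "orbit x n \<noteq> 0"
  using r by (simp add: orbit_def)

lemma orbit_add: "orbit x (n + k) = character k \<alpha> * orbit x n"
proof -
  have "x + of_int (n + k) * \<alpha> = (x + of_int n * \<alpha>) + of_int k * \<alpha>" by (simp add: algebra_simps)
  moreover have "character 1 (of_int k * \<alpha>) = character k \<alpha>" by (simp add: character_def mult_ac)
  ultimately show ?thesis unfolding orbit_def by (simp add: character_add_right)
qed

lemma trig_poly_orbit: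
  assumes "r = exp (- 2 * pi * y)"
  shows "trig_poly m vh (Complex x y + of_int n * of_real \<alpha>)
    = (\<Sum>s\<le>2 * m. vh (int s - int m) * orbit x n ^ s) / orbit x n ^ m"
proof -
  let ?z = "Complex x y + of_int n * of_real \<alpha>"
  have \<zeta>: "orbit x n = exp (2 * of_real pi * \<i> * ?z)"
  proof -
    have "orbit x n = of_real (exp (- 2 * pi * y)) * exp (\<i> * of_real (2 * pi * (x + of_int n * \<alpha>)))"
      unfolding orbit_def character_def cis_conv_exp using assms by simp
    also have "\<dots> = exp (of_real (- 2 * pi * y) + \<i> * of_real (2 * pi * (x + of_int n * \<alpha>)))"
      by (simp only: exp_add exp_of_real)
    also have "of_real (- 2 * pi * y) + \<i> * of_real (2 * pi * (x + of_int n * \<alpha>)) = 2 * of_real pi * \<i> * ?z"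
      by (simp add: complex_eq_iff)
    finally show ?thesis .
  qed
  have "trig_poly m vh ?z = (\<Sum>k\<in>{- int m..int m}. vh k * orbit x n powi k)"
    unfolding trig_poly_def \<zeta> by (simp add: exp_power_int mult_ac)
  also have "\<dots> = (\<Sum>s\<le>2 * m. vh (int s - int m) * orbit x n powi (int s - int m))"
    by (rule sum.reindex_bij_witness[of _ "\<lambda>s. int s - int m" "\<lambda>k. nat (k + int m)"]) auto
  also have "\<dots> = (\<Sum>s\<le>2 * m. vh (int s - int m) * orbit x n ^ s) / orbit x n ^ m"
    unfolding sum_divide_distrib by (intro sum.cong) (auto simp: power_int_diff)
  finally show ?thesis .
qed

text \<open>
  The relation between \<open>g\<close> and \<open>y\<close> says that \<open>exp (- g) = r\<^sup>m / \<bar>vh (- m)\<bar>\<close>, which is exactly the rate in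
  \<open>dual_series_lower_bound\<close> and the inverse of the rate at which continuants grow. Off the spectrum the
  kernel \<open>\<Gamma>\<close> beats both rates by \<open>exp (- \<delta> l)\<close>, so neither case of the dichotomy can occur.
\<close>
theorem energy_in_op_spectrum:
  fixes g x y :: real
  assumes irr: "\<alpha> \<notin> \<rat>" and r_eq: "r = exp (- 2 * pi * y)"
    and g_eq: "g = 2 * pi * real m * y + ln (cmod (vh (- int m)))"
  shows "E \<in> op_spectrum (hop \<alpha> (trig_poly m vh) g (Complex x y))"
proof (rule ccontr)
  define v where "v = (\<lambda>n::int. trig_poly m vh (Complex x y + of_int n * of_real \<alpha>))"
  define V where "V = (\<lambda>n. v n - E)"
  have hop: "hop \<alpha> (trig_poly m vh) g (Complex x y) = jacobi (- exp g) (- exp (- g)) v"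
    by (intro ext) (simp add: hop_def jacobi_def v_def)
  have jE: "jacobi a b v u n - E * u n = jacobi a b V u n" for a b u n
    by (simp add: jacobi_def V_def algebra_simps)
  assume "\<not> ?thesis"
  then have "E \<notin> op_spectrum (jacobi (- exp g) (- exp (- g)) v)" unfolding hop by simp
  then obtain \<Gamma> C \<delta> where \<delta>: "\<delta> > 0" and C: "C \<ge> 0"
    and \<Gamma>_eq: "\<And>k n. jacobi (- exp g) (- exp (- g)) V (\<Gamma> k) n = (if n = k then 1 else 0)"
    and \<Gamma>_decay: "\<And>k n. cmod (\<Gamma> k n) \<le> C * exp (- \<delta> * \<bar>real_of_int (n - k)\<bar>)"
    and inj: "\<And>w n. w \<in> ell2 \<Longrightarrow> (\<And>n. jacobi (- exp g) (- exp (- g)) V w n = 0) \<Longrightarrow> w n = 0"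
    unfolding jE[symmetric] by (rule combes_thomas) blast
  have V_orbit: "V n = (\<Sum>s\<le>2 * m. vh (int s - int m) * orbit x n ^ s) / orbit x n ^ m - E" for n
    unfolding V_def v_def trig_poly_orbit[OF r_eq] ..
  have exp_g: "exp (- g) = r ^ m / cmod (vh (- int m))"
  proof -
    have "exp (- g) = exp (real m * (- 2 * pi * y)) / exp (ln (cmod (vh (- int m))))"
      unfolding g_eq exp_diff[symmetric] by (simp add: algebra_simps)
    then show ?thesis using vh unfolding r_eq by (simp add: exp_of_nat_mult[symmetric])
  qed
  define G where "G = (\<lambda>k n. dual_series (n - k) (orbit x n))"
  have G_eq: "jacobi (- 1) (- 1) V (G k) n = (if n = k then 1 else 0)" for k n
  proof -
    have "jacobi (- 1) (- 1) V (G k) n = V n * dual_series (n - k) (orbit x n)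
       - dual_series (n - k + 1) (orbit x (n + 1)) - dual_series (n - k - 1) (orbit x (n + - 1))"
      by (simp add: jacobi_def G_def algebra_simps)
    also have "\<dots> = (if n - k = 0 then 1 else 0)"
      unfolding orbit_add V_orbit by (rule dual_series_green) simp
    finally show ?thesis by simp
  qed
  define \<epsilon> where "\<epsilon> = - ln (\<rho> * r)"
  define D where "D = K / (1 - \<rho> * r)"
  have \<epsilon>: "\<epsilon> > 0" using \<rho> r conv by (simp add: \<epsilon>_def ln_less_zero)
  have D: "D \<ge> 0" using K conv by (simp add: D_def)
  have decay: "cmod (dual_series j (orbit x n)) \<le> D * exp (- \<epsilon> * \<bar>real_of_int j\<bar>)" for j n
  proof -
    have "(\<rho> * r) ^ nat \<bar>j\<bar> = exp (ln (\<rho> * r)) ^ nat \<bar>j\<bar>" using \<rho> r by simp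
    also have "\<dots> = exp (- \<epsilon> * \<bar>real_of_int j\<bar>)"
      unfolding exp_of_nat_mult[symmetric] \<epsilon>_def by (simp add: mult.commute)
    finally show ?thesis using dual_series_decay[of "orbit x n" j] unfolding D_def by simp
  qed
  have lower: "exp (- g) ^ Suc l \<le> M" if "\<And>n. cmod (dual_series (- int l) (orbit x n)) \<le> M" for l M
    unfolding exp_g
    by (rule dual_series_lower_bound[OF irr, of l x M])
      (use that[of "int _"] in \<open>simp add: orbit_def\<close>)
  \<comment> \<open>The decay of the series leaves no room for a rate \<open>exp (- g)\<close> of \<open>1\<close> or more.\<close>
  have g: "g \<ge> 0"
  proof (rule ccontr)
    assume "\<not> g \<ge> 0"
    then have "exp (- g) \<ge> 1" by simp
    have "1 \<le> D * exp (- \<epsilon> * l)" for l :: nat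
    proof -
      have "1 \<le> exp (- g) ^ Suc l" using \<open>exp (- g) \<ge> 1\<close> by (rule one_le_power)
      also have "\<dots> \<le> D * exp (- \<epsilon> * l)" by (rule lower) (use decay[of "- int l"] in simp)
      finally show ?thesis .
    qed
    then show False by (rule not_le_exp_decay[rotated 2]) (use \<epsilon> in auto)
  qed
  have "(\<forall>k n. G k n = of_real (exp (g * of_int (n - k))) * \<Gamma> k n) \<or> (\<forall>k n. n \<le> k \<longrightarrow> \<Gamma> k n = 0)"
  proof (rule green_function_dichotomy[OF g \<delta> \<epsilon> C D \<Gamma>_eq \<Gamma>_decay _ G_eq])
    show "w n = 0" if "w \<in> ell2" "\<And>n. jacobi (- exp g) (- exp (- g)) V w n = 0" for w n
      by (rule inj[OF that])
    show "cmod (G k n) \<le> D * exp (- \<epsilon> * \<bar>real_of_int (n - k)\<bar>)" for k n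
      unfolding G_def by (rule decay)
  qed
  then show False
  proof
    assume same: "\<forall>k n. G k n = of_real (exp (g * of_int (n - k))) * \<Gamma> k n"
    have "exp (- g) \<le> C * exp (- \<delta> * l)" for l :: nat
    proof -
      have "exp (- g) ^ Suc l \<le> exp (- g) ^ l * (C * exp (- \<delta> * l))"
      proof (rule lower)
        fix n
        have "dual_series (- int l) (orbit x n) = G (n + int l) n" by (simp add: G_def)
        also have "\<dots> = of_real (exp (g * of_int (n - (n + int l)))) * \<Gamma> (n + int l) n" using same by blast
        also have "exp (g * of_int (n - (n + int l))) = exp (- g) ^ l"
          by (simp add: exp_of_nat_mult[symmetric] mult.commute)
        finally have "cmod (dual_series (- int l) (orbit x n)) = exp (- g) ^ l * cmod (\<Gamma> (n + int l) n)"
          by (simp add: norm_mult norm_power)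
        also have "\<dots> \<le> exp (- g) ^ l * (C * exp (- \<delta> * l))"
          using \<Gamma>_decay[of "n + int l" n] by (intro mult_left_mono) auto
        finally show "cmod (dual_series (- int l) (orbit x n)) \<le> exp (- g) ^ l * (C * exp (- \<delta> * l))" .
      qed
      then have "exp (- g) ^ l * exp (- g) \<le> exp (- g) ^ l * (C * exp (- \<delta> * l))"
        by (simp only: power_Suc2)
      then show ?thesis by (subst (asm) mult_le_cancel_left_pos) auto
    qed
    then show False by (rule not_le_exp_decay[rotated 2]) (use \<delta> in auto)
  next
    assume causal: "\<forall>k n. n \<le> k \<longrightarrow> \<Gamma> k n = 0"
    define q where "q = (\<Sum>s\<le>2 * m. monom (vh (int s - int m)) s) - monom E m"
    have q: "V n * orbit x n ^ m = poly q (orbit x n)" for n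
      unfolding V_orbit q_def by (simp add: left_diff_distrib poly_sum poly_monom)
    have q0: "coeff q 0 = vh (- int m)"
      using m by (simp add: q_def coeff_sum if_distrib cong: if_cong)
    define \<omega> where "\<omega> = character 1 \<alpha>"
    have orbit_\<omega>: "\<omega> ^ l * orbit x k = orbit x (k + int l)" for l k
      unfolding \<omega>_def character_of_nat[symmetric] orbit_add ..
    have poly_bound: "cmod (poly (continuant_poly q \<omega> m (Suc l)) (orbit x k))
        \<le> exp g ^ Suc l * (C * exp (- \<delta> * Suc l)) * r ^ (m * l)" for k l
    proof -
      \<comment> \<open>By causality the unweighted column starts with \<open>0, -1\<close>, so up to sign it is the continuant.\<close>
      define W where "W = (\<lambda>l::nat. - of_real (exp (g * l)) * \<Gamma> k (k + int l))"
      have step: "of_real (exp (g * (n + 1 - k))) * \<Gamma> k (n + 1) = V n * (of_real (exp (g * (n - k))) * \<Gamma> k n)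
          - of_real (exp (g * (n - 1 - k))) * \<Gamma> k (n - 1) - (if n = k then 1 else 0)" for n
      proof -
        have e: "exp (g * (n + 1 - k)) = exp g * exp (g * (n - k))"
          "exp (g * (n - 1 - k)) = exp (- g) * exp (g * (n - k))"
          by (simp_all add: exp_add[symmetric] algebra_simps)
        have "of_real (exp g) * \<Gamma> k (n + 1) = V n * \<Gamma> k n - of_real (exp (- g)) * \<Gamma> k (n - 1) - (if n = k then 1 else 0)"
          unfolding \<Gamma>_eq[of k n, symmetric] jacobi_def by simp
        then have "of_real (exp (g * (n - k))) * (of_real (exp g) * \<Gamma> k (n + 1))
            = of_real (exp (g * (n - k))) * (V n * \<Gamma> k n - of_real (exp (- g)) * \<Gamma> k (n - 1) - (if n = k then 1 else 0))"
          by simp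
        then show ?thesis unfolding e of_real_mult by (auto simp: algebra_simps)
      qed
      have W0: "W 0 = 0" using causal by (simp add: W_def)
      have W1: "W (Suc 0) = 1"
        using step[of k] causal by (simp add: W_def)
      have W_rec: "W (Suc (Suc l)) = V (k + int (Suc l)) * W (Suc l) - W l" for l
        using step[of "k + int (Suc l)"] by (simp add: W_def algebra_simps)
      have "poly (continuant_poly q \<omega> m (Suc l)) (orbit x k)
          = W (Suc l) * (\<Prod>s\<in>{1..<Suc l}. (\<omega> ^ s * orbit x k) ^ m)"
        by (rule poly_continuant_poly[where V = "\<lambda>l. V (k + int l)"]) (simp_all only: W_rec W0 W1 orbit_\<omega> q)
      also have "cmod \<dots> = cmod (W (Suc l)) * r ^ (m * l)"
      proof -
        have "cmod (\<Prod>s\<in>{1..<Suc l}. orbit x (k + int s) ^ m) = (\<Prod>s\<in>{1..<Suc l}. r ^ m)"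
          by (simp only: prod_norm[symmetric] norm_power cmod_orbit)
        also have "\<dots> = r ^ (m * l)"
          unfolding power_mult by (simp only: prod_constant card_atLeastLessThan) simp
        finally show ?thesis unfolding orbit_\<omega> norm_mult by simp
      qed
      also have "cmod (W (Suc l)) \<le> exp g ^ Suc l * (C * exp (- \<delta> * Suc l))"
      proof -
        have "cmod (W (Suc l)) = exp g ^ Suc l * cmod (\<Gamma> k (k + int (Suc l)))"
          unfolding W_def exp_of_nat_mult[symmetric] by (simp add: norm_mult mult.commute)
        then show ?thesis using \<Gamma>_decay[of k "k + int (Suc l)"] by (simp add: mult_left_mono)
      qed
      finally show ?thesis using r by (simp add: mult_right_mono)
    qed
    have "1 \<le> (exp g * C * exp (- \<delta>)) * exp (- \<delta> * l)" for l :: nat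
    proof -
      have "cmod (coeff (continuant_poly q \<omega> m (Suc l)) 0)
          \<le> exp g ^ Suc l * (C * exp (- \<delta> * Suc l)) * r ^ (m * l)"
        by (rule poly_orbit_bound[OF irr r, where x = x])
          (use poly_bound[of l "int _"] in \<open>simp add: orbit_def\<close>)
      then have "cmod (vh (- int m)) ^ l \<le> exp g ^ Suc l * (C * exp (- \<delta> * Suc l)) * r ^ (m * l)"
        by (simp add: coeff_0_continuant_poly[OF m] q0 norm_power)
      moreover have "r ^ (m * l) = cmod (vh (- int m)) ^ l * exp (- g) ^ l"
        unfolding exp_g power_mult power_mult_distrib[symmetric] using vh by simp
      moreover have "exp g ^ Suc l * exp (- g) ^ l = exp g"
        by (simp add: power_mult_distrib[symmetric] exp_minus)
      moreover have "A * B * (X * Y) = X * ((A * Y) * B)" for A B X Y :: real by simp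
      ultimately have "cmod (vh (- int m)) ^ l * 1
          \<le> cmod (vh (- int m)) ^ l * (exp g * (C * exp (- \<delta> * Suc l)))"
        by (simp only: mult_1_right)
      then have "1 \<le> exp g * (C * exp (- \<delta> * Suc l))"
        by (subst (asm) mult_le_cancel_left_pos) (use vh in auto)
      also have "exp (- \<delta> * Suc l) = exp (- \<delta>) * exp (- \<delta> * l)"
        by (simp add: exp_add[symmetric] algebra_simps)
      finally show ?thesis by (simp add: mult_ac)
    qed
    then show False by (rule not_le_exp_decay[rotated 2]) (use \<delta> in auto)
  qed
qed

end

section \<open>The dual cocycle controls the coefficients\<close>

context dual_expansion
begin

text \<open>
  For fixed degree \<open>p\<close> the coefficients are the Fourier coefficients of a trigonometric polynomial in the dual
  phase \<open>\<theta>\<close>. The shifts of \<open>j\<close> become a multiplication by \<open>2 cos\<close> and the recursion becomes the dual equation,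
  with \<open>p\<close> as the lattice site.
\<close>
definition coeff_sum :: "nat \<Rightarrow> real \<Rightarrow> complex"
  where "coeff_sum p \<theta> = (\<Sum>j\<in>{- int p..int p}. c p j * character j \<theta>)"

lemma coeff_eq_0_of_abs_gt: "\<bar>j\<bar> \<ge> int p \<Longrightarrow> c p j = 0"
proof (rule coeff_support)
  assume "\<bar>j\<bar> \<ge> int p"
  then have "int p < 1 * (\<bar>j\<bar> + 1)" by simp
  also have "\<dots> \<le> int m * (\<bar>j\<bar> + 1)" using m by (intro mult_right_mono) auto
  finally show "int p < int m * (\<bar>j\<bar> + 1)" .
qed

lemma coeff_sum_shift:
  assumes "int p < N" and that: "\<bar>k\<bar> \<le> 1"
  shows "(\<Sum>j\<in>{- N..N}. c p (j + k) * character j \<theta>) = character (- k) \<theta> * coeff_sum p \<theta>"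
proof -
  have "(\<Sum>j\<in>{- N..N}. c p (j + k) * character j \<theta>)
      = (\<Sum>j\<in>{- N + k..N + k}. c p j * character (j - k) \<theta>)"
    by (rule sum.reindex_bij_witness[of _ "\<lambda>j. j - k" "\<lambda>j. j + k"]) auto
  also have "\<dots> = (\<Sum>j\<in>{- int p..int p}. c p j * character (j - k) \<theta>)"
    by (rule sum.mono_neutral_right) (use that assms in \<open>auto intro!: coeff_eq_0_of_abs_gt\<close>)
  also have "\<dots> = character (- k) \<theta> * coeff_sum p \<theta>"
    unfolding coeff_sum_def sum_distrib_left
    using character_add_left[of _ "- k" \<theta>] by (intro sum.cong) (auto simp: mult_ac)
  finally show ?thesis .
qed

lemma coeff_sum_rec:
  "vh (- int m) * coeff_sum (q + m) \<theta> = (if q = 0 then 1 else 0)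
     + of_real (2 * cos (2 * pi * (\<theta> - q * \<alpha>))) * coeff_sum q \<theta> + E * coeff_sum q \<theta>
     - (\<Sum>i\<in>{q - m..<q + m}. vh (int q - int i) * coeff_sum i \<theta>)"
proof -
  define N where "N = int (q + m) + 1"
  have S: "coeff_sum p \<theta> = (\<Sum>j\<in>{- N..N}. c p j * character j \<theta>)" if "p \<le> q + m" for p
    using coeff_sum_shift[of p N 0 \<theta>] that by (simp add: N_def)
  have sh: "(\<Sum>j\<in>{- N..N}. c q (j + 1) * character j \<theta>) = character (- 1) \<theta> * coeff_sum q \<theta>"
    "(\<Sum>j\<in>{- N..N}. c q (j - 1) * character j \<theta>) = character 1 \<theta> * coeff_sum q \<theta>"
    using coeff_sum_shift[of q N 1 \<theta>] coeff_sum_shift[of q N "- 1" \<theta>] m by (auto simp: N_def)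
  have "vh (- int m) * coeff_sum (q + m) \<theta> = (\<Sum>j\<in>{- N..N}. (vh (- int m) * c (q + m) j) * character j \<theta>)"
    unfolding S[OF order_refl] sum_distrib_left by (simp only: mult.assoc)
  also have "\<dots> = (\<Sum>j\<in>{- N..N}. (if q = 0 \<and> j = 0 then 1 else 0) * character j \<theta>)
      + (character (int q) \<alpha> * (\<Sum>j\<in>{- N..N}. c q (j + 1) * character j \<theta>)
      + character (- int q) \<alpha> * (\<Sum>j\<in>{- N..N}. c q (j - 1) * character j \<theta>))
      + E * (\<Sum>j\<in>{- N..N}. c q j * character j \<theta>)
      - (\<Sum>j\<in>{- N..N}. (\<Sum>i\<in>{q - m..<q + m}. vh (int q - int i) * c i j) * character j \<theta>)"
    unfolding coeff_rec by (simp only: distrib_right left_diff_distrib sum.distrib sum_subtractf sum_distrib_left mult.assoc add.assoc)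
  also have "(\<Sum>j\<in>{- N..N}. (if q = 0 \<and> j = 0 then 1 else 0) * character j \<theta>) = (if q = 0 then 1 else 0)"
  proof -
    have "(\<Sum>j\<in>{- N..N}. (if q = 0 \<and> j = 0 then 1 else 0) * character j \<theta>)
        = (\<Sum>j\<in>{- N..N}. if j = 0 then (if q = 0 then 1 else 0) else 0)"
      by (intro sum.cong) auto
    then show ?thesis by (simp add: N_def)
  qed
  also have "(\<Sum>j\<in>{- N..N}. (\<Sum>i\<in>{q - m..<q + m}. vh (int q - int i) * c i j) * character j \<theta>)
      = (\<Sum>i\<in>{q - m..<q + m}. vh (int q - int i) * coeff_sum i \<theta>)"
  proof -
    have "(\<Sum>i\<in>{q - m..<q + m}. vh (int q - int i) * coeff_sum i \<theta>)
        = (\<Sum>i\<in>{q - m..<q + m}. \<Sum>j\<in>{- N..N}. vh (int q - int i) * c i j * character j \<theta>)"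
      by (intro sum.cong refl) (simp add: S sum_distrib_left mult.assoc)
    also have "\<dots> = (\<Sum>j\<in>{- N..N}. \<Sum>i\<in>{q - m..<q + m}. vh (int q - int i) * c i j * character j \<theta>)"
      by (rule sum.swap)
    finally show ?thesis by (simp only: sum_distrib_right)
  qed
  also have "(\<Sum>j\<in>{- N..N}. c q j * character j \<theta>) = coeff_sum q \<theta>" by (simp add: S)
  also have "character (int q) \<alpha> * (\<Sum>j\<in>{- N..N}. c q (j + 1) * character j \<theta>)
      + character (- int q) \<alpha> * (\<Sum>j\<in>{- N..N}. c q (j - 1) * character j \<theta>)
     = of_real (2 * cos (2 * pi * (\<theta> - q * \<alpha>))) * coeff_sum q \<theta>"
  proof -
    have e: "character (int q) \<alpha> * character (- 1) \<theta> + character (- int q) \<alpha> * character 1 \<theta>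
        = cis (- (2 * pi * (\<theta> - q * \<alpha>))) + cis (2 * pi * (\<theta> - q * \<alpha>))"
      by (simp add: character_def cis_mult algebra_simps)
    have "cis (- t) + cis t = of_real (2 * cos t)" for t by (rule complex_eqI) simp_all
    then show ?thesis unfolding sh mult.assoc[symmetric] distrib_right[symmetric] e by simp
  qed
  finally show ?thesis .
qed

lemma coeff_sum_eq_0_of_less: "p < m \<Longrightarrow> coeff_sum p \<theta> = 0"
  by (simp add: coeff_sum_def coeff_eq_0_of_less)

text \<open>
  Conjugation replaces the coefficients \<open>vh (- k)\<close> by \<open>vh k\<close> and \<open>E\<close> by \<open>cnj E\<close>; reflecting the phase
  restores the direction of the rotation. Taking the sign of the dual operator into account, the dual
  energy is \<open>- cnj E\<close>.
\<close>
definition dual_solution :: "real \<Rightarrow> int \<Rightarrow> complex"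
  where "dual_solution x n = (if n < 0 then 0 else cnj (coeff_sum (nat n) (- x)))"

end

locale real_dual_expansion = dual_expansion +
  assumes real: "\<And>k. \<bar>k\<bar> \<le> int m \<Longrightarrow> cnj (vh k) = vh (- k)"
begin

lemma top_coeff_nonzero: "vh (int m) \<noteq> 0"
  using real[of "int m"] vh complex_cnj_zero_iff[of "vh (int m)"] by simp

lemma dual_solution_eq_0_of_less: "n < int m \<Longrightarrow> dual_solution x n = 0"
  by (simp add: dual_solution_def coeff_sum_eq_0_of_less)

lemma dual_solution_rec:
  assumes "n \<ge> 0"
  shows "vh (int m) * dual_solution x (n + int m) = (if n = 0 then 1 else 0)
     + (of_real (2 * cos (2 * pi * (x + of_int n * \<alpha>))) + cnj E) * dual_solution x n
     - (\<Sum>k\<in>{- int m..<int m}. vh k * dual_solution x (n + k))"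
proof -
  define q where "q = nat n"
  have n: "n = int q" using assms by (simp add: q_def)
  have cos: "cos (2 * pi * (- x - real q * \<alpha>)) = cos (2 * pi * (x + of_int n * \<alpha>))"
    using cos_minus[of "2 * pi * (x + of_int n * \<alpha>)"] unfolding n by (simp add: algebra_simps)
  have u: "cnj (coeff_sum i (- x)) = dual_solution x (int i)" for i by (simp add: dual_solution_def)
  have "cnj (\<Sum>i\<in>{q - m..<q + m}. vh (int q - int i) * coeff_sum i (- x))
      = (\<Sum>i\<in>{q - m..<q + m}. vh (int i - int q) * dual_solution x (int i))"
    unfolding cnj_sum
  proof (intro sum.cong refl)
    fix i assume "i \<in> {q - m..<q + m}"
    then have "\<bar>int q - int i\<bar> \<le> int m" by auto
    then show "cnj (vh (int q - int i) * coeff_sum i (- x)) = vh (int i - int q) * dual_solution x (int i)"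
      by (simp add: real u)
  qed
  also have "\<dots> = (\<Sum>k\<in>{max (- int q) (- int m)..<int m}. vh k * dual_solution x (n + k))"
    unfolding n by (rule sum.reindex_bij_witness[of _ "\<lambda>k. nat (int q + k)" "\<lambda>i. int i - int q"]) auto
  also have "\<dots> = (\<Sum>k\<in>{- int m..<int m}. vh k * dual_solution x (n + k))"
    by (rule sum.mono_neutral_left) (auto simp: n dual_solution_def)
  finally have sum: "cnj (\<Sum>i\<in>{q - m..<q + m}. vh (int q - int i) * coeff_sum i (- x))
      = (\<Sum>k\<in>{- int m..<int m}. vh k * dual_solution x (n + k))" .
  have "vh (int m) * dual_solution x (n + int m) = cnj (vh (- int m) * coeff_sum (q + m) (- x))"
    using real[of "- int m"] u[of "q + m"] by (simp add: n)
  also have "\<dots> = (if n = 0 then 1 else 0)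
     + (of_real (2 * cos (2 * pi * (x + of_int n * \<alpha>))) + cnj E) * dual_solution x n
     - (\<Sum>k\<in>{- int m..<int m}. vh k * dual_solution x (n + k))"
    unfolding coeff_sum_rec complex_cnj_diff complex_cnj_add complex_cnj_mult sum u cos complex_cnj_complex_of_real
    by (simp add: n distrib_right)
  finally show ?thesis .
qed

text \<open>
  The source of the recursion sits at \<open>n = 0\<close>, so from \<open>n = 1\<close> on the transfer matrices propagate the solution.
\<close>
lemma state_vec_dual_solution_step:
  assumes "n \<ge> 1"
  shows "state_vec m (dual_solution x) (n + 1)
    = dual_transfer m vh (- cnj E) (x + of_int n * \<alpha>) *\<^sub>v state_vec m (dual_solution x) n"
proof (rule eq_vecI)
  let ?T = "dual_transfer m vh (- cnj E) (x + of_int n * \<alpha>)"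
  let ?u = "dual_solution x"
  show "dim_vec (state_vec m ?u (n + 1)) = dim_vec (?T *\<^sub>v state_vec m ?u n)"
    by (simp add: state_vec_def dual_transfer_def)
  fix i assume "i < dim_vec (?T *\<^sub>v state_vec m ?u n)"
  then have i: "i < 2 * m" by (simp add: dual_transfer_def)
  have entry: "(?T *\<^sub>v state_vec m ?u n) $ i = (\<Sum>j\<in>{0..<2 * m}. ?T $$ (i, j) * ?u (n + int m - 1 - int j))"
    using i by (auto simp: dual_transfer_def state_vec_def scalar_prod_def intro!: sum.cong)
  show "state_vec m ?u (n + 1) $ i = (?T *\<^sub>v state_vec m ?u n) $ i"
  proof (cases i)
    case 0
    define a where "a = of_real (2 * cos (2 * pi * (x + of_int n * \<alpha>))) + cnj E"
    have "(\<Sum>j\<in>{0..<2 * m}. ?T $$ (i, j) * ?u (n + int m - 1 - int j))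
        = (\<Sum>k\<in>{- int m..<int m}. ((if k = 0 then a else 0) - vh k) / vh (int m) * ?u (n + k))"
      by (rule sum.reindex_bij_witness[of _ "\<lambda>k. nat (int m - 1 - k)" "\<lambda>j. int m - 1 - int j"])
        (auto simp: dual_transfer_def a_def Let_def 0 algebra_simps)
    also have "\<dots> = (\<Sum>k\<in>{- int m..<int m}. (if k = 0 then a * ?u n else 0) - vh k * ?u (n + k)) / vh (int m)"
      unfolding sum_divide_distrib by (intro sum.cong) (auto simp: left_diff_distrib)
    also have "\<dots> = (a * ?u n - (\<Sum>k\<in>{- int m..<int m}. vh k * ?u (n + k))) / vh (int m)"
      using m by (simp add: sum_subtractf)
    also have "a * ?u n - (\<Sum>k\<in>{- int m..<int m}. vh k * ?u (n + k)) = vh (int m) * ?u (n + int m)"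
      using dual_solution_rec[of n x] assms by (simp add: a_def)
    finally show ?thesis unfolding entry using top_coeff_nonzero m by (simp add: state_vec_def 0)
  next
    case (Suc l)
    have "(\<Sum>j\<in>{0..<2 * m}. ?T $$ (i, j) * ?u (n + int m - 1 - int j))
        = (\<Sum>j\<in>{0..<2 * m}. if j = l then ?u (n + int m - 1 - int j) else 0)"
      using i Suc by (intro sum.cong) (auto simp: dual_transfer_def)
    then show ?thesis unfolding entry using i Suc by (simp add: state_vec_def diff_diff_eq)
  qed
qed

lemma cocycle_iterate_carrier:
  "cocycle_iterate \<alpha> (dual_transfer m vh e) N x \<in> carrier_mat (2 * m) (2 * m)"
proof (induction N)
  case (Suc N)
  have "dual_transfer m vh e (x + of_nat N * \<alpha>) \<in> carrier_mat (2 * m) (2 * m)" by (simp add: dual_transfer_def)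
  then show ?case using Suc by (simp add: mult_carrier_mat)
qed (simp add: dual_transfer_def)

lemma state_vec_dual_solution:
  "state_vec m (dual_solution x) (1 + int N)
    = cocycle_iterate \<alpha> (dual_transfer m vh (- cnj E)) N (x + \<alpha>) *\<^sub>v state_vec m (dual_solution x) 1"
proof (induction N)
  case 0
  have "state_vec m (dual_solution x) 1 \<in> carrier_vec (2 * m)" by (simp add: state_vec_def)
  then show ?case by (simp add: dual_transfer_def)
next
  case (Suc N)
  let ?A = "cocycle_iterate \<alpha> (dual_transfer m vh (- cnj E)) N (x + \<alpha>)"
  have carrier: "state_vec m (dual_solution x) 1 \<in> carrier_vec (2 * m)"
    "dual_transfer m vh (- cnj E) t \<in> carrier_mat (2 * m) (2 * m)" for t
    by (simp_all add: state_vec_def dual_transfer_def)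
  have t: "x + of_int (1 + int N) * \<alpha> = x + \<alpha> + of_nat N * \<alpha>" by (simp add: algebra_simps)
  have "state_vec m (dual_solution x) (1 + int N + 1)
      = dual_transfer m vh (- cnj E) (x + \<alpha> + of_nat N * \<alpha>) *\<^sub>v (?A *\<^sub>v state_vec m (dual_solution x) 1)"
    using state_vec_dual_solution_step[of "1 + int N" x] unfolding t Suc by simp
  then show ?case
    unfolding cocycle_iterate.simps assoc_mult_mat_vec[OF carrier(2) cocycle_iterate_carrier carrier(1)] by simp
qed

text \<open>
  At \<open>n = 1\<close> the state vector is \<open>1 / vh m\<close> times the first unit vector.
\<close>
lemma dual_solution_eq_cocycle_entry:
  "dual_solution x (int N + int m)
    = cocycle_iterate \<alpha> (dual_transfer m vh (- cnj E)) N (x + \<alpha>) $$ (0, 0) / vh (int m)"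
proof -
  let ?A = "cocycle_iterate \<alpha> (dual_transfer m vh (- cnj E)) N (x + \<alpha>)"
  have A: "?A \<in> carrier_mat (2 * m) (2 * m)" by (rule cocycle_iterate_carrier)
  have "(\<Sum>k\<in>{- int m..<int m}. vh k * dual_solution x (0 + k)) = 0"
    by (intro sum.neutral) (simp add: dual_solution_eq_0_of_less)
  then have "vh (int m) * dual_solution x (int m) = 1"
    using dual_solution_rec[of 0 x] m by (simp add: dual_solution_eq_0_of_less)
  then have um: "dual_solution x (int m) = 1 / vh (int m)" using top_coeff_nonzero by (simp add: field_simps)
  have "dual_solution x (int N + int m) = state_vec m (dual_solution x) (1 + int N) $ 0"
    using m by (simp add: state_vec_def)
  also have "\<dots> = (\<Sum>j\<in>{0..<2 * m}. ?A $$ (0, j) * dual_solution x (int m - int j))"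
    unfolding state_vec_dual_solution using A m
    by (auto simp: state_vec_def scalar_prod_def intro!: sum.cong)
  also have "\<dots> = (\<Sum>j\<in>{0..<2 * m}. if j = 0 then ?A $$ (0, 0) / vh (int m) else 0)"
    by (intro sum.cong) (auto simp: um dual_solution_eq_0_of_less)
  finally show ?thesis using m by simp
qed

text \<open>
  Each coefficient is a Fourier coefficient of \<open>coeff_sum p\<close>, whose modulus is that of a cocycle entry
  divided by \<open>vh m\<close>.
\<close>
theorem coeff_bound_of_cocycle_bound:
  assumes irr: "\<alpha> \<notin> \<rat>" and \<rho>: "\<rho> > 0"
    and growth: "\<And>N x. cmod (cocycle_iterate \<alpha> (dual_transfer m vh (- cnj E)) N x $$ (0, 0)) \<le> K * \<rho> ^ N"
  shows "cmod (c p j) \<le> K / (cmod (vh (int m)) * \<rho> ^ m) * \<rho> ^ p"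
proof -
  have K: "K \<ge> 0" using order_trans[OF norm_ge_zero growth[of 0 0]] by simp
  then have nonneg: "K / (cmod (vh (int m)) * \<rho> ^ m) * \<rho> ^ p \<ge> 0" using \<rho> by simp
  have sum: "cmod (coeff_sum p \<theta>) \<le> K / (cmod (vh (int m)) * \<rho> ^ m) * \<rho> ^ p" for \<theta>
  proof (cases "p < m")
    case True
    then show ?thesis using nonneg by (simp add: coeff_sum_eq_0_of_less)
  next
    case False
    define N where "N = p - m"
    have p: "p = N + m" using False by (simp add: N_def)
    have "cmod (coeff_sum p \<theta>) = cmod (dual_solution (- \<theta>) (int N + int m))"
      by (simp add: dual_solution_def p nat_int_add)
    also have "\<dots> \<le> K * \<rho> ^ N / cmod (vh (int m))"
      unfolding dual_solution_eq_cocycle_entry norm_divide by (intro divide_right_mono growth) simp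
    also have "\<dots> = K / (cmod (vh (int m)) * \<rho> ^ m) * \<rho> ^ p" using \<rho> by (simp add: p power_add)
    finally show ?thesis .
  qed
  show ?thesis
  proof (cases "\<bar>j\<bar> < int p")
    case True
    then have "j \<in> {- int p..int p}" by auto
    then show ?thesis
      using orbit_bound_imp_coeff_bound[OF irr, of "{- int p..int p}" j "c p" 0] sum
      unfolding coeff_sum_def by blast
  next
    case False
    then show ?thesis using nonneg by (simp add: coeff_eq_0_of_abs_gt)
  qed
qed

end

section \<open>Entry sums and the largest singular value\<close>

lemma mult_mat_entry:
  assumes "A \<in> carrier_mat n k" "B \<in> carrier_mat k l" "i < n" "j < l"
  shows "(A * B) $$ (i, j) = (\<Sum>t<k. A $$ (i, t) * B $$ (t, j))"
  using assms by (auto simp: scalar_prod_def lessThan_atLeast0 intro!: sum.cong)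

lemma mult_mat_vec_entry:
  assumes "A \<in> carrier_mat n k" "v \<in> carrier_vec k" "i < n"
  shows "(A *\<^sub>v v) $ i = (\<Sum>t<k. A $$ (i, t) * v $ t)"
  using assms by (auto simp: scalar_prod_def lessThan_atLeast0 intro!: sum.cong)

text \<open>
  A submultiplicative size of matrices that is continuous in the entries and comparable to the largest singular
  value up to a factor depending on the dimension. Such factors do not affect exponential growth rates.
\<close>
definition entry_sum :: "complex mat \<Rightarrow> real"
  where "entry_sum A = (\<Sum>i<dim_row A. \<Sum>j<dim_col A. cmod (A $$ (i, j)))"

lemma entry_sum_carrier:
  "A \<in> carrier_mat n k \<Longrightarrow> entry_sum A = (\<Sum>i<n. \<Sum>j<k. cmod (A $$ (i, j)))"
  by (simp add: entry_sum_def)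

lemma entry_sum_nonneg: "entry_sum A \<ge> 0"
  unfolding entry_sum_def by (intro sum_nonneg) auto

lemma entry_le_entry_sum:
  assumes "A \<in> carrier_mat n k" "i < n" "j < k"
  shows "cmod (A $$ (i, j)) \<le> entry_sum A"
proof -
  have "cmod (A $$ (i, j)) \<le> (\<Sum>j<k. cmod (A $$ (i, j)))"
    using assms by (intro member_le_sum) auto
  also have "\<dots> \<le> (\<Sum>i<n. \<Sum>j<k. cmod (A $$ (i, j)))"
    using assms by (intro member_le_sum[of i _ "\<lambda>i. \<Sum>j<k. cmod (A $$ (i, j))"] sum_nonneg) auto
  finally show ?thesis using assms(1) by (simp add: entry_sum_carrier)
qed

lemma entry_sum_mult:
  assumes A: "A \<in> carrier_mat n k" and B: "B \<in> carrier_mat k l"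
  shows "entry_sum (A * B) \<le> entry_sum A * entry_sum B"
proof -
  have "entry_sum (A * B) = (\<Sum>i<n. \<Sum>j<l. cmod (\<Sum>t<k. A $$ (i, t) * B $$ (t, j)))"
    unfolding entry_sum_carrier[OF mult_carrier_mat[OF A B]]
    by (intro sum.cong refl arg_cong[of _ _ cmod] mult_mat_entry[OF A B]) auto
  also have "\<dots> \<le> (\<Sum>i<n. \<Sum>j<l. \<Sum>t<k. cmod (A $$ (i, t)) * cmod (B $$ (t, j)))"
    by (intro sum_mono order_trans[OF norm_sum]) (simp add: norm_mult)
  also have "\<dots> = (\<Sum>i<n. \<Sum>t<k. cmod (A $$ (i, t)) * (\<Sum>j<l. cmod (B $$ (t, j))))"
    unfolding sum_distrib_left by (intro sum.cong refl sum.swap)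
  also have "\<dots> \<le> (\<Sum>i<n. \<Sum>t<k. cmod (A $$ (i, t)) * entry_sum B)"
  proof (intro sum_mono mult_left_mono)
    fix t assume "t \<in> {..<k}"
    then show "(\<Sum>j<l. cmod (B $$ (t, j))) \<le> entry_sum B"
      unfolding entry_sum_carrier[OF B]
      by (intro member_le_sum[of t _ "\<lambda>t. \<Sum>j<l. cmod (B $$ (t, j))"] sum_nonneg) auto
  qed simp
  also have "\<dots> = entry_sum A * entry_sum B"
    by (simp add: entry_sum_carrier[OF A] sum_distrib_right)
  finally show ?thesis .
qed

lemma entry_sum_one: "entry_sum (1\<^sub>m n) = real n"
proof -
  have "(\<Sum>j<n. cmod (1\<^sub>m n $$ (i, j))) = 1" if "i < n" for i
  proof -
    have "(\<Sum>j<n. cmod (1\<^sub>m n $$ (i, j))) = (\<Sum>j<n. if i = j then 1 else 0)"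
      using that by (intro sum.cong) auto
    then show ?thesis using that by simp
  qed
  then show ?thesis by (simp add: entry_sum_def)
qed

lemma cmod_det_le:
  assumes A: "A \<in> carrier_mat n n"
  shows "cmod (det A) \<le> fact n * entry_sum A ^ n"
proof -
  let ?P = "{p. p permutes {0..<n}}"
  have "cmod (det A) \<le> (\<Sum>p\<in>?P. cmod (signof p * (\<Prod>i = 0..<n. A $$ (i, p i))))"
    unfolding det_def'[OF A] by (rule norm_sum)
  also have "\<dots> \<le> (\<Sum>p\<in>?P. entry_sum A ^ n)"
  proof (rule sum_mono)
    fix p assume "p \<in> ?P"
    then have p: "p i < n" if "i < n" for i using permutes_in_image[of p "{0..<n}" i] that by simp
    have "cmod (signof p * (\<Prod>i = 0..<n. A $$ (i, p i))) = (\<Prod>i = 0..<n. cmod (A $$ (i, p i)))"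
      by (simp add: norm_mult prod_norm sign_def)
    also have "\<dots> \<le> (\<Prod>i = 0..<n. entry_sum A)"
      by (intro prod_mono conjI norm_ge_zero entry_le_entry_sum[OF A]) (use p in auto)
    finally show "cmod (signof p * (\<Prod>i = 0..<n. A $$ (i, p i))) \<le> entry_sum A ^ n" by simp
  qed
  also have "\<dots> = fact n * entry_sum A ^ n" by (simp add: card_permutations)
  finally show ?thesis .
qed

text \<open>
  By the Leibniz formula a matrix with small entries has a small determinant. Consequently the logarithm of the
  entry sum is bounded below along a unimodular cocycle.
\<close>
lemma entry_sum_ge_of_unimodular:
  assumes A: "A \<in> carrier_mat n n" and n: "n > 0" and "cmod (det A) = 1"
  shows "entry_sum A \<ge> 1 / fact n"
proof (rule ccontr)
  assume "\<not> entry_sum A \<ge> 1 / fact n"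
  then have less: "entry_sum A < 1 / fact n" by simp
  also have "\<dots> \<le> 1" by simp
  finally have "entry_sum A ^ n \<le> entry_sum A ^ 1"
    using n entry_sum_nonneg[of A] by (intro power_decreasing) auto
  then have "fact n * entry_sum A ^ n \<le> fact n * entry_sum A" by simp
  also have "\<dots> < 1" using less by (simp add: field_simps)
  finally show False using cmod_det_le[OF A] assms(3) by simp
qed

definition mat_trace :: "complex mat \<Rightarrow> complex"
  where "mat_trace A = (\<Sum>i<dim_row A. A $$ (i, i))"

lemma mat_trace_carrier: "A \<in> carrier_mat n n \<Longrightarrow> mat_trace A = (\<Sum>i<n. A $$ (i, i))"
  by (simp add: mat_trace_def)

lemma mat_trace_mult_commute:
  assumes A: "A \<in> carrier_mat n n" and B: "B \<in> carrier_mat n n"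
  shows "mat_trace (A * B) = mat_trace (B * A)"
proof -
  have "mat_trace (A * B) = (\<Sum>i<n. \<Sum>t<n. A $$ (i, t) * B $$ (t, i))"
    using A B mult_mat_entry[OF A B] by (simp add: mat_trace_def)
  also have "\<dots> = (\<Sum>t<n. \<Sum>i<n. B $$ (t, i) * A $$ (i, t))"
    by (subst sum.swap) (simp add: mult.commute)
  also have "\<dots> = mat_trace (B * A)"
    using A B mult_mat_entry[OF B A] by (simp add: mat_trace_def)
  finally show ?thesis .
qed

lemma upper_triangular_pow:
  fixes B :: "complex mat"
  assumes B: "B \<in> carrier_mat n n" and ut: "upper_triangular B"
  shows "i < n \<Longrightarrow> (\<forall>j<i. (B ^\<^sub>m k) $$ (i, j) = 0) \<and> (B ^\<^sub>m k) $$ (i, i) = (B $$ (i, i)) ^ k"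
proof (induction k)
  case 0
  then show ?case using B by auto
next
  case (Suc k)
  have ut: "B $$ (s, t) = 0" if "t < s" "s < n" for s t
    using ut that B by auto
  have entry: "(B ^\<^sub>m Suc k) $$ (i, j) = (\<Sum>t<n. (B ^\<^sub>m k) $$ (i, t) * B $$ (t, j))" if "j < n" for j
    using mult_mat_entry[OF pow_carrier_mat[OF B] B Suc.prems that] by simp
  have "(B ^\<^sub>m Suc k) $$ (i, j) = 0" if "j < i" for j
  proof -
    have "(B ^\<^sub>m k) $$ (i, t) * B $$ (t, j) = 0" if "t < n" for t
      using Suc \<open>j < i\<close> ut[of j t] that by (cases "t < i") auto
    then have "(\<Sum>t<n. (B ^\<^sub>m k) $$ (i, t) * B $$ (t, j)) = 0" by (intro sum.neutral) auto
    then show ?thesis using entry[of j] Suc.prems that by simp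
  qed
  moreover have "(B ^\<^sub>m Suc k) $$ (i, i) = (\<Sum>t<n. if t = i then (B ^\<^sub>m k) $$ (i, i) * B $$ (i, i) else 0)"
    unfolding entry[OF Suc.prems]
  proof (intro sum.cong refl)
    fix t assume "t \<in> {..<n}"
    then show "(B ^\<^sub>m k) $$ (i, t) * B $$ (t, i) = (if t = i then (B ^\<^sub>m k) $$ (i, i) * B $$ (i, i) else 0)"
      using Suc ut[of i t] by (cases "t < i") auto
  qed
  ultimately show ?case using Suc by (simp add: mult.commute)
qed

text \<open>
  Schur triangulation: the powers of a triangular matrix carry the powers of the eigenvalues on the diagonal.
\<close>
lemma mat_trace_pow:
  assumes A: "A \<in> carrier_mat n n" and es: "char_poly A = (\<Prod>e\<leftarrow>es. [:- e, 1:])"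
  shows "mat_trace (A ^\<^sub>m k) = (\<Sum>e\<leftarrow>es. e ^ k)"
proof -
  obtain B P Q where BPQ: "schur_decomposition A es = (B, P, Q)" by (metis prod_cases3)
  from schur_decomposition[OF A es BPQ]
  have wit: "similar_mat_wit A B P Q" and ut: "upper_triangular B" and diag: "diag_mat B = es" by auto
  note D = similar_mat_witD2[OF A wit]
  have pow: "A ^\<^sub>m k = P * B ^\<^sub>m k * Q" by (rule similar_mat_wit_pow_id[OF wit])
  have Bk: "B ^\<^sub>m k \<in> carrier_mat n n" using D by simp
  have "mat_trace (A ^\<^sub>m k) = mat_trace (Q * (P * B ^\<^sub>m k))"
    unfolding pow by (rule mat_trace_mult_commute) (use D Bk in auto)
  also have "Q * (P * B ^\<^sub>m k) = Q * P * B ^\<^sub>m k"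
    by (rule assoc_mult_mat[OF D(7) D(6) Bk, symmetric])
  also have "\<dots> = B ^\<^sub>m k" unfolding D(2) by (rule left_mult_one_mat[OF Bk])
  also have "mat_trace (B ^\<^sub>m k) = (\<Sum>i<n. (B $$ (i, i)) ^ k)"
    unfolding mat_trace_carrier[OF Bk] using upper_triangular_pow[OF D(5) ut] by (intro sum.cong) auto
  also have "\<dots> = (\<Sum>e\<leftarrow>es. e ^ k)"
    unfolding diag[symmetric] diag_mat_def using D(5)
    by (simp add: comp_def interv_sum_list_conv_sum_set_nat lessThan_atLeast0)
  finally show ?thesis .
qed

lemma mat_adjoint_carrier:
  "A \<in> carrier_mat n n \<Longrightarrow> mat_adjoint A \<in> carrier_mat n n"
  unfolding mat_adjoint_def by auto

lemma mat_adjoint_entry: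
  assumes "A \<in> carrier_mat n n" "i < n" "j < n"
  shows "mat_adjoint A $$ (i, j) = cnj (A $$ (j, i))"
  unfolding mat_adjoint_def using assms by (subst mat_of_rows_index) (auto simp: conjugate_complex_def)

lemma adjoint_mult_entry:
  assumes A: "A \<in> carrier_mat n n" and "i < n" "j < n"
  shows "(mat_adjoint A * A) $$ (i, j) = (\<Sum>t<n. cnj (A $$ (t, i)) * A $$ (t, j))"
  using assms by (simp add: mult_mat_entry[OF mat_adjoint_carrier[OF A] A] mat_adjoint_entry[OF A])

text \<open>
  Pairing the eigenvector equation with \<open>v\<close> gives \<open>e \<bar>v\<bar>\<^sup>2 = \<bar>A v\<bar>\<^sup>2\<close>.
\<close>
lemma eigenvalue_adjoint_mult:
  assumes A: "A \<in> carrier_mat n n" and e: "eigenvalue (mat_adjoint A * A) e"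
  shows "e = of_real (Re e)" "Re e \<ge> 0"
proof -
  let ?H = "mat_adjoint A * A"
  have H: "?H \<in> carrier_mat n n" using mat_adjoint_carrier[OF A] A by simp
  obtain v where v: "v \<in> carrier_vec n" "v \<noteq> 0\<^sub>v n" and Hv: "?H *\<^sub>v v = e \<cdot>\<^sub>v v"
    using e H unfolding eigenvalue_def eigenvector_def by auto
  have row: "(\<Sum>j<n. ?H $$ (i, j) * v $ j) = e * v $ i" if "i < n" for i
  proof -
    have "(?H *\<^sub>v v) $ i = (\<Sum>j<n. ?H $$ (i, j) * v $ j)"
      by (rule mult_mat_vec_entry[OF H v(1) that])
    then show ?thesis using Hv v that by simp
  qed
  define S where "S = (\<Sum>i<n. (cmod (v $ i))\<^sup>2)"
  define T where "T = (\<Sum>t<n. (cmod (\<Sum>j<n. A $$ (t, j) * v $ j))\<^sup>2)"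
  have "e * of_real S = (\<Sum>i<n. cnj (v $ i) * (e * v $ i))"
    unfolding S_def of_real_sum complex_norm_square sum_distrib_left by (intro sum.cong refl) (simp add: mult_ac)
  also have "\<dots> = (\<Sum>i<n. cnj (v $ i) * (\<Sum>j<n. (\<Sum>t<n. cnj (A $$ (t, i)) * A $$ (t, j)) * v $ j))"
    using row adjoint_mult_entry[OF A] by (intro sum.cong refl) simp
  also have "\<dots> = (\<Sum>i<n. \<Sum>j<n. \<Sum>t<n. cnj (A $$ (t, i) * v $ i) * (A $$ (t, j) * v $ j))"
    by (simp add: sum_distrib_left sum_distrib_right mult_ac)
  also have "\<dots> = (\<Sum>i<n. \<Sum>t<n. \<Sum>j<n. cnj (A $$ (t, i) * v $ i) * (A $$ (t, j) * v $ j))"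
    by (intro sum.cong refl sum.swap)
  also have "\<dots> = (\<Sum>t<n. \<Sum>i<n. \<Sum>j<n. cnj (A $$ (t, i) * v $ i) * (A $$ (t, j) * v $ j))"
    by (rule sum.swap)
  also have "\<dots> = (\<Sum>t<n. cnj (\<Sum>i<n. A $$ (t, i) * v $ i) * (\<Sum>j<n. A $$ (t, j) * v $ j))"
    by (simp only: sum_product cnj_sum)
  also have "\<dots> = of_real T"
    unfolding T_def of_real_sum complex_norm_square by (intro sum.cong refl mult.commute)
  finally have eST: "e * of_real S = of_real T" .
  have "\<exists>i<n. v $ i \<noteq> 0"
  proof (rule ccontr)
    assume "\<not> ?thesis"
    then have "v = 0\<^sub>v n" using v(1) by (intro eq_vecI) auto
    then show False using v(2) by simp
  qed
  then obtain i where "i < n" "v $ i \<noteq> 0" by blast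
  then have "0 < (cmod (v $ i))\<^sup>2" "(cmod (v $ i))\<^sup>2 \<le> S"
    unfolding S_def by (auto intro!: member_le_sum[of i "{..<n}" "\<lambda>i. (cmod (v $ i))\<^sup>2"])
  then have S: "S > 0" by linarith
  have T: "T \<ge> 0" unfolding T_def by (intro sum_nonneg) auto
  have "e = of_real (T / S)" using eST S by (simp add: field_simps)
  then show "e = of_real (Re e)" "Re e \<ge> 0" using S T by auto
qed

text \<open>
  The list \<open>es\<close> consists of the eigenvalues of \<open>A\<^sup>* A\<close>, the squares of the singular values. Their power sums
  are traces, so they depend continuously on the entries of \<open>A\<close>, although the individual eigenvalues are
  only given as roots of a polynomial.
\<close>
lemma largest_singular_value:
  assumes A: "A \<in> carrier_mat n n" and n: "n > 0"
  obtains es where "length es = n" "\<And>e. e \<in> set es \<Longrightarrow> 0 \<le> e"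
    "singular_values A ! 0 = Max (sqrt ` set es)"
    "\<And>k. mat_trace ((mat_adjoint A * A) ^\<^sub>m k) = of_real (\<Sum>e\<leftarrow>es. e ^ k)"
proof -
  let ?H = "mat_adjoint A * A"
  have H: "?H \<in> carrier_mat n n" using mat_adjoint_carrier[OF A] A by simp
  obtain zs where zs: "char_poly ?H = (\<Prod>z\<leftarrow>zs. [:- z, 1:])" "length zs = n"
    using char_poly_factorized[OF H] by blast
  have roots: "poly (char_poly ?H) z = 0" if "z \<in> set zs" for z
    unfolding zs(1) poly_prod_list using that by (auto simp: prod_list_zero_iff)
  have real: "z = of_real (Re z)" "Re z \<ge> 0" if "z \<in> set zs" for z
  proof -
    have "eigenvalue ?H z" unfolding eigenvalue_root_char_poly[OF H] by (rule roots[OF that])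
    from eigenvalue_adjoint_mult[OF A this] show "z = of_real (Re z)" "Re z \<ge> 0" by blast+
  qed
  define es where "es = map Re zs"
  have zs_es: "zs = map of_real es"
    unfolding es_def map_map comp_def by (rule map_idI[symmetric]) (rule real(1)[symmetric])
  have "proots (char_poly ?H) = mset zs"
  proof -
    have "proots (\<Prod>z\<leftarrow>zs. [:- z, 1:]) = mset zs" for zs :: "complex list"
    proof (induction zs)
      case (Cons z zs)
      have "(\<Prod>z\<leftarrow>zs. [:- z, 1:]) \<noteq> 0" by (auto simp: prod_list_zero_iff)
      then have "proots ([:- z, 1:] * (\<Prod>z\<leftarrow>zs. [:- z, 1:])) = proots [:- z, 1:] + proots (\<Prod>z\<leftarrow>zs. [:- z, 1:])"
        by (intro proots_mult) auto
      then show ?case using Cons by (simp del: mult_pCons_left)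
    qed simp
    then show ?thesis unfolding zs(1) .
  qed
  moreover have "image_mset (\<lambda>z. sqrt (Re z)) (mset zs) = mset (map sqrt es)"
    unfolding zs_es mset_map[symmetric] map_map by (simp only: comp_def Re_complex_of_real)
  ultimately have "singular_values A = rev (sort (map sqrt es))"
    unfolding singular_values_def by (simp only: sorted_list_of_multiset_mset)
  moreover have ne: "sort (map sqrt es) \<noteq> []" 
  proof -
    have "length (sort (map sqrt es)) \<noteq> 0" using zs(2) n by (simp add: es_def)
    then show ?thesis unfolding length_0_conv .
  qed
  ultimately have "singular_values A ! 0 = last (sort (map sqrt es))"
    by (simp add: hd_conv_nth[symmetric] hd_rev)
  also have "\<dots> = Max (set (sort (map sqrt es)))"
  proof (rule Max_eqI[symmetric])
    fix x assume "x \<in> set (sort (map sqrt es))"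
    then obtain i where i: "i < length (sort (map sqrt es))" and x: "sort (map sqrt es) ! i = x"
      unfolding in_set_conv_nth by blast
    show "x \<le> last (sort (map sqrt es))"
      unfolding last_conv_nth[OF ne] x[symmetric] using i by (intro sorted_nth_mono sorted_sort) simp_all
  next
    show "last (sort (map sqrt es)) \<in> set (sort (map sqrt es))" using ne by (rule last_in_set)
  qed simp
  finally have "singular_values A ! 0 = Max (sqrt ` set es)" by simp
  moreover have "mat_trace (?H ^\<^sub>m k) = of_real (\<Sum>e\<leftarrow>es. e ^ k)" for k
  proof -
    have "(\<Sum>z\<leftarrow>map of_real es. z ^ k) = complex_of_real (\<Sum>e\<leftarrow>es. e ^ k)" for es by (induction es) auto
    then show ?thesis unfolding mat_trace_pow[OF H zs(1)] by (subst zs_es)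
  qed
  moreover have "0 \<le> e" if "e \<in> set es" for e using that real(2) unfolding es_def by auto
  moreover have "length es = n" using zs(2) by (simp add: es_def)
  ultimately show ?thesis using that by blast
qed

lemma trace_adjoint_mult_pow_bounds:
  assumes A: "A \<in> carrier_mat n n" and n: "n > 0"
  defines "s \<equiv> singular_values A ! 0"
  shows "0 \<le> s" "(s\<^sup>2) ^ k \<le> Re (mat_trace ((mat_adjoint A * A) ^\<^sub>m k))"
    "Re (mat_trace ((mat_adjoint A * A) ^\<^sub>m k)) \<le> n * (s\<^sup>2) ^ k"
proof -
  obtain es where len: "length es = n" and nonneg: "\<And>e. e \<in> set es \<Longrightarrow> 0 \<le> e"
    and s: "singular_values A ! 0 = Max (sqrt ` set es)"
    and tr: "\<And>k. mat_trace ((mat_adjoint A * A) ^\<^sub>m k) = of_real (\<Sum>e\<leftarrow>es. e ^ k)"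
    by (rule largest_singular_value[OF A n]) blast
  have "set es \<noteq> {}" using len n by auto
  then have "s \<in> sqrt ` set es" unfolding s_def s by (intro Max_in) auto
  then obtain e0 where e0: "e0 \<in> set es" "s = sqrt e0" by blast
  have s2: "s\<^sup>2 = e0" using e0 nonneg by simp
  show "0 \<le> s" using e0 nonneg by simp
  have le: "e \<le> s\<^sup>2" if "e \<in> set es" for e
  proof -
    have "sqrt e \<le> s" unfolding s_def s using that by (intro Max_ge) auto
    then have "(sqrt e)\<^sup>2 \<le> s\<^sup>2" using nonneg[OF that] by (intro power_mono) auto
    then show ?thesis using nonneg[OF that] by simp
  qed
  have "e0 ^ k \<le> (\<Sum>e\<leftarrow>es. e ^ k)"
    using e0(1) nonneg by (intro member_le_sum_list) auto
  then show "(s\<^sup>2) ^ k \<le> Re (mat_trace ((mat_adjoint A * A) ^\<^sub>m k))" unfolding tr s2 by simp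
  have "(\<Sum>e\<leftarrow>es. e ^ k) \<le> (\<Sum>e\<leftarrow>es. (s\<^sup>2) ^ k)"
    using le nonneg by (intro sum_list_mono power_mono) auto
  also have "\<dots> = n * (s\<^sup>2) ^ k" by (simp add: sum_list_triv len)
  finally show "Re (mat_trace ((mat_adjoint A * A) ^\<^sub>m k)) \<le> n * (s\<^sup>2) ^ k" unfolding tr by simp
qed

lemma trace_adjoint_mult:
  assumes A: "A \<in> carrier_mat n n"
  shows "Re (mat_trace (mat_adjoint A * A)) = (\<Sum>i<n. \<Sum>t<n. (cmod (A $$ (t, i)))\<^sup>2)"
proof -
  have H: "mat_adjoint A * A \<in> carrier_mat n n" using mat_adjoint_carrier[OF A] A by simp
  have "mat_trace (mat_adjoint A * A) = (\<Sum>i<n. \<Sum>t<n. cnj (A $$ (t, i)) * A $$ (t, i))"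
    unfolding mat_trace_carrier[OF H] by (intro sum.cong refl adjoint_mult_entry[OF A]) auto
  also have "\<dots> = of_real (\<Sum>i<n. \<Sum>t<n. (cmod (A $$ (t, i)))\<^sup>2)"
    unfolding of_real_sum complex_norm_square by (intro sum.cong refl mult.commute)
  finally show ?thesis by simp
qed

lemma largest_singular_value_entry_sum:
  assumes A: "A \<in> carrier_mat n n" and n: "n > 0"
  shows "singular_values A ! 0 \<le> entry_sum A" "entry_sum A \<le> real n ^ 3 * singular_values A ! 0"
proof -
  define s where "s = singular_values A ! 0"
  have H: "mat_adjoint A * A \<in> carrier_mat n n" using mat_adjoint_carrier[OF A] A by simp
  have H1: "(mat_adjoint A * A) ^\<^sub>m 1 = mat_adjoint A * A"
    by (simp only: One_nat_def pow_mat.simps carrier_matD(1)[OF H] left_mult_one_mat[OF H])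
  have b: "0 \<le> s" "s\<^sup>2 \<le> (\<Sum>i<n. \<Sum>t<n. (cmod (A $$ (t, i)))\<^sup>2)"
    "(\<Sum>i<n. \<Sum>t<n. (cmod (A $$ (t, i)))\<^sup>2) \<le> n * s\<^sup>2"
    unfolding s_def by (fact trace_adjoint_mult_pow_bounds(1)[OF A n]
      trace_adjoint_mult_pow_bounds(2,3)[OF A n, of 1, unfolded H1 trace_adjoint_mult[OF A] power_one_right])+
  have "(\<Sum>i<n. \<Sum>t<n. (cmod (A $$ (t, i)))\<^sup>2) \<le> (\<Sum>i<n. \<Sum>t<n. cmod (A $$ (t, i)) * entry_sum A)"
    unfolding power2_eq_square by (intro sum_mono mult_left_mono entry_le_entry_sum[OF A] norm_ge_zero) simp_all
  also have "\<dots> = (\<Sum>i<n. \<Sum>t<n. cmod (A $$ (t, i))) * entry_sum A" by (simp add: sum_distrib_right)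
  also have "(\<Sum>i<n. \<Sum>t<n. cmod (A $$ (t, i))) = entry_sum A"
    unfolding entry_sum_carrier[OF A] by (rule sum.swap)
  finally have "s\<^sup>2 \<le> (entry_sum A)\<^sup>2" using b(2) unfolding power2_eq_square by linarith
  then have "s \<le> entry_sum A" by (rule power2_le_imp_le[OF _ entry_sum_nonneg])
  then show "singular_values A ! 0 \<le> entry_sum A" by (simp only: s_def)
  have entry: "cmod (A $$ (t, i)) \<le> n * s" if "t < n" "i < n" for t i
  proof -
    have "(cmod (A $$ (t, i)))\<^sup>2 \<le> (\<Sum>t<n. (cmod (A $$ (t, i)))\<^sup>2)"
      using that by (intro member_le_sum[of t _ "\<lambda>t. (cmod (A $$ (t, i)))\<^sup>2"]) auto
    also have "\<dots> \<le> (\<Sum>i<n. \<Sum>t<n. (cmod (A $$ (t, i)))\<^sup>2)"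
      using that by (intro member_le_sum[of i _ "\<lambda>i. \<Sum>t<n. (cmod (A $$ (t, i)))\<^sup>2"] sum_nonneg) auto
    also have "\<dots> \<le> n * s\<^sup>2" by (rule b(3))
    also have "\<dots> \<le> (n * s)\<^sup>2"
    proof -
      have "real n * 1 \<le> real n * real n" using n by (intro mult_left_mono) auto
      then have "real n * s\<^sup>2 \<le> (real n * real n) * s\<^sup>2" by (intro mult_right_mono) auto
      then show ?thesis by (simp only: power_mult_distrib power2_eq_square mult_ac)
    qed
    finally show ?thesis by (rule power2_le_imp_le) (use b(1) in simp)
  qed
  have "entry_sum A \<le> (\<Sum>i<n. \<Sum>j<n. n * s)"
    unfolding entry_sum_carrier[OF A] by (intro sum_mono entry) simp_all
  also have "\<dots> = real n ^ 3 * s" by (simp add: power3_eq_cube)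
  finally show "entry_sum A \<le> real n ^ 3 * singular_values A ! 0" by (simp add: s_def)
qed

text \<open>
  The largest of \<open>n\<close> nonnegative numbers is the limit of the roots of their power sums. This represents the
  largest singular value as a pointwise limit of measurable functions of the entries.
\<close>
lemma trace_root_tendsto_largest_singular_value:
  assumes A: "A \<in> carrier_mat n n" and n: "n > 0"
  shows "(\<lambda>k. Re (mat_trace ((mat_adjoint A * A) ^\<^sub>m Suc k)) powr (1 / (2 * Suc k)))
    \<longlonglongrightarrow> singular_values A ! 0"
proof -
  define s where "s = singular_values A ! 0"
  define t where "t = (\<lambda>k. Re (mat_trace ((mat_adjoint A * A) ^\<^sub>m Suc k)))"
  note b = trace_adjoint_mult_pow_bounds[OF A n, folded s_def]
  have root: "((s\<^sup>2) ^ Suc k) powr (1 / real (2 * Suc k)) = s" for k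
  proof (cases "s = 0")
    case False
    then have "s > 0" using b(1) by simp
    have "(s\<^sup>2) ^ Suc k = s ^ (2 * Suc k)" by (rule power_mult[symmetric])
    also have "\<dots> = s powr real (2 * Suc k)" by (rule powr_realpow[OF \<open>s > 0\<close>, symmetric])
    finally have "((s\<^sup>2) ^ Suc k) powr (1 / real (2 * Suc k)) = s powr (real (2 * Suc k) * (1 / real (2 * Suc k)))"
      by (simp only: powr_powr)
    also have "real (2 * Suc k) * (1 / real (2 * Suc k)) = 1" by simp
    finally show ?thesis using \<open>s > 0\<close> by simp
  qed simp
  have lower: "\<forall>k. s \<le> t k powr (1 / real (2 * Suc k))"
  proof
    fix k
    have "((s\<^sup>2) ^ Suc k) powr (1 / real (2 * Suc k)) \<le> t k powr (1 / real (2 * Suc k))"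
      unfolding t_def by (intro powr_mono2 b zero_le_power) auto
    then show "s \<le> t k powr (1 / real (2 * Suc k))" unfolding root .
  qed
  have upper: "\<forall>k. t k powr (1 / real (2 * Suc k)) \<le> real n powr (1 / real (2 * Suc k)) * s"
  proof
    fix k
    have "0 \<le> t k" unfolding t_def by (rule order_trans[OF _ b(2)]) simp
    then have "t k powr (1 / real (2 * Suc k)) \<le> (n * (s\<^sup>2) ^ Suc k) powr (1 / real (2 * Suc k))"
      unfolding t_def by (intro powr_mono2 b) auto
    also have "\<dots> = n powr (1 / real (2 * Suc k)) * ((s\<^sup>2) ^ Suc k) powr (1 / real (2 * Suc k))"
      by (rule powr_mult)
    finally show "t k powr (1 / real (2 * Suc k)) \<le> real n powr (1 / real (2 * Suc k)) * s"
      unfolding root .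
  qed
  have "(\<lambda>k. (1 / 2) * inverse (real (Suc k))) \<longlonglongrightarrow> (1 / 2) * 0"
    by (intro tendsto_mult tendsto_const LIMSEQ_inverse_real_of_nat)
  moreover have "(\<lambda>k. (1 / 2) * inverse (real (Suc k))) = (\<lambda>k. 1 / real (2 * Suc k))"
    by (simp add: fun_eq_iff field_simps)
  ultimately have "(\<lambda>k. 1 / real (2 * Suc k)) \<longlonglongrightarrow> 0" by (simp only: mult_zero_right)
  then have "(\<lambda>k. real n powr (1 / real (2 * Suc k))) \<longlonglongrightarrow> real n powr 0"
    by (rule tendsto_powr[OF tendsto_const]) (use n in simp)
  then have "(\<lambda>k. real n powr (1 / real (2 * Suc k)) * s) \<longlonglongrightarrow> real n powr 0 * s"
    by (rule tendsto_mult[OF _ tendsto_const])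
  then have "(\<lambda>k. real n powr (1 / real (2 * Suc k)) * s) \<longlonglongrightarrow> s" using n by simp
  then have "(\<lambda>k. t k powr (1 / real (2 * Suc k))) \<longlonglongrightarrow> s"
    by (rule tendsto_sandwich[OF always_eventually[OF lower] always_eventually[OF upper] tendsto_const])
  then show ?thesis by (simp only: t_def s_def)
qed

section \<open>The top Lyapunov exponent as a mean logarithm\<close>

text \<open>
  Fekete's lemma: writing \<open>n = s q + t\<close> bounds \<open>a n / n\<close> by \<open>a q / q\<close> up to an error of order \<open>1 / n\<close>, so the
  sequence converges to its infimum.
\<close>
lemma fekete_limit_exists:
  fixes a :: "nat \<Rightarrow> real"
  assumes sub: "\<And>n k. a (n + k) \<le> a n + a k" and low: "\<And>n. - c \<le> a n"
  shows "convergent (\<lambda>n. a n / real n)"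
proof -
  define S where "S = (\<lambda>n. a n / real n) ` {1..}"
  define L where "L = Inf S"
  have "- \<bar>c\<bar> \<le> a n / real n" if "n \<ge> 1" for n
  proof -
    have "- (\<bar>c\<bar> * real n) \<le> - \<bar>c\<bar> * 1" using that mult_left_mono[of 1 "real n" "\<bar>c\<bar>"] by simp
    also have "\<dots> \<le> a n" using low[of n] by linarith
    finally show ?thesis using that by (simp add: le_divide_eq)
  qed
  then have bdd: "bdd_below S" unfolding S_def by (intro bdd_belowI[of _ "- \<bar>c\<bar>"]) auto
  have L_le: "L \<le> a n / real n" if "n \<ge> 1" for n
    unfolding L_def using bdd that by (intro cInf_lower) (auto simp: S_def)
  have mult: "a (s * q + t) \<le> real s * a q + a t" for s q t
  proof (induction s)
    case (Suc s)
    have "a (Suc s * q + t) \<le> a q + a (s * q + t)" using sub[of q "s * q + t"] by (simp add: add.assoc)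
    then show ?case using Suc by (simp add: algebra_simps)
  qed simp
  have "(\<lambda>n. a n / real n) \<longlonglongrightarrow> L"
  proof (rule LIMSEQ_I)
    fix e :: real assume e: "e > 0"
    have "S \<noteq> {}" by (auto simp: S_def)
    then obtain s where "s \<in> S" "s < L + e / 2"
      using cInf_lessD[of S "L + e / 2"] e unfolding L_def by force
    then obtain q where q: "q \<ge> 1" "a q / real q < L + e / 2" unfolding S_def by auto
    define M where "M = (\<Sum>t<q. \<bar>a t\<bar>)"
    define B where "B = \<bar>a q\<bar> + M"
    obtain N0 :: nat where N0: "2 * B / e < real N0" using reals_Archimedean2 by blast
    show "\<exists>n0. \<forall>n\<ge>n0. norm (a n / real n - L) < e"
    proof (intro exI[of _ "max 1 N0"] allI impI)
      fix n assume n: "n \<ge> max 1 N0"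
      define s where "s = n div q"
      define t where "t = n mod q"
      have nst: "n = s * q + t" unfolding s_def t_def by simp
      have t: "t < q" unfolding t_def using q by simp
      have "\<bar>a t\<bar> \<le> M" unfolding M_def using t by (intro member_le_sum[of t _ "\<lambda>t. \<bar>a t\<bar>"]) auto
      have sq: "real s * real q = real n - real t" using arg_cong[OF nst, of real] by simp
      define u where "u = real t / real q"
      have u: "0 \<le> u" "u \<le> 1" using t by (simp_all add: u_def)
      have "real s * a q = (real s * real q) * (a q / real q)" using q by simp
      also have "\<dots> = real n * (a q / real q) - u * a q"
        unfolding sq u_def by (simp add: left_diff_distrib diff_divide_distrib)
      also have "\<dots> \<le> real n * (a q / real q) + \<bar>a q\<bar>"
      proof -
        have "u * \<bar>a q\<bar> \<le> 1 * \<bar>a q\<bar>" using u by (intro mult_right_mono) auto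
        moreover have "u * (- a q) \<le> u * \<bar>a q\<bar>" using u by (intro mult_left_mono) auto
        ultimately show ?thesis by simp
      qed
      finally have "a n \<le> real n * (a q / real q) + B"
        using mult[of s q t] \<open>\<bar>a t\<bar> \<le> M\<close> unfolding nst[symmetric] B_def by linarith
      have pos: "real n > 0" using n by simp
      have "(a q / real q + B / real n) * real n = real n * (a q / real q) + B"
        using pos by (simp add: distrib_right)
      then have "a n / real n \<le> a q / real q + B / real n"
        unfolding pos_divide_le_eq[OF pos] using \<open>a n \<le> _\<close> by linarith
      moreover have "B / real n < e / 2"
      proof -
        have "2 * B / e < real n" using N0 n by linarith
        then have "2 * B < real n * e" unfolding pos_divide_less_eq[OF e] .
        then show ?thesis unfolding pos_divide_less_eq[OF pos] by (simp add: mult.commute)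
      qed
      moreover have "L \<le> a n / real n" using n by (intro L_le) simp
      ultimately show "norm (a n / real n - L) < e" using q(2) unfolding real_norm_def by linarith
    qed
  qed
  then show ?thesis by (rule convergentI)
qed

text \<open>
  The parameter is the phase, or a pair of an energy and a phase.
\<close>
definition continuous_mat :: "nat \<Rightarrow> ('p::topological_space \<Rightarrow> complex mat) \<Rightarrow> bool"
  where "continuous_mat d M \<longleftrightarrow> (\<forall>p. M p \<in> carrier_mat d d) \<and>
    (\<forall>i<d. \<forall>j<d. continuous_on UNIV (\<lambda>p. M p $$ (i, j)))"

lemma continuous_matD:
  assumes "continuous_mat d M"
  shows "M p \<in> carrier_mat d d" "i < d \<Longrightarrow> j < d \<Longrightarrow> continuous_on UNIV (\<lambda>p. M p $$ (i, j))"
  using assms by (auto simp: continuous_mat_def)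

lemma continuous_mat_mult:
  assumes M: "continuous_mat d M" and N: "continuous_mat d N"
  shows "continuous_mat d (\<lambda>p. M p * N p)"
  unfolding continuous_mat_def
proof (intro conjI allI impI)
  show "M p * N p \<in> carrier_mat d d" for p using continuous_matD(1)[OF M, of p] continuous_matD(1)[OF N, of p] by simp
  fix i j assume ij: "i < d" "j < d"
  have "(\<lambda>p. (M p * N p) $$ (i, j)) = (\<lambda>p. \<Sum>t<d. M p $$ (i, t) * N p $$ (t, j))"
    by (rule ext, rule mult_mat_entry[OF continuous_matD(1)[OF M] continuous_matD(1)[OF N] ij])
  moreover have "continuous_on UNIV (\<lambda>p. \<Sum>t<d. M p $$ (i, t) * N p $$ (t, j))"
    by (intro continuous_on_sum continuous_on_mult continuous_matD(2)[OF M] continuous_matD(2)[OF N] ij) simp_all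
  ultimately show "continuous_on UNIV (\<lambda>p. (M p * N p) $$ (i, j))" by (simp only:)
qed

lemma continuous_mat_adjoint:
  assumes M: "continuous_mat d M"
  shows "continuous_mat d (\<lambda>p. mat_adjoint (M p))"
  unfolding continuous_mat_def
proof (intro conjI allI impI)
  show "mat_adjoint (M p) \<in> carrier_mat d d" for p by (rule mat_adjoint_carrier[OF continuous_matD(1)[OF M]])
  fix i j assume ij: "i < d" "j < d"
  have "(\<lambda>p. mat_adjoint (M p) $$ (i, j)) = (\<lambda>p. cnj (M p $$ (j, i)))"
    by (rule ext, rule mat_adjoint_entry[OF continuous_matD(1)[OF M] ij])
  moreover have "continuous_on UNIV (\<lambda>p. cnj (M p $$ (j, i)))"
    by (intro continuous_on_cnj continuous_matD(2)[OF M] ij)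
  ultimately show "continuous_on UNIV (\<lambda>p. mat_adjoint (M p) $$ (i, j))" by (simp only:)
qed

lemma continuous_mat_one: "continuous_mat d (\<lambda>p. 1\<^sub>m d)"
  by (simp add: continuous_mat_def)

lemma continuous_mat_pow:
  assumes M: "continuous_mat d M"
  shows "continuous_mat d (\<lambda>p. M p ^\<^sub>m k)"
proof (induction k)
  case 0
  have "(\<lambda>p. M p ^\<^sub>m 0) = (\<lambda>p. 1\<^sub>m d)" by (simp add: carrier_matD(1)[OF continuous_matD(1)[OF M]])
  then show ?case using continuous_mat_one by simp
next
  case (Suc k)
  show ?case unfolding pow_mat.simps by (rule continuous_mat_mult[OF Suc M])
qed

lemma continuous_mat_compose:
  assumes M: "continuous_mat d M" and f: "continuous_on UNIV f"
  shows "continuous_mat d (\<lambda>p. M (f p))"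
  unfolding continuous_mat_def
proof (intro conjI allI impI)
  show "M (f p) \<in> carrier_mat d d" for p by (rule continuous_matD(1)[OF M])
  fix i j assume "i < d" "j < d"
  then show "continuous_on UNIV (\<lambda>p. M (f p) $$ (i, j))"
    by (intro continuous_on_compose2[OF continuous_matD(2)[OF M] f]) simp_all
qed

lemma continuous_on_mat_trace:
  assumes M: "continuous_mat d M"
  shows "continuous_on UNIV (\<lambda>p. mat_trace (M p))"
  unfolding mat_trace_carrier[OF continuous_matD(1)[OF M]]
  by (intro continuous_on_sum continuous_matD(2)[OF M]) simp_all

lemma continuous_on_entry_sum:
  assumes M: "continuous_mat d M"
  shows "continuous_on UNIV (\<lambda>p. entry_sum (M p))"
  unfolding entry_sum_carrier[OF continuous_matD(1)[OF M]]
  by (intro continuous_on_sum continuous_on_norm continuous_matD(2)[OF M]) simp_all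

text \<open>
  The definition of the Lyapunov exponent integrates the logarithm of this function, which is meaningful only
  if the function is measurable.
\<close>
lemma borel_measurable_largest_singular_value:
  fixes M :: "real \<Rightarrow> complex mat"
  assumes M: "continuous_mat d M" and d: "d > 0"
  shows "(\<lambda>x. singular_values (M x) ! 0) \<in> borel_measurable borel"
proof (rule borel_measurable_LIMSEQ_real)
  fix x
  show "(\<lambda>k. Re (mat_trace ((mat_adjoint (M x) * M x) ^\<^sub>m Suc k)) powr (1 / (2 * Suc k)))
      \<longlonglongrightarrow> singular_values (M x) ! 0"
    by (rule trace_root_tendsto_largest_singular_value[OF continuous_matD(1)[OF M] d])
next
  fix k
  have "continuous_on UNIV (\<lambda>x. Re (mat_trace ((mat_adjoint (M x) * M x) ^\<^sub>m Suc k)))"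
    by (intro continuous_on_Re continuous_on_mat_trace[where d = d] continuous_mat_pow continuous_mat_mult continuous_mat_adjoint M)
  then have "(\<lambda>x. Re (mat_trace ((mat_adjoint (M x) * M x) ^\<^sub>m Suc k))) \<in> borel_measurable borel"
    by (rule borel_measurable_continuous_onI)
  then show "(\<lambda>x. Re (mat_trace ((mat_adjoint (M x) * M x) ^\<^sub>m Suc k)) powr (1 / (2 * Suc k))) \<in> borel_measurable borel"
    by (intro powr_real_measurable borel_measurable_const)
qed

lemma integral_close_of_measurable:
  fixes f h :: "real \<Rightarrow> real"
  assumes f: "f \<in> borel_measurable borel" and h: "continuous_on UNIV h" and c: "\<And>x. \<bar>f x - h x\<bar> \<le> c"
  shows "\<bar>(LBINT x:{0..1}. f x) - integral {0..1} h\<bar> \<le> c"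
proof -
  have h01: "continuous_on {0..1} h" by (rule continuous_on_subset[OF h]) simp
  have "set_integrable lborel {0..1} (\<lambda>x. \<bar>h x\<bar> + c)"
    by (intro borel_integrable_atLeastAtMost' continuous_intros h01)
  then have fi: "set_integrable lborel {0..1} f"
  proof (rule set_integrable_bound)
    show "set_borel_measurable lborel {0..1} f"
      unfolding set_borel_measurable_def using f by simp
    have "norm (f x) \<le> norm (\<bar>h x\<bar> + c)" for x using c[of x] by simp
    then show "AE x in lborel. x \<in> {0..1} \<longrightarrow> norm (f x) \<le> norm (\<bar>h x\<bar> + c)" by simp
  qed
  note F = set_borel_integral_eq_integral[OF fi]
  have "((\<lambda>x. f x - h x) has_integral (integral {0..1} f - integral {0..1} h)) {0..1}"
    by (intro has_integral_diff integrable_integral F(1) integrable_continuous_real h01)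
  moreover have "0 \<le> c" using c[of 0] by linarith
  ultimately have "norm (integral {0..1} f - integral {0..1} h) \<le> c * measure lborel {0..1::real}"
    using c by (intro has_integral_bound_real[where f = "\<lambda>x. f x - h x" and S = "{}"]) simp_all
  then show ?thesis unfolding F(2) by simp
qed

locale unimodular_cocycle =
  fixes \<alpha> :: real and A :: "real \<Rightarrow> complex mat" and d :: nat
  assumes irr: "\<alpha> \<notin> \<rat>" and d: "d > 0" and cont: "continuous_mat d A"
    and periodic: "\<And>x. A (x + 1) = A x" and det: "\<And>x. cmod (det (A x)) = 1"
begin

abbreviation iterate where "iterate \<equiv> cocycle_iterate \<alpha> A"

lemma iterate_continuous: "continuous_mat d (iterate n)"
proof (induction n)
  case 0
  have "iterate 0 = (\<lambda>x. 1\<^sub>m d)" by (intro ext) (simp add: carrier_matD(1)[OF continuous_matD(1)[OF cont]])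
  then show ?case using continuous_mat_one by simp
next
  case (Suc n)
  have "continuous_mat d (\<lambda>x. A (x + of_nat n * \<alpha>) * iterate n x)"
    by (intro continuous_mat_mult continuous_mat_compose[OF cont] Suc continuous_intros)
  then show ?case unfolding cocycle_iterate.simps .
qed

lemmas iterate_carrier = continuous_matD(1)[OF iterate_continuous]

lemma iterate_periodic: "iterate n (x + 1) = iterate n x"
proof (induction n)
  case (Suc n)
  have "A (x + 1 + of_nat n * \<alpha>) = A (x + of_nat n * \<alpha>)"
    using periodic[of "x + of_nat n * \<alpha>"] by (simp add: add_ac)
  then show ?case using Suc by simp
qed (simp add: periodic)

lemma iterate_det: "cmod (det (iterate n x)) = 1"
proof (induction n)
  case (Suc n)
  have "det (iterate (Suc n) x) = det (A (x + of_nat n * \<alpha>)) * det (iterate n x)"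
    unfolding cocycle_iterate.simps by (rule det_mult[OF continuous_matD(1)[OF cont] iterate_carrier])
  then show ?case using Suc det by (simp add: norm_mult)
qed simp

lemma iterate_add: "iterate (n + k) x = iterate k (x + of_nat n * \<alpha>) * iterate n x"
proof (induction k)
  case 0
  show ?case using left_mult_one_mat[OF iterate_carrier[of n x]]
    by (simp add: carrier_matD(1)[OF continuous_matD(1)[OF cont]])
next
  case (Suc k)
  have "iterate (n + Suc k) x = A (x + of_nat (n + k) * \<alpha>) * (iterate k (x + of_nat n * \<alpha>) * iterate n x)"
    using Suc by simp
  also have "x + of_nat (n + k) * \<alpha> = x + of_nat n * \<alpha> + of_nat k * \<alpha>" by (simp add: algebra_simps)
  also have "A (x + of_nat n * \<alpha> + of_nat k * \<alpha>) * (iterate k (x + of_nat n * \<alpha>) * iterate n x)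
      = iterate (Suc k) (x + of_nat n * \<alpha>) * iterate n x"
    unfolding cocycle_iterate.simps
    by (rule assoc_mult_mat[OF continuous_matD(1)[OF cont] iterate_carrier iterate_carrier, symmetric])
  finally show ?case .
qed

lemma entry_sum_iterate_ge: "entry_sum (iterate n x) \<ge> 1 / fact d"
  by (rule entry_sum_ge_of_unimodular[OF iterate_carrier d iterate_det])

lemma entry_sum_iterate_pos: "entry_sum (iterate n x) > 0"
proof -
  have "0 < 1 / (fact d :: real)" by simp
  then show ?thesis using entry_sum_iterate_ge[of n x] by linarith
qed

lemma continuous_ln_entry_sum: "continuous_on UNIV (\<lambda>x. ln (entry_sum (iterate n x)))"
proof (intro continuous_on_ln continuous_on_entry_sum[OF iterate_continuous] ballI)
  show "entry_sum (iterate n x) \<noteq> 0" for x using entry_sum_iterate_pos[of n x] by simp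
qed

definition mean_log :: "nat \<Rightarrow> real"
  where "mean_log n = integral {0..1} (\<lambda>x. ln (entry_sum (iterate n x)))"

lemma mean_log_ge: "- ln (fact d) \<le> mean_log n"
proof -
  have "integral {0..1} (\<lambda>x::real. - ln (fact d :: real)) \<le> mean_log n"
    unfolding mean_log_def
  proof (rule integral_le)
    show "(\<lambda>x. ln (entry_sum (iterate n x))) integrable_on {0..1}"
      by (intro integrable_continuous_real continuous_on_subset[OF continuous_ln_entry_sum]) simp
    fix x
    have "ln (1 / fact d) \<le> ln (entry_sum (iterate n x))"
      using entry_sum_iterate_ge[of n x] entry_sum_iterate_pos[of n x] by (subst ln_le_cancel_iff) auto
    then show "- ln (fact d) \<le> ln (entry_sum (iterate n x))" by (simp add: ln_div)
  qed (intro integrable_continuous_real continuous_on_const)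
  then show ?thesis by simp
qed

text \<open>
  Submultiplicativity of the entry sum, combined with the invariance of the integral under the rotation.
\<close>
lemma mean_log_subadditive: "mean_log (n + k) \<le> mean_log n + mean_log k"
proof -
  let ?f = "\<lambda>k x. ln (entry_sum (iterate k x))"
  have int: "?f k integrable_on {0..1}" for k
    by (intro integrable_continuous_real continuous_on_subset[OF continuous_ln_entry_sum]) simp
  have "continuous_on UNIV (\<lambda>x. ?f k (x + of_nat n * \<alpha>))"
    by (rule continuous_on_compose2[OF continuous_ln_entry_sum]) (auto intro!: continuous_intros)
  from continuous_on_subset[OF this subset_UNIV]
  have ints: "(\<lambda>x. ?f k (x + of_nat n * \<alpha>)) integrable_on {0..1}"
    by (rule integrable_continuous_real)
  have "mean_log (n + k) \<le> integral {0..1} (\<lambda>x. ?f n x + ?f k (x + of_nat n * \<alpha>))"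
    unfolding mean_log_def
  proof (rule integral_le[OF int integrable_add[OF int ints]])
    fix x
    have "entry_sum (iterate (n + k) x) \<le> entry_sum (iterate k (x + of_nat n * \<alpha>)) * entry_sum (iterate n x)"
      unfolding iterate_add by (rule entry_sum_mult[OF iterate_carrier iterate_carrier])
    then have "?f (n + k) x \<le> ln (entry_sum (iterate k (x + of_nat n * \<alpha>)) * entry_sum (iterate n x))"
      using entry_sum_iterate_pos by (subst ln_le_cancel_iff) simp_all
    also have "\<dots> = ?f k (x + of_nat n * \<alpha>) + ?f n x"
      by (rule ln_mult_pos[OF entry_sum_iterate_pos entry_sum_iterate_pos])
    finally show "?f (n + k) x \<le> ?f n x + ?f k (x + of_nat n * \<alpha>)" by simp
  qed
  also have "\<dots> = integral {0..1} (?f n) + integral {0..1} (\<lambda>x. ?f k (x + of_nat n * \<alpha>))"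
    by (rule integral_add[OF int ints])
  also have "integral {0..1} (\<lambda>x. ?f k (x + of_nat n * \<alpha>)) = integral {0..1} (?f k)"
    by (rule integral_periodic_shift[OF irr continuous_ln_entry_sum]) (simp add: iterate_periodic)
  finally show ?thesis by (simp add: mean_log_def)
qed

text \<open>
  The limit in the definition of the exponent exists by Fekete's lemma for \<open>mean_log\<close>; passing from entry
  sums to largest singular values changes each integral by at most a constant, which dividing by \<open>n\<close> removes.
\<close>
theorem mean_log_tendsto_lyapunov_exponent:
  "(\<lambda>n. mean_log n / real n) \<longlonglongrightarrow> lyapunov_exponent \<alpha> A 1"
proof -
  obtain L where L: "(\<lambda>n. mean_log n / real n) \<longlonglongrightarrow> L"
    using fekete_limit_exists[of mean_log, OF mean_log_subadditive mean_log_ge] unfolding convergent_def by blast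
  define c where "c = ln (real d ^ 3)"
  define b where "b = (\<lambda>n. LBINT x:{0..1}. ln (singular_values (iterate n x) ! 0))"
  have close: "\<bar>b n - mean_log n\<bar> \<le> c" for n
    unfolding b_def mean_log_def
  proof (rule integral_close_of_measurable)
    show "(\<lambda>x. ln (singular_values (iterate n x) ! 0)) \<in> borel_measurable borel"
      by (intro borel_measurable_ln borel_measurable_largest_singular_value[OF iterate_continuous d])
    show "continuous_on UNIV (\<lambda>x. ln (entry_sum (iterate n x)))" by (rule continuous_ln_entry_sum)
    fix x
    let ?s = "singular_values (iterate n x) ! 0" and ?e = "entry_sum (iterate n x)"
    note bounds = largest_singular_value_entry_sum[OF iterate_carrier[of n x] d]
    have e: "?e > 0" by (rule entry_sum_iterate_pos)
    have "0 < real d ^ 3 * ?s" using e bounds(2) by linarith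
    then have s: "?s > 0" using d by (simp add: zero_less_mult_iff)
    have "ln ?s \<le> ln ?e" using bounds(1) s e by simp
    moreover have "ln ?e \<le> ln (real d ^ 3 * ?s)" using bounds(2) e \<open>0 < real d ^ 3 * ?s\<close> by simp
    moreover have "ln (real d ^ 3 * ?s) = c + ln ?s"
      unfolding c_def by (rule ln_mult_pos) (use s d in simp_all)
    ultimately show "\<bar>ln ?s - ln ?e\<bar> \<le> c" by linarith
  qed
  have "(\<lambda>n. b n / real n - mean_log n / real n) \<longlonglongrightarrow> 0"
  proof (rule Lim_null_comparison)
    show "\<forall>\<^sub>F n in sequentially. norm (b n / real n - mean_log n / real n) \<le> c * inverse (real n)"
    proof (rule always_eventually, rule allI)
      fix n
      have "norm (b n / real n - mean_log n / real n) = \<bar>b n - mean_log n\<bar> * inverse (real n)"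
        by (simp add: divide_inverse abs_mult flip: left_diff_distrib)
      also have "\<dots> \<le> c * inverse (real n)" by (intro mult_right_mono close) simp
      finally show "norm (b n / real n - mean_log n / real n) \<le> c * inverse (real n)" .
    qed
    show "(\<lambda>n. c * inverse (real n)) \<longlonglongrightarrow> 0"
      by (rule tendsto_mult_right_zero[OF lim_inverse_n])
  qed
  then have "(\<lambda>n. (b n / real n - mean_log n / real n) + mean_log n / real n) \<longlonglongrightarrow> 0 + L"
    by (rule tendsto_add[OF _ L])
  then have "(\<lambda>n. b n / real n) \<longlonglongrightarrow> L" by simp
  then have "lim (\<lambda>n. b n / real n) = L" by (rule limI)
  then have "lyapunov_exponent \<alpha> A 1 = L" by (simp add: lyapunov_exponent_def b_def)
  then show ?thesis using L by simp
qed

lemma lyapunov_exponent_nonneg: "lyapunov_exponent \<alpha> A 1 \<ge> 0"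
proof (rule LIMSEQ_le[OF _ mean_log_tendsto_lyapunov_exponent])
  show "(\<lambda>n. - ln (fact d) * inverse (real n)) \<longlonglongrightarrow> 0"
    by (rule tendsto_mult_right_zero[OF lim_inverse_n])
  have "- ln (fact d) * inverse (real n) \<le> mean_log n / real n" for n
    unfolding divide_inverse by (intro mult_right_mono mean_log_ge) simp
  then show "\<exists>N. \<forall>n\<ge>N. - ln (fact d) * inverse (real n) \<le> mean_log n / real n" by blast
qed

lemma ex_mean_log_less:
  assumes "lyapunov_exponent \<alpha> A 1 < \<kappa>"
  obtains N where "N \<ge> 1" "mean_log N < real N * \<kappa>"
proof -
  have "\<forall>\<^sub>F n in sequentially. mean_log n / real n < \<kappa>"
    using mean_log_tendsto_lyapunov_exponent assms by (rule order_tendstoD)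
  then obtain n0 where n0: "\<And>n. n \<ge> n0 \<Longrightarrow> mean_log n / real n < \<kappa>"
    unfolding eventually_sequentially by blast
  have "mean_log (Suc n0) / real (Suc n0) < \<kappa>" by (rule n0) simp
  then have "mean_log (Suc n0) < real (Suc n0) * \<kappa>" by (simp add: divide_less_eq mult.commute)
  then show ?thesis by (intro that[of "Suc n0"]) simp_all
qed

end

section \<open>Uniform growth of the dual cocycle near energy zero\<close>

lemma continuous_mat_dual_transfer:
  assumes "continuous_on UNIV f" "continuous_on UNIV h"
  shows "continuous_mat (2 * m) (\<lambda>p. dual_transfer m vh (f p) (h p))"
  unfolding continuous_mat_def
proof (intro conjI allI impI)
  show "dual_transfer m vh (f p) (h p) \<in> carrier_mat (2 * m) (2 * m)" for p by (simp add: dual_transfer_def)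
  have cos: "continuous_on UNIV (\<lambda>p. cos (2 * pi * h p))"
    by (rule continuous_on_compose2[where g = cos and t = UNIV, OF continuous_on_cos[OF continuous_on_id]])
      (auto intro!: continuous_intros assms)
  fix i j assume ij: "i < 2 * m" "j < 2 * m"
  let ?k = "int m - 1 - int j"
  show "continuous_on UNIV (\<lambda>p. dual_transfer m vh (f p) (h p) $$ (i, j))"
  proof (cases "i = 0")
    case True
    then have "(\<lambda>p. dual_transfer m vh (f p) (h p) $$ (i, j))
        = (\<lambda>p. ((if ?k = 0 then of_real (2 * cos (2 * pi * h p)) - f p else 0) - vh ?k) / vh (int m))"
      using ij by (simp add: dual_transfer_def Let_def)
    moreover have "continuous_on UNIV (\<lambda>p. ((if ?k = 0 then of_real (2 * cos (2 * pi * h p)) - f p else 0) - vh ?k) / vh (int m))"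
      unfolding divide_inverse by (cases "?k = 0") (auto intro!: continuous_intros assms cos)
    ultimately show ?thesis by (simp only:)
  next
    case False
    then show ?thesis using ij by (simp add: dual_transfer_def)
  qed
qed

lemma continuous_mat_dual_iterate:
  "continuous_mat (2 * m) (\<lambda>p. cocycle_iterate \<alpha> (dual_transfer m vh (fst p)) n (snd p))"
proof (induction n)
  case 0
  have "(\<lambda>p. cocycle_iterate \<alpha> (dual_transfer m vh (fst p)) 0 (snd p)) = (\<lambda>p. 1\<^sub>m (2 * m))"
    by (simp add: dual_transfer_def)
  then show ?case by (simp only: continuous_mat_one)
next
  case (Suc n)
  show ?case unfolding cocycle_iterate.simps
    by (intro continuous_mat_mult continuous_mat_dual_transfer Suc continuous_intros)
qed

text \<open>
  The last column has a single nonzero entry, \<open>- vh (- m) / vh m\<close>, in the first row, and deleting both leaves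
  the identity matrix.
\<close>
lemma cmod_det_dual_transfer:
  assumes m: "m > 0" and vh: "vh (int m) \<noteq> 0" "cmod (vh (- int m)) = cmod (vh (int m))"
  shows "cmod (det (dual_transfer m vh e x)) = 1"
proof -
  let ?T = "dual_transfer m vh e x"
  have T: "?T \<in> carrier_mat (2 * m) (2 * m)" by (simp add: dual_transfer_def)
  let ?j = "2 * m - 1"
  have j: "?j < 2 * m" using m by simp
  have "int m - 1 - int ?j = - int m" using m by (simp add: of_nat_diff)
  then have corner: "?T $$ (0, ?j) = - vh (- int m) / vh (int m)"
    using m by (simp add: dual_transfer_def Let_def)
  have zero: "?T $$ (i, ?j) = 0" if "0 < i" "i < 2 * m" for i
    using that m by (simp add: dual_transfer_def)
  have "mat_delete ?T 0 ?j = 1\<^sub>m (2 * m - 1)"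
  proof (rule eq_matI)
    show "dim_row (mat_delete ?T 0 ?j) = dim_row (1\<^sub>m (2 * m - 1))"
      "dim_col (mat_delete ?T 0 ?j) = dim_col (1\<^sub>m (2 * m - 1))"
      by (simp_all add: dual_transfer_def)
    fix i l assume "i < dim_row (1\<^sub>m (2 * m - 1))" "l < dim_col (1\<^sub>m (2 * m - 1))"
    then show "mat_delete ?T 0 ?j $$ (i, l) = 1\<^sub>m (2 * m - 1) $$ (i, l)"
      by (simp add: mat_delete_def dual_transfer_def)
  qed
  then have cof: "cofactor ?T 0 ?j = (- 1) ^ ?j" by (simp add: cofactor_def)
  have "det ?T = (\<Sum>i<2 * m. ?T $$ (i, ?j) * cofactor ?T i ?j)"
    by (rule laplace_expansion_column[OF T j])
  also have "\<dots> = (\<Sum>i<2 * m. if i = 0 then ?T $$ (0, ?j) * cofactor ?T 0 ?j else 0)"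
  proof (intro sum.cong refl)
    fix i assume "i \<in> {..<2 * m}"
    then show "?T $$ (i, ?j) * cofactor ?T i ?j = (if i = 0 then ?T $$ (0, ?j) * cofactor ?T 0 ?j else 0)"
      using zero[of i] by (cases "i = 0") auto
  qed
  also have "\<dots> = ?T $$ (0, ?j) * cofactor ?T 0 ?j" using m by simp
  finally show ?thesis unfolding corner cof using vh by (simp add: norm_mult norm_divide norm_power)
qed

lemma dual_transfer_periodic: "dual_transfer m vh e (x + 1) = dual_transfer m vh e x"
proof -
  have "cos (2 * pi * (x + 1)) = cos (2 * pi * x)" by (simp add: distrib_left cos_add)
  then show ?thesis by (simp only: dual_transfer_def)
qed

lemma unimodular_dual_cocycle:
  assumes "\<alpha> \<notin> \<rat>" "m > 0" "vh (int m) \<noteq> 0" "cmod (vh (- int m)) = cmod (vh (int m))"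
  shows "unimodular_cocycle \<alpha> (dual_transfer m vh e) (2 * m)"
proof
  show "continuous_mat (2 * m) (dual_transfer m vh e)"
    using continuous_mat_dual_transfer[of "\<lambda>x. e" "\<lambda>x. x" m vh] by simp
qed (use assms in \<open>simp_all add: dual_transfer_periodic cmod_det_dual_transfer\<close>)

lemma dual_iterate_frac:
  assumes "unimodular_cocycle \<alpha> (dual_transfer m vh e) (2 * m)"
  shows "cocycle_iterate \<alpha> (dual_transfer m vh e) n x = cocycle_iterate \<alpha> (dual_transfer m vh e) n (frac x)"
proof -
  interpret unimodular_cocycle \<alpha> "dual_transfer m vh e" "2 * m" by fact
  have "iterate n (frac x + of_int \<lfloor>x\<rfloor>) = iterate n (frac x)"
    by (rule periodic_of_int[where f = "iterate n", OF iterate_periodic])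
  then show ?thesis by (simp add: frac_def)
qed

text \<open>
  At energy \<open>0\<close> there is a block length \<open>N\<close> for which the mean of \<open>ln (entry_sum \<dots>)\<close> is below \<open>N \<kappa>\<close>. A
  slightly larger continuous function \<open>f\<close> of the phase still has this property and dominates the blocks for
  all energies near \<open>0\<close>. Long products split into such blocks, whose phases form an orbit of the rotation
  by \<open>N \<alpha>\<close>; by equidistribution the sum of \<open>f\<close> along this orbit is eventually below \<open>N \<kappa>\<close> per block,
  uniformly in the phase. Short products and incomplete blocks only cost a constant.
\<close>
theorem dual_cocycle_growth:
  assumes irr: "\<alpha> \<notin> \<rat>" and m: "m > 0"
    and vh: "vh (int m) \<noteq> 0" "cmod (vh (- int m)) = cmod (vh (int m))"
    and \<kappa>: "lyapunov_exponent \<alpha> (dual_transfer m vh 0) 1 < \<kappa>"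
  shows "\<exists>\<delta>>0. \<exists>K. \<forall>e n x. cmod e < \<delta> \<longrightarrow>
    cmod (cocycle_iterate \<alpha> (dual_transfer m vh e) n x $$ (0, 0)) \<le> K * exp \<kappa> ^ n"
proof -
  define d where "d = 2 * m"
  define I where "I = (\<lambda>e. cocycle_iterate \<alpha> (dual_transfer m vh e))"
  have uc: "unimodular_cocycle \<alpha> (dual_transfer m vh e) d" for e
    unfolding d_def by (rule unimodular_dual_cocycle[OF irr m vh])
  interpret C: unimodular_cocycle \<alpha> "dual_transfer m vh 0" d by (rule uc)
  have carrier: "I e n x \<in> carrier_mat d d" for e n x
    unfolding I_def by (rule unimodular_cocycle.iterate_carrier[OF uc])
  have split: "I e (n + k) x = I e k (x + of_nat n * \<alpha>) * I e n x" for e n k x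
    unfolding I_def by (rule unimodular_cocycle.iterate_add[OF uc])
  have frac: "I e n x = I e n (frac x)" for e n x
    unfolding I_def by (rule dual_iterate_frac) (use uc in \<open>simp add: d_def\<close>)
  have zero: "I e 0 x = 1\<^sub>m d" for e x by (simp add: I_def d_def dual_transfer_def)
  have joint: "continuous_on UNIV (\<lambda>p. entry_sum (I (fst p) n (snd p)))" for n
    unfolding I_def by (rule continuous_on_entry_sum[OF continuous_mat_dual_iterate])
  have \<kappa>0: "\<kappa> \<ge> 0" using C.lyapunov_exponent_nonneg \<kappa> by linarith
  obtain N where N: "N \<ge> 1" "C.mean_log N < real N * \<kappa>" using C.ex_mean_log_less[OF \<kappa>] by blast
  define s where "s = real N * \<kappa> - C.mean_log N"
  have s: "s > 0" using N by (simp add: s_def)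
  \<comment> \<open>Since \<open>S \<ge> 1 / fact d\<close>, adding \<open>\<eta>\<close> to \<open>S\<close> raises its logarithm by at most half of the gap \<open>s\<close>.\<close>
  define \<eta> where "\<eta> = s / (2 * fact d)"
  have \<eta>: "\<eta> > 0" using s by (simp add: \<eta>_def)
  define S where "S = (\<lambda>x. entry_sum (I 0 N x))"
  have S: "S x \<ge> 1 / fact d" "S x > 0" for x
    unfolding S_def I_def by (rule C.entry_sum_iterate_ge C.entry_sum_iterate_pos)+
  define f where "f = (\<lambda>x. ln (S x + \<eta>))"
  have S\<eta>: "S x + \<eta> > 0" for x using S(2)[of x] \<eta> by linarith
  have exp_f: "exp (f x) = S x + \<eta>" for x unfolding f_def by (rule exp_ln[OF S\<eta>])
  have S_cont: "continuous_on UNIV S"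
    unfolding S_def I_def by (rule continuous_on_entry_sum[OF C.iterate_continuous])
  have f_cont: "continuous_on UNIV f"
    unfolding f_def
  proof (intro continuous_on_ln continuous_on_add S_cont continuous_on_const ballI)
    show "S x + \<eta> \<noteq> 0" for x using S\<eta>[of x] by simp
  qed
  have f_per: "f (x + 1) = f x" for x
    unfolding f_def S_def I_def by (simp only: C.iterate_periodic)
  have f_le: "f x \<le> ln (S x) + s / 2" for x
  proof -
    have "f x = ln (S x * (1 + \<eta> / S x))" unfolding f_def using S(2)[of x] by (simp add: distrib_left)
    also have "\<dots> = ln (S x) + ln (1 + \<eta> / S x)"
      by (rule ln_mult_pos[OF S(2)]) (use S(2)[of x] \<eta> in \<open>simp add: add_pos_pos\<close>)
    also have "ln (1 + \<eta> / S x) \<le> \<eta> / S x"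
      by (rule ln_add_one_self_le_self) (use S(2)[of x] \<eta> in simp)
    also have "\<eta> / S x \<le> \<eta> / (1 / fact d)"
      using S[of x] \<eta> by (intro divide_left_mono) auto
    also have "\<dots> = s / 2" by (simp add: \<eta>_def)
    finally show ?thesis by simp
  qed
  have f_int: "integral {0..1} f < real N * \<kappa>"
  proof -
    have lnS: "(\<lambda>x. ln (S x)) integrable_on {0..1}"
      unfolding S_def I_def
      by (rule integrable_continuous_real[OF continuous_on_subset[OF C.continuous_ln_entry_sum subset_UNIV]])
    have const: "(\<lambda>x::real. s / 2) integrable_on {0..1}" by (intro integrable_continuous_real continuous_on_const)
    have "integral {0..1} f \<le> integral {0..1} (\<lambda>x. ln (S x) + s / 2)"
    proof (rule integral_le)
      show "f integrable_on {0..1}"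
        by (rule integrable_continuous_real[OF continuous_on_subset[OF f_cont subset_UNIV]])
      show "(\<lambda>x. ln (S x) + s / 2) integrable_on {0..1}" by (rule integrable_add[OF lnS const])
    qed (rule f_le)
    also have "\<dots> = integral {0..1} (\<lambda>x. ln (S x)) + integral {0..1} (\<lambda>x::real. s / 2)"
      by (rule integral_add[OF lnS const])
    also have "integral {0..1} (\<lambda>x. ln (S x)) = C.mean_log N"
      by (simp add: C.mean_log_def S_def I_def)
    also have "integral {0..1} (\<lambda>x::real. s / 2) = s / 2" by simp
    finally show ?thesis using s s_def by linarith
  qed
  \<comment> \<open>Periodicity reduces all phases to a compact set, on which continuity in the energy is uniform.\<close>
  define Q where "Q = cball (0::complex) 1 \<times> {0..1::real}"
  have Q: "compact Q" unfolding Q_def by (intro compact_Times) auto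
  have "uniformly_continuous_on Q (\<lambda>p. entry_sum (I (fst p) N (snd p)))"
    by (intro compact_uniformly_continuous Q continuous_on_subset[OF joint subset_UNIV])
  then obtain \<delta>0 where \<delta>0: "\<delta>0 > 0" and unif: "\<And>p q. p \<in> Q \<Longrightarrow> q \<in> Q \<Longrightarrow> dist q p < \<delta>0 \<Longrightarrow>
      dist (entry_sum (I (fst q) N (snd q))) (entry_sum (I (fst p) N (snd p))) < \<eta>"
    using \<eta> unfolding uniformly_continuous_on_def by metis
  define \<delta> where "\<delta> = min \<delta>0 1"
  have near: "entry_sum (I e N x) \<le> exp (f x)" if e: "cmod e < \<delta>" for e x
  proof -
    have fr: "frac x \<in> {0..1}" using frac_ge_0[of x] frac_lt_1[of x] by simp
    have "dist (entry_sum (I e N (frac x))) (entry_sum (I 0 N (frac x))) < \<eta>"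
      using unif[of "(0, frac x)" "(e, frac x)"] e fr by (simp add: Q_def \<delta>_def dist_Pair_Pair)
    then have "entry_sum (I e N (frac x)) \<le> entry_sum (I 0 N (frac x)) + \<eta>" by (simp add: dist_real_def)
    then show ?thesis unfolding exp_f S_def frac[symmetric] .
  qed
  have "bounded ((\<lambda>p. entry_sum (I (fst p) 1 (snd p))) ` Q)"
    by (intro compact_imp_bounded compact_continuous_image Q continuous_on_subset[OF joint subset_UNIV])
  then obtain B0 where B0: "\<And>p. p \<in> Q \<Longrightarrow> norm (entry_sum (I (fst p) 1 (snd p))) \<le> B0"
    unfolding bounded_iff by blast
  define B where "B = max B0 1"
  have B: "B \<ge> 1" by (simp add: B_def)
  have one_step: "entry_sum (I e 1 x) \<le> B" if "cmod e < \<delta>" for e x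
  proof -
    have "(e, frac x) \<in> Q" using that frac_ge_0[of x] frac_lt_1[of x] by (simp add: Q_def \<delta>_def)
    from B0[OF this] have "entry_sum (I e 1 (frac x)) \<le> B" by (simp add: B_def)
    then show ?thesis unfolding frac[symmetric] .
  qed
  have crude: "entry_sum (I e n x) \<le> real d * B ^ n" if e: "cmod e < \<delta>" for e n x
  proof (induction n)
    case 0
    show ?case by (simp add: zero entry_sum_one)
  next
    case (Suc n)
    have "entry_sum (I e (n + 1) x) \<le> entry_sum (I e 1 (x + of_nat n * \<alpha>)) * entry_sum (I e n x)"
      unfolding split by (rule entry_sum_mult[OF carrier carrier])
    also have "\<dots> \<le> B * (real d * B ^ n)"
      by (intro mult_mono one_step e Suc entry_sum_nonneg) (use B in simp)
    finally show ?case by (simp add: mult_ac)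
  qed
  have blocks: "entry_sum (I e (M * N) x) \<le> real d * exp (\<Sum>n<M. f (x + of_nat n * (of_nat N * \<alpha>)))"
    if e: "cmod e < \<delta>" for e M x
  proof (induction M)
    case 0
    show ?case by (simp add: zero entry_sum_one)
  next
    case (Suc M)
    have "entry_sum (I e (M * N + N) x) \<le> entry_sum (I e N (x + of_nat (M * N) * \<alpha>)) * entry_sum (I e (M * N) x)"
      unfolding split by (rule entry_sum_mult[OF carrier carrier])
    also have "\<dots> \<le> exp (f (x + of_nat (M * N) * \<alpha>)) * (real d * exp (\<Sum>n<M. f (x + of_nat n * (of_nat N * \<alpha>))))"
      by (intro mult_mono near e Suc entry_sum_nonneg) simp
    also have "of_nat (M * N) * \<alpha> = of_nat M * (of_nat N * \<alpha>)" by simp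
    finally show ?case by (simp add: exp_add mult_ac add_ac)
  qed
  have "of_nat N * \<alpha> \<notin> \<rat>"
  proof
    assume "of_nat N * \<alpha> \<in> \<rat>"
    then have "of_nat N * \<alpha> / of_nat N \<in> \<rat>" by (intro Rats_divide) auto
    then show False using irr N(1) by simp
  qed
  then have weyl: "uniform_orbit_mean (of_nat N * \<alpha>) f (integral {0..1} f)"
    by (rule weyl_equidistribution[OF _ f_cont f_per])
  define t where "t = real N * \<kappa> - integral {0..1} f"
  have "t > 0" using f_int by (simp add: t_def)
  then obtain M0 where M0: "\<And>M x. M \<ge> M0 \<Longrightarrow>
      dist (orbit_average (of_nat N * \<alpha>) f M x) (integral {0..1} f) < t"
    using uniform_limitD[OF weyl[unfolded uniform_orbit_mean_def]] unfolding eventually_sequentially by blast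
  have birkhoff: "(\<Sum>n<M. f (x + of_nat n * (of_nat N * \<alpha>))) \<le> \<kappa> * real (M * N)" if "M \<ge> M0" for M x
  proof (cases "M = 0")
    case False
    have "orbit_average (of_nat N * \<alpha>) f M x < real N * \<kappa>"
      using M0[OF that, of x] unfolding dist_real_def t_def by linarith
    then have "real M * orbit_average (of_nat N * \<alpha>) f M x \<le> real M * (real N * \<kappa>)"
      by (intro mult_left_mono) auto
    moreover have "real M * orbit_average (of_nat N * \<alpha>) f M x = (\<Sum>n<M. f (x + of_nat n * (of_nat N * \<alpha>)))"
      using False by (simp add: orbit_average_def)
    ultimately show ?thesis by (simp add: mult_ac)
  qed simp
  define K where "K = real d * real d * B ^ (N + M0 * N)"
  have d1: "real d \<ge> 1" using m by (simp add: d_def)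
  have bound: "entry_sum (I e n x) \<le> K * exp \<kappa> ^ n" if e: "cmod e < \<delta>" for e n x
  proof (cases "n div N \<ge> M0")
    case True
    define M where "M = n div N"
    define u where "u = n mod N"
    have n: "n = M * N + u" by (simp add: M_def u_def)
    have u: "u \<le> N" unfolding u_def using N(1) by (simp add: less_imp_le)
    have "entry_sum (I e (M * N + u) x) \<le> entry_sum (I e u (x + of_nat (M * N) * \<alpha>)) * entry_sum (I e (M * N) x)"
      unfolding split by (rule entry_sum_mult[OF carrier carrier])
    also have "\<dots> \<le> (real d * B ^ u) * (real d * exp (\<kappa> * real (M * N)))"
    proof (intro mult_mono crude e entry_sum_nonneg)
      have "exp (\<Sum>n<M. f (x + of_nat n * (of_nat N * \<alpha>))) \<le> exp (\<kappa> * real (M * N))"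
        using birkhoff[of M x] True by (simp add: M_def)
      then show "entry_sum (I e (M * N) x) \<le> real d * exp (\<kappa> * real (M * N))"
        using blocks[OF e, of M x] mult_left_mono[of _ _ "real d"] by (meson of_nat_0_le_iff order_trans)
    qed (use B in simp)
    also have "\<dots> \<le> (real d * B ^ (N + M0 * N)) * (real d * exp (\<kappa> * real n))"
    proof (intro mult_mono order_refl)
      show "B ^ u \<le> B ^ (N + M0 * N)" using u B by (intro power_increasing) auto
      show "exp (\<kappa> * real (M * N)) \<le> exp (\<kappa> * real n)" using \<kappa>0 by (simp add: n mult_left_mono)
    qed (use B in simp_all)
    also have "exp (\<kappa> * real n) = exp \<kappa> ^ n" by (simp add: exp_of_nat_mult[symmetric] mult.commute)
    finally show ?thesis unfolding n[symmetric] K_def by (simp add: mult_ac)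
  next
    case False
    have "n \<le> N + M0 * N"
    proof -
      have "n < M0 * N" using False N(1) by (simp add: less_mult_imp_div_less div_less_iff_less_mult not_le)
      then show ?thesis by simp
    qed
    have "entry_sum (I e n x) \<le> real d * B ^ n" by (rule crude[OF e])
    also have "\<dots> \<le> real d * B ^ (N + M0 * N)"
      using \<open>n \<le> N + M0 * N\<close> B by (intro mult_left_mono power_increasing) auto
    also have "\<dots> = 1 * (real d * B ^ (N + M0 * N)) * 1" by simp
    also have "\<dots> \<le> real d * (real d * B ^ (N + M0 * N)) * exp \<kappa> ^ n"
      using d1 B \<kappa>0 by (intro mult_mono one_le_power) auto
    finally show ?thesis by (simp add: K_def mult_ac)
  qed
  have "cmod (I e n x $$ (0, 0)) \<le> K * exp \<kappa> ^ n" if "cmod e < \<delta>" for e n x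
    using entry_le_entry_sum[OF carrier[of e n x], of 0 0] bound[OF that, of n x] m by (simp add: d_def)
  moreover have "\<delta> > 0" using \<delta>0 by (simp add: \<delta>_def)
  ultimately show ?thesis unfolding I_def by blast
qed

section \<open>A disc in the spectrum\<close>

lemma trig_poly_of_real: "trig_poly m vh (of_real t) = (\<Sum>k\<in>{- int m..int m}. vh k * character k t)"
  unfolding trig_poly_def
proof (intro sum.cong refl)
  fix k :: int
  have "2 * of_real pi * \<i> * of_int k * of_real t = \<i> * of_real (2 * pi * of_int k * t)" by simp
  then show "vh k * exp (2 * of_real pi * \<i> * of_int k * of_real t) = vh k * character k t"
    by (simp only: character_def cis_conv_exp)
qed

text \<open>
  The function minus its conjugate vanishes, so by \<open>orbit_bound_imp_coeff_bound\<close> its coefficients vanish.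
\<close>
lemma coeff_conj_of_real_valued:
  fixes \<alpha> :: real
  assumes irr: "\<alpha> \<notin> \<rat>" and real: "\<And>t :: real. trig_poly m vh (of_real t) \<in> \<real>" and k: "\<bar>k\<bar> \<le> int m"
  shows "cnj (vh k) = vh (- k)"
proof -
  let ?A = "{- int m..int m}"
  have "cmod (vh (- k) - cnj (vh (- (- k)))) \<le> 0"
  proof (rule orbit_bound_imp_coeff_bound[where a = "\<lambda>k. vh k - cnj (vh (- k))" and q = "- k" and A = ?A and x = 0, OF irr])
    fix n :: nat
    let ?t = "0 + real n * \<alpha>"
    have "(\<Sum>k\<in>?A. cnj (vh (- k)) * character k ?t) = (\<Sum>k\<in>?A. cnj (vh k * character k ?t))"
      by (rule sum.reindex_bij_witness[of _ uminus uminus]) (auto simp: cnj_character)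
    also have "\<dots> = cnj (trig_poly m vh (of_real ?t))" unfolding trig_poly_of_real cnj_sum ..
    also have "\<dots> = trig_poly m vh (of_real ?t)" using real[of ?t] by (simp add: Reals_cnj_iff)
    finally have "(\<Sum>k\<in>?A. (vh k - cnj (vh (- k))) * character k ?t) = 0"
      unfolding left_diff_distrib sum_subtractf trig_poly_of_real by (simp only: diff_self)
    then show "cmod (\<Sum>k\<in>?A. (vh k - cnj (vh (- k))) * character k ?t) \<le> 0" by (simp only: norm_zero order_refl)
  qed (use k in auto)
  then show ?thesis by simp
qed

theorem corollary1p3:
  fixes \<alpha> :: real and m :: nat and vh :: "int \<Rightarrow> complex" and x y g :: real
  assumes "\<alpha> \<notin> \<rat>"
    and "m \<ge> 1"
    and "\<And>t :: real. trig_poly m vh (of_real t) \<in> \<real>"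
    and "vh (int m) \<noteq> 0"
    and "y > dual_gamma \<alpha> m vh m 0"
    and "g = 2 * pi * real m * y + ln (cmod (vh (int m)))"
  shows "emeasure lebesgue (op_spectrum (hop \<alpha> (trig_poly m vh) g (Complex x y))) > 0"
proof -
  have m: "m > 0" using assms(2) by simp
  have conj: "cnj (vh k) = vh (- k)" if "\<bar>k\<bar> \<le> int m" for k
    by (rule coeff_conj_of_real_valued[OF assms(1,3) that])
  have vm: "cmod (vh (- int m)) = cmod (vh (int m))"
    using conj[of "int m"] complex_mod_cnj[of "vh (int m)"] by simp
  have vm0: "vh (- int m) \<noteq> 0" using vm assms(4) by auto
  interpret C: unimodular_cocycle \<alpha> "dual_transfer m vh 0" "2 * m"
    by (rule unimodular_dual_cocycle[OF assms(1) m assms(4) vm])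
  have \<gamma>: "lyapunov_exponent \<alpha> (dual_transfer m vh 0) 1 < y"
    using assms(5) by (simp add: dual_gamma_def)
  have y: "y > 0" using \<gamma> C.lyapunov_exponent_nonneg by linarith
  obtain \<delta> K where \<delta>: "\<delta> > 0" and K: "\<And>e n x. cmod e < \<delta> \<Longrightarrow>
      cmod (cocycle_iterate \<alpha> (dual_transfer m vh e) n x $$ (0, 0)) \<le> K * exp y ^ n"
    using dual_cocycle_growth[OF assms(1) m assms(4) vm \<gamma>] by blast
  let ?\<Sigma> = "op_spectrum (hop \<alpha> (trig_poly m vh) g (Complex x y))"
  \<comment> \<open>The growth rate \<open>exp y\<close> of the dual cocycle stays below \<open>1 / r = exp (2\<pi>y)\<close>.\<close>
  have ball: "E \<in> ?\<Sigma>" if E: "cmod E < \<delta>" for E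
  proof -
    interpret real_dual_expansion \<alpha> m vh E
      by unfold_locales (use m vm0 conj in auto)
    define K' where "K' = K / (cmod (vh (int m)) * exp y ^ m)"
    have "cmod (- cnj E) < \<delta>" using E by simp
    note growth = K[OF this]
    have coeff: "cmod (c p j) \<le> K' * exp y ^ p" for p j
      unfolding K'_def by (rule coeff_bound_of_cocycle_bound[OF assms(1) exp_gt_zero growth])
    have "K' \<ge> 0" using order_trans[OF norm_ge_zero coeff[of 0 0]] by simp
    moreover have "exp y * exp (- 2 * pi * y) < 1"
    proof -
      have "1 * y < 2 * pi * y" using y pi_gt3 by (intro mult_strict_right_mono) auto
      then show ?thesis by (simp add: exp_add[symmetric])
    qed
    ultimately interpret dual_expansion_bounded \<alpha> m vh E K' "exp y" "exp (- 2 * pi * y)"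
      by unfold_locales (use coeff in auto)
    show ?thesis by (rule energy_in_op_spectrum[OF assms(1) refl]) (simp add: assms(6) vm)
  qed
  define v where "v = (\<lambda>n::int. trig_poly m vh (Complex x y + of_int n * of_real \<alpha>))"
  have "cmod (v n) \<le> (\<Sum>k\<in>{- int m..int m}. cmod (vh k) * exp (- 2 * pi * of_int k * y))" for n
    unfolding v_def trig_poly_def by (rule order_trans[OF norm_sum]) (simp add: norm_mult)
  then have "closed (op_spectrum (jacobi (- exp g) (- exp (- g)) v))" by (rule closed_op_spectrum_jacobi)
  moreover have "hop \<alpha> (trig_poly m vh) g (Complex x y) = jacobi (- exp g) (- exp (- g)) v"
    by (intro ext) (simp add: hop_def jacobi_def v_def)
  ultimately have "closed ?\<Sigma>" by (simp only:)
  then have sets: "?\<Sigma> \<in> sets lebesgue" by (simp add: borel_closed)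
  show ?thesis
  proof (rule ccontr)
    assume "\<not> ?thesis"
    then have "?\<Sigma> \<in> null_sets lebesgue" using sets by (simp add: null_sets_def)
    then have "negligible ?\<Sigma>" by (simp add: negligible_iff_null_sets)
    moreover have "ball 0 \<delta> \<subseteq> ?\<Sigma>" using ball by auto
    ultimately have "negligible (ball (0::complex) \<delta>)" by (rule negligible_subset)
    then show False using open_not_negligible[of "ball (0::complex) \<delta>"] \<delta> by simp
  qed
qed

end
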